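(* Let $F$ be a finite graph and $\epsilon>0$. Then the map $W\mapsto\mathsf{til}_\epsilon(F,W)$ is continuous on the space of graphons on $\Omega$ equipped with the cut-norm; that is, whenever graphons $W_n$ satisfy $\|W_n-W\|_\square\to0$, we have $\mathsf{til}_\epsilon(F,W_n)\to\mathsf{til}_\epsilon(F,W)$.
   Context: $(\Omega,\nu)$ is an atomless Borel probability space; a graphon is a symmetric measurable $W:\Omega^2\to[0,1]$. The cut-norm is $\|V\|_\square=\sup_{A,B\subset\Omega}|\int_{A\times B}V|$. Let $F$ have vertex set $[k]$; $W^{\otimes F}(x_1,\dots,x_k)=\prod_{ij\in E(F),i<j}W(x_i,x_j)$, $\mathcal{F}_F(W)=\{W^{\otimes F}\neq0\}$. An $F$-tiling in $W$ is a measurable $\mathfrak{t}:\Omega^k\to[0,\infty)$ with $\{\mathfrak{t}\neq0\}\subset\mathcal{F}_F(W)$ such that for each $x\in\Omega$, $\sum_{\ell=1}^k\int\mathfrak{t}(x_1,\dots,x_{\ell-1},x,x_{\ell+1},\dots,x_k)\,\mathrm{d}\nu^{k-1}\le1$ (integrating over all coordinates except the $\ell$-th); its size is $\int\mathfrak{t}\,\mathrm{d}\nu^k$, and $\mathsf{til}(F,W)$ is the supremum of sizes. The robust tiling number is $\mathsf{til}_\epsilon(F,W)=\inf_U\mathsf{til}(F,W-U)$, the infimum over all graphons $U$ with $U\le W$ and $\|U\|_{\mathcal{L}^1(\Omega^2)}\le\epsilon$. *)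

theory Defs
  imports "HOL-Probability.Probability"
begin

definition atomless_borel_prob :: "'a::polish_space measure \<Rightarrow> bool" where
  "atomless_borel_prob M \<longleftrightarrow> prob_space M \<and> sets M = sets borel \<and>
     (\<forall>A\<in>sets M. measure M A > 0 \<longrightarrow>
        (\<exists>B\<in>sets M. B \<subseteq> A \<and> 0 < measure M B \<and> measure M B < measure M A))"

definition graphon :: "'a measure \<Rightarrow> ('a \<Rightarrow> 'a \<Rightarrow> real) \<Rightarrow> bool" where
  "graphon M W \<longleftrightarrow> (\<lambda>p. W (fst p) (snd p)) \<in> borel_measurable (M \<Otimes>\<^sub>M M) \<and>
     (\<forall>x\<in>space M. \<forall>y\<in>space M. W x y = W y x \<and> 0 \<le> W x y \<and> W x y \<le> 1)"

definition cut_norm :: "'a measure \<Rightarrow> ('a \<Rightarrow> 'a \<Rightarrow> real) \<Rightarrow> real" where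
  "cut_norm M V = (SUP AB \<in> sets M \<times> sets M.
     \<bar>integral\<^sup>L (M \<Otimes>\<^sub>M M) (\<lambda>p. indicator (fst AB \<times> snd AB) p * V (fst p) (snd p))\<bar>)"

text \<open>A graph F on vertex set {0..<k} is given by k and a set E of edges (i,j) with i < j < k.
  The space Omega^k is the product measure PiM {..<k} (\<lambda>_. M).\<close>
definition graph_on :: "nat \<Rightarrow> (nat \<times> nat) set \<Rightarrow> bool" where
  "graph_on k E \<longleftrightarrow> (\<forall>(i,j)\<in>E. i < j \<and> j < k)"

definition tensorF :: "(nat \<times> nat) set \<Rightarrow> ('a \<Rightarrow> 'a \<Rightarrow> real) \<Rightarrow> (nat \<Rightarrow> 'a) \<Rightarrow> real" where
  "tensorF E W x = (\<Prod>(i,j)\<in>E. W (x i) (x j))"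

definition F_support :: "'a measure \<Rightarrow> nat \<Rightarrow> (nat \<times> nat) set \<Rightarrow> ('a \<Rightarrow> 'a \<Rightarrow> real) \<Rightarrow> (nat \<Rightarrow> 'a) set" where
  "F_support M k E W = {x \<in> space (PiM {..<k} (\<lambda>_. M)). tensorF E W x \<noteq> 0}"

text \<open>F-tilings. The integral over all coordinates except the l-th is written as the integral
  over all of Omega^k of t with the l-th coordinate replaced by x (M is a probability measure).\<close>
definition is_tiling :: "'a measure \<Rightarrow> nat \<Rightarrow> (nat \<times> nat) set \<Rightarrow> ('a \<Rightarrow> 'a \<Rightarrow> real)
    \<Rightarrow> ((nat \<Rightarrow> 'a) \<Rightarrow> real) \<Rightarrow> bool" where
  "is_tiling M k E W t \<longleftrightarrow>
     t \<in> borel_measurable (PiM {..<k} (\<lambda>_. M)) \<and>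
     (\<forall>x\<in>space (PiM {..<k} (\<lambda>_. M)). 0 \<le> t x) \<and>
     {x \<in> space (PiM {..<k} (\<lambda>_. M)). t x \<noteq> 0} \<subseteq> F_support M k E W \<and>
     (\<forall>x\<in>space M. (\<Sum>l<k. \<integral>\<^sup>+ y. ennreal (t (y(l := x))) \<partial>(PiM {..<k} (\<lambda>_. M))) \<le> 1)"

definition tiling_size :: "'a measure \<Rightarrow> nat \<Rightarrow> ((nat \<Rightarrow> 'a) \<Rightarrow> real) \<Rightarrow> real" where
  "tiling_size M k t = enn2real (\<integral>\<^sup>+ x. ennreal (t x) \<partial>(PiM {..<k} (\<lambda>_. M)))"

definition til :: "'a measure \<Rightarrow> nat \<Rightarrow> (nat \<times> nat) set \<Rightarrow> ('a \<Rightarrow> 'a \<Rightarrow> real) \<Rightarrow> real" where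
  "til M k E W = (SUP t \<in> {t. is_tiling M k E W t}. tiling_size M k t)"

definition til_eps :: "'a measure \<Rightarrow> real \<Rightarrow> nat \<Rightarrow> (nat \<times> nat) set \<Rightarrow> ('a \<Rightarrow> 'a \<Rightarrow> real) \<Rightarrow> real" where
  "til_eps M eps k E W = (INF U \<in> {U. graphon M U \<and> (\<forall>x\<in>space M. \<forall>y\<in>space M. U x y \<le> W x y) \<and>
        (\<integral>\<^sup>+ p. ennreal \<bar>U (fst p) (snd p)\<bar> \<partial>(M \<Otimes>\<^sub>M M)) \<le> ennreal eps}.
      til M k E (\<lambda>x y. W x y - U x y))"

end

(*
  Lower bounds for til are transferred along cut-norm convergence through Szemeredi regularity.
  Let U' be feasible for W' close to W, put V' = W' - U', and take a partition that is regular for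
  V' and on which W is nearly a step function. Let D be the step function of densities of V' on
  the dense regular pairs. On such pairs the counting lemma holds with errors relative to the cells,
  so any fractional tiling supported by D can be redistributed along the tensor of V' with little
  loss; hence til of D is at most til of V', up to a small error independent of the number of
  cells. Since W' - W is small on every cell, D is nearly below W, and U = W - min(D, W) is
  feasible up to a small excess in the L1 norm. Such an excess is repaired by setting U to 0 on
  the pairs that meet a suitable set of small measure, which raises til by at most that measure;
  this is where eps > 0 and the absence of atoms enter.

  In the other direction a fixed U below W is transferred to U' = W' U / W (and U' = W' where W
  vanishes). The L1 norm of U' tends to that of U, and the support of W' - U' is contained in that
  of W - U, so til cannot increase.
*)
theory Submission
  imports Defs
begin

text \<open>The two directions need different uniformity. For the upper bound one nearly optimal U
  below W is fixed, so the tolerance in cut-norm may depend on U. For the lower bound the competitor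
  U', hence also the regular partition, changes with W', while testing W' - W on a step function
  costs the cut-norm times the sum of the coefficients. The number of cells must therefore be
  bounded before the tolerance is chosen, uniformly in V'; hence the bound K in the regularity
  lemma, which depends only on the accuracy and on the size of the starting partition.

  Tilings see only the support of a kernel, and a support can carry arbitrarily little density.
  Pairs of density below a threshold \<tau> are therefore discarded: in a surviving box the product
  of the densities is at least \<tau> to the power of the number of edges, and the counting error
  has to be small compared with the measure of that single box. A weak partition, with cut-norm
  error on the global scale only, would not give this, which explains the use of full
  regularity.\<close>

section \<open>Bounded measurable functions\<close>

text \<open>Closed under sums, products and composition, so that most integrability goals reduce to
  introduction rules. The bound holds at every point of the space, not almost everywhere, which lets
  \<open>bmeas_compose\<close> accept any measurable map.\<close>

definition bmeas :: "'b measure \<Rightarrow> ('b \<Rightarrow> real) set" where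
  "bmeas N = {f \<in> borel_measurable N. \<exists>C. \<forall>x\<in>space N. \<bar>f x\<bar> \<le> C}"

lemma bmeasI: "f \<in> borel_measurable N \<Longrightarrow> (\<And>x. x \<in> space N \<Longrightarrow> \<bar>f x\<bar> \<le> C) \<Longrightarrow> f \<in> bmeas N"
  unfolding bmeas_def by blast

lemma bmeas_measurable: "f \<in> bmeas N \<Longrightarrow> f \<in> borel_measurable N"
  unfolding bmeas_def by blast

lemma bmeas_const [simp, intro]: "(\<lambda>x. c) \<in> bmeas N"
  by (rule bmeasI[of _ _ "\<bar>c\<bar>"]) auto

lemma bmeas_add [intro]:
  assumes "f \<in> bmeas N" "g \<in> bmeas N" shows "(\<lambda>x. f x + g x) \<in> bmeas N"
proof -
  from assms obtain C D where *: "\<forall>x\<in>space N. \<bar>f x\<bar> \<le> C" "\<forall>x\<in>space N. \<bar>g x\<bar> \<le> D"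
    and [measurable]: "f \<in> borel_measurable N" "g \<in> borel_measurable N"
    unfolding bmeas_def by blast
  show ?thesis
    by (rule bmeasI[of _ _ "C + D"]) (use * in \<open>auto intro!: order_trans[OF abs_triangle_ineq] add_mono\<close>)
qed

lemma bmeas_mult [intro]:
  assumes "f \<in> bmeas N" "g \<in> bmeas N" shows "(\<lambda>x. f x * g x) \<in> bmeas N"
proof -
  from assms obtain C D where *: "\<forall>x\<in>space N. \<bar>f x\<bar> \<le> C" "\<forall>x\<in>space N. \<bar>g x\<bar> \<le> D"
    and [measurable]: "f \<in> borel_measurable N" "g \<in> borel_measurable N"
    unfolding bmeas_def by blast
  show ?thesis
  proof (rule bmeasI[of _ _ "C * D"])
    fix x assume x: "x \<in> space N"
    have "\<bar>f x\<bar> \<le> C" "\<bar>g x\<bar> \<le> D" using * x by auto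
    then show "\<bar>f x * g x\<bar> \<le> C * D"
      unfolding abs_mult by (intro mult_mono) auto
  qed simp
qed

lemma bmeas_uminus [intro]: "f \<in> bmeas N \<Longrightarrow> (\<lambda>x. - f x) \<in> bmeas N"
  unfolding bmeas_def by auto

lemma bmeas_diff [intro]: "f \<in> bmeas N \<Longrightarrow> g \<in> bmeas N \<Longrightarrow> (\<lambda>x. f x - g x) \<in> bmeas N"
  using bmeas_add[of f N "\<lambda>x. - g x"] bmeas_uminus[of g N] by simp

lemma bmeas_abs [intro]: "f \<in> bmeas N \<Longrightarrow> (\<lambda>x. \<bar>f x\<bar>) \<in> bmeas N"
  unfolding bmeas_def by auto

lemma bmeas_sum [intro]: "(\<And>i. i \<in> I \<Longrightarrow> f i \<in> bmeas N) \<Longrightarrow> (\<lambda>x. \<Sum>i\<in>I. f i x) \<in> bmeas N"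
  by (induction I rule: infinite_finite_induct) auto

lemma bmeas_prod [intro]: "(\<And>i. i \<in> I \<Longrightarrow> f i \<in> bmeas N) \<Longrightarrow> (\<lambda>x. \<Prod>i\<in>I. f i x) \<in> bmeas N"
  by (induction I rule: infinite_finite_induct) auto

lemma bmeas_indicator [intro]: "A \<in> sets N \<Longrightarrow> indicator A \<in> bmeas N"
  by (rule bmeasI[of _ _ 1]) (auto split: split_indicator)

lemma bmeas_compose [intro]:
  "f \<in> bmeas N \<Longrightarrow> g \<in> measurable L N \<Longrightarrow> (\<lambda>x. f (g x)) \<in> bmeas L"
  unfolding bmeas_def by (auto dest: measurable_space)

lemma (in finite_measure) bmeas_integrable: "f \<in> bmeas M \<Longrightarrow> integrable M f"
  unfolding bmeas_def by (force intro: integrable_const_bound AE_I2)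

lemma prod_lessThan_remove:
  fixes f :: "nat \<Rightarrow> 'b::comm_monoid_mult"
  assumes "l < k" shows "(\<Prod>i<k. f i) = f l * (\<Prod>i\<in>{..<k}-{l}. f i)"
  using assms by (subst prod.remove[of _ l]) auto

lemma graph_on_finite: "graph_on k E \<Longrightarrow> finite E"
  by (rule finite_subset[of _ "{..<k} \<times> {..<k}"]) (auto simp: graph_on_def)

section \<open>Covers by sets of small measure\<close>

lemma atomless_singleton_null:
  assumes M: "atomless_borel_prob M"
  shows "measure M {x} = 0"
proof (rule ccontr)
  interpret prob_space M using M by (simp add: atomless_borel_prob_def)
  assume "measure M {x} \<noteq> 0"
  then have "measure M {x} > 0" by (simp add: zero_less_measure_iff)
  moreover have "{x} \<in> sets M" using M by (simp add: atomless_borel_prob_def)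
  ultimately obtain B where "B \<subseteq> {x}" "0 < measure M B" "measure M B < measure M {x}"
    using M unfolding atomless_borel_prob_def by blast
  then show False by (cases "B = {}") (auto dest: subset_singletonD)
qed

text \<open>Balls around a point shrink to a null singleton, so every point has an open
  neighbourhood of measure at most \<eta>. Lindelof leaves countably many of them, and by continuity
  of the measure finitely many miss a set of measure below \<eta>. The sets may overlap.\<close>

lemma atomless_finite_cover:
  assumes M: "atomless_borel_prob M" and \<eta>: "(\<eta>::real) > 0"
  shows "\<exists>N D. (\<forall>i<N. D i \<in> sets M \<and> measure M (D i) \<le> \<eta>) \<and> (\<Union>i<N::nat. D i) = UNIV"
proof -
  interpret prob_space M using M by (simp add: atomless_borel_prob_def)
  have sets: "sets M = sets borel" using M by (simp add: atomless_borel_prob_def)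
  then have sp: "space M = UNIV" by (metis sets_eq_imp_space_eq space_borel)
  define \<F> where "\<F> = {U. open U \<and> measure M U \<le> \<eta>}"
  have "\<exists>U\<in>\<F>. x \<in> U" for x
  proof -
    let ?A = "\<lambda>n::nat. ball x (1 / Suc n)"
    have "(\<Inter>n. ?A n) = {x}"
    proof (intro equalityI subsetI)
      fix y assume y: "y \<in> (\<Inter>n. ?A n)"
      have "dist x y < 1 / Suc n" for n using y by auto
      then have "dist x y \<le> 0"
        by (metis (no_types, lifting) less_eq_real_def not_le nat_approx_posE less_trans less_irrefl)
      then show "y \<in> {x}" by simp
    qed simp
    moreover have "decseq ?A"
      unfolding decseq_def by (auto intro!: subset_ball simp: frac_le)
    moreover have "range ?A \<subseteq> sets M" unfolding sets by (simp add: image_subset_iff)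
    ultimately have "(\<lambda>n. measure M (?A n)) \<longlonglongrightarrow> 0"
      using finite_Lim_measure_decseq[of ?A] atomless_singleton_null[OF M, of x] by simp
    then have "eventually (\<lambda>n. measure M (?A n) < \<eta>) sequentially"
      by (rule order_tendstoD) (rule \<eta>)
    then obtain n where "measure M (?A n) < \<eta>" by (auto simp: eventually_sequentially)
    then show ?thesis by (intro bexI[of _ "?A n"]) (auto simp: \<F>_def)
  qed
  then have U: "\<Union>\<F> = UNIV" by auto
  obtain \<F>' where F': "\<F>' \<subseteq> \<F>" "countable \<F>'" "\<Union>\<F>' = UNIV"
    using Lindelof[of \<F>] U by (auto simp: \<F>_def)
  have "\<F>' \<noteq> {}" using F' by auto
  define B where "B = from_nat_into \<F>'"
  have rB: "range B = \<F>'" using F' \<open>\<F>' \<noteq> {}\<close> by (simp add: B_def range_from_nat_into)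
  have B: "B i \<in> sets M" "measure M (B i) \<le> \<eta>" for i
  proof -
    have "B i \<in> \<F>" using F'(1) rB by auto
    then show "B i \<in> sets M" "measure M (B i) \<le> \<eta>" by (auto simp: \<F>_def sets)
  qed
  let ?C = "\<lambda>n. \<Union>i<n. B i"
  have "(\<lambda>n. measure M (?C n)) \<longlonglongrightarrow> measure M (\<Union>n. ?C n)"
    using B by (intro finite_Lim_measure_incseq) (auto intro!: incseq_SucI simp: lessThan_Suc)
  also have "(\<Union>n. ?C n) = space M"
  proof -
    have "x \<in> (\<Union>n. ?C n)" for x
    proof -
      obtain i where "x \<in> B i" using rB F' by blast
      then show ?thesis by (intro UN_I[of "Suc i"] UN_I[of i]) auto
    qed
    then show ?thesis unfolding sp by blast
  qed
  finally have "(\<lambda>n. measure M (?C n)) \<longlonglongrightarrow> 1" by (simp only: prob_space)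
  then have "eventually (\<lambda>n. measure M (?C n) > 1 - \<eta>) sequentially"
    by (rule order_tendstoD) (use \<eta> in simp)
  then obtain n where n: "measure M (?C n) > 1 - \<eta>" by (auto simp: eventually_sequentially)
  \<comment> \<open>The uncovered remainder becomes the last of the \<open>Suc n\<close>
    sets.\<close>
  define D where "D i = (if i < n then B i else - ?C n)" for i
  have "- ?C n = space M - ?C n" using sp by auto
  moreover have "?C n \<in> sets M" using B by auto
  ultimately have "- ?C n \<in> sets M" "measure M (- ?C n) \<le> \<eta>" using n by (auto simp: prob_compl)
  then have "\<forall>i<Suc n. D i \<in> sets M \<and> measure M (D i) \<le> \<eta>" using B by (auto simp: D_def)
  moreover have "(\<Union>i<Suc n. D i) = UNIV"
  proof (intro equalityI subsetI UNIV_I)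
    fix x show "x \<in> (\<Union>i<Suc n. D i)"
    proof (cases "x \<in> ?C n")
      case True
      then obtain i where "i < n" "x \<in> B i" by auto
      then show ?thesis by (intro UN_I[of i]) (auto simp: D_def)
    next
      case False
      then show ?thesis by (intro UN_I[of n]) (auto simp: D_def)
    qed
  qed
  ultimately show ?thesis by blast
qed

section \<open>Tilings\<close>

text \<open>The point type carries no topology here: what atomlessness contributes is
  \<open>atomless_finite_cover\<close>, which enters later as the hypothesis \<open>cover\<close>.
  The full space removes membership conditions on points.\<close>

locale full_prob_space = prob_space M for M :: "'a measure" +
  assumes space_UNIV [simp]: "space M = UNIV"
begin

sublocale pair: pair_prob_space M M ..

lemma product_sigma_finite_M: "product_sigma_finite (\<lambda>_::nat. M)"
  by unfold_locales

abbreviation Pw :: "nat \<Rightarrow> (nat \<Rightarrow> 'a) measure" where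
  "Pw k \<equiv> PiM {..<k} (\<lambda>_. M)"

lemma prob_space_Pw: "prob_space (Pw k)"
  by (intro prob_space_PiM prob_space_axioms)

lemma measurable_update_pair [measurable]:
  "l < k \<Longrightarrow> (\<lambda>p. (snd p)(l := fst p)) \<in> measurable (M \<Otimes>\<^sub>M Pw k) (Pw k)"
  by (rule measurable_fun_upd[where J="{..<k}"]) auto

lemma measurable_update_tuple [measurable]:
  "l < k \<Longrightarrow> (\<lambda>y. y(l := x)) \<in> measurable (Pw k) (Pw k)"
  by (rule measurable_fun_upd[where J="{..<k}"]) auto

lemma measurable_update_point [measurable]:
  "l < k \<Longrightarrow> y \<in> space (Pw k) \<Longrightarrow> (\<lambda>x. y(l := x)) \<in> measurable M (Pw k)"
  by (rule measurable_fun_upd[where J="{..<k}"]) auto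

lemma space_Pw_update: "y \<in> space (Pw k) \<Longrightarrow> l < k \<Longrightarrow> y(l := x) \<in> space (Pw k)"
  by (auto simp: space_PiM PiE_def extensional_def)

text \<open>Overwriting coordinate l by an independent point preserves the product law. This
  replaces a splitting of the index set and fits \<open>is_tiling\<close>, where the integral runs
  over all k coordinates and one of them is overwritten.\<close>

lemma distr_update:
  assumes l: "l < k"
  shows "distr (M \<Otimes>\<^sub>M Pw k) (Pw k) (\<lambda>p. (snd p)(l := fst p)) = Pw k"
proof (rule product_sigma_finite.PiM_eqI[OF product_sigma_finite_M])
  fix A assume A: "\<And>i. i \<in> {..<k} \<Longrightarrow> A i \<in> sets M"
  interpret P: prob_space "Pw k" by (rule prob_space_Pw)
  \<comment> \<open>The old l-th coordinate is forgotten, so it is left unconstrained and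
    contributes the factor 1.\<close>
  let ?B = "\<lambda>i. if i = l then UNIV else A i"
  have B: "?B i \<in> sets M" if "i \<in> {..<k}" for i
    using A that sets.top[of M] by auto
  have eq: "(\<lambda>p. (snd p)(l := fst p)) -` PiE {..<k} A \<inter> space (M \<Otimes>\<^sub>M Pw k) = A l \<times> PiE {..<k} ?B"
    (is "?L = ?R")
  proof (intro set_eqI iffI)
    fix p assume "p \<in> ?L"
    then obtain x y where p: "p = (x, y)" and *: "y \<in> extensional {..<k}" "y(l := x) \<in> PiE {..<k} A"
      by (cases p) (auto simp: space_pair_measure space_PiM PiE_iff)
    have "y i \<in> A i" if "i < k" "i \<noteq> l" for i
      using PiE_mem[OF *(2), of i] that by simp
    moreover have "x \<in> A l" using PiE_mem[OF *(2), of l] l by simp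
    ultimately show "p \<in> ?R" using * p by (auto simp: PiE_iff)
  next
    fix p assume "p \<in> ?R"
    then obtain x y where p: "p = (x, y)" and *: "x \<in> A l" "y \<in> PiE {..<k} ?B"
      by auto
    have "y i \<in> A i" if "i < k" "i \<noteq> l" for i
      using PiE_mem[OF *(2), of i] that by simp
    with * l p show "p \<in> ?L"
      by (auto simp: PiE_iff extensional_def space_pair_measure space_PiM)
  qed
  have "emeasure (distr (M \<Otimes>\<^sub>M Pw k) (Pw k) (\<lambda>p. (snd p)(l := fst p))) (PiE {..<k} A) =
      emeasure (M \<Otimes>\<^sub>M Pw k) (A l \<times> PiE {..<k} ?B)"
    unfolding eq[symmetric] using A
    by (intro emeasure_distr measurable_update_pair l sets_PiM_I_finite) auto
  also have "\<dots> = emeasure M (A l) * emeasure (Pw k) (PiE {..<k} ?B)"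
    using A l B by (intro P.emeasure_pair_measure_Times sets_PiM_I_finite) auto
  also have "emeasure (Pw k) (PiE {..<k} ?B) = (\<Prod>i<k. emeasure M (?B i))"
    using B by (intro product_sigma_finite.emeasure_PiM[OF product_sigma_finite_M]) auto
  also have "\<dots> = (\<Prod>i\<in>{..<k}-{l}. emeasure M (A i))"
    using l emeasure_space_1 by (subst prod_lessThan_remove[of l]) (auto intro!: prod.cong)
  finally show "emeasure (distr (M \<Otimes>\<^sub>M Pw k) (Pw k) (\<lambda>p. (snd p)(l := fst p))) (PiE {..<k} A)
      = (\<Prod>i\<in>{..<k}. emeasure M (A i))"
    unfolding prod_lessThan_remove[OF l] .
qed auto

lemma nn_integral_update:
  assumes l: "l < k" and f [measurable]: "f \<in> borel_measurable (Pw k)"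
  shows "(\<integral>\<^sup>+ x. \<integral>\<^sup>+ y. f (y(l := x)) \<partial>Pw k \<partial>M) = (\<integral>\<^sup>+ z. f z \<partial>Pw k)"
proof -
  interpret P: prob_space "Pw k" by (rule prob_space_Pw)
  have "(\<integral>\<^sup>+ z. f z \<partial>Pw k) = (\<integral>\<^sup>+ p. f ((snd p)(l := fst p)) \<partial>(M \<Otimes>\<^sub>M Pw k))"
    using l by (subst (1) distr_update[OF l, symmetric]) (simp add: nn_integral_distr)
  also have "\<dots> = (\<integral>\<^sup>+ x. \<integral>\<^sup>+ y. f (y(l := x)) \<partial>Pw k \<partial>M)"
    using l by (subst P.nn_integral_fst[symmetric]) simp_all
  finally show ?thesis ..
qed

text \<open>Both orders of integration occur later: the first yields the marginal of one coordinate,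
  the second integrates out the endpoints of an edge in the counting lemma.\<close>

lemma integral_update:
  assumes l: "l < k" and f: "f \<in> bmeas (Pw k)"
  shows "(\<integral> x. \<integral> y. f (y(l := x)) \<partial>Pw k \<partial>M) = (\<integral> z. f z \<partial>Pw k)"
    and "(\<integral> y. \<integral> x. f (y(l := x)) \<partial>M \<partial>Pw k) = (\<integral> z. f z \<partial>Pw k)"
proof -
  interpret P: prob_space "Pw k" by (rule prob_space_Pw)
  interpret PP: pair_prob_space M "Pw k" ..
  have [measurable]: "f \<in> borel_measurable (Pw k)" using f by (rule bmeas_measurable)
  have 1: "(\<integral> z. f z \<partial>Pw k) = (\<integral> p. f ((snd p)(l := fst p)) \<partial>(M \<Otimes>\<^sub>M Pw k))"
    using l by (subst (1) distr_update[OF l, symmetric]) (simp add: integral_distr)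
  have 2: "integrable (M \<Otimes>\<^sub>M Pw k) (\<lambda>p. f ((snd p)(l := fst p)))"
    using bmeas_compose[OF f measurable_update_pair[OF l]] by (rule PP.P.bmeas_integrable)
  show "(\<integral> x. \<integral> y. f (y(l := x)) \<partial>Pw k \<partial>M) = (\<integral> z. f z \<partial>Pw k)"
    using PP.integral_fst'[OF 2] 1 by simp
  show "(\<integral> y. \<integral> x. f (y(l := x)) \<partial>M \<partial>Pw k) = (\<integral> z. f z \<partial>Pw k)"
    using PP.integral_snd[of "\<lambda>x y. f (y(l := x))"] 2 1 by (simp add: split_beta')
qed

lemma bmeas_update_integral:
  assumes l: "l < k" and f: "f \<in> bmeas (Pw k)"
  shows "(\<lambda>y. \<integral> x. f (y(l := x)) \<partial>M) \<in> bmeas (Pw k)" and "(\<lambda>x. \<integral> y. f (y(l := x)) \<partial>Pw k) \<in> bmeas M"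
proof -
  interpret P: prob_space "Pw k" by (rule prob_space_Pw)
  obtain C where C: "\<And>x. x \<in> space (Pw k) \<Longrightarrow> \<bar>f x\<bar> \<le> C" using f unfolding bmeas_def by blast
  have [measurable]: "f \<in> borel_measurable (Pw k)" using f by (rule bmeas_measurable)
  have [measurable]: "(\<lambda>p. (fst p)(l := snd p)) \<in> measurable (Pw k \<Otimes>\<^sub>M M) (Pw k)"
    using l by (intro measurable_fun_upd[where J="{..<k}"]) auto
  show "(\<lambda>y. \<integral> x. f (y(l := x)) \<partial>M) \<in> bmeas (Pw k)"
  proof (rule bmeasI)
    fix y assume y: "y \<in> space (Pw k)"
    have "\<bar>\<integral> x. f (y(l := x)) \<partial>M\<bar> \<le> (\<integral> x. \<bar>f (y(l := x))\<bar> \<partial>M)" by (rule integral_abs_bound)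
    also have "\<dots> \<le> (\<integral> x. C \<partial>M)"
      using y l C space_Pw_update[OF y l]
      by (intro integral_mono bmeas_integrable bmeas_abs bmeas_compose[OF f]) auto
    finally show "\<bar>\<integral> x. f (y(l := x)) \<partial>M\<bar> \<le> C" by (simp add: prob_space[simplified])
  qed measurable
  show "(\<lambda>x. \<integral> y. f (y(l := x)) \<partial>Pw k) \<in> bmeas M"
  proof (rule bmeasI)
    fix x
    have "\<bar>\<integral> y. f (y(l := x)) \<partial>Pw k\<bar> \<le> (\<integral> y. \<bar>f (y(l := x))\<bar> \<partial>Pw k)" by (rule integral_abs_bound)
    also have "\<dots> \<le> (\<integral> x. C \<partial>Pw k)"
      using l C space_Pw_update[OF _ l]
      by (intro integral_mono P.bmeas_integrable bmeas_abs bmeas_compose[OF f]) auto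
    finally show "\<bar>\<integral> y. f (y(l := x)) \<partial>Pw k\<bar> \<le> C" by (simp add: P.prob_space)
  qed (use l in measurable)
qed

text \<open>The vertex constraint at x, integrated over x in A. A tuple is counted once for each
  coordinate in A, so the bound covers all tuples that meet A. The cost of deleting a set and the
  comparison with cell measures both come from here.\<close>

lemma tiling_marginal:
  assumes t: "is_tiling M k E W t" and A: "A \<in> sets M"
  shows "(\<Sum>l<k. \<integral>\<^sup>+ z. ennreal (t z) * indicator A (z l) \<partial>Pw k) \<le> emeasure M A"
proof -
  have [measurable]: "t \<in> borel_measurable (Pw k)" using t by (simp add: is_tiling_def)
  note A[measurable]
  have comp: "(\<lambda>z. z l) \<in> measurable (Pw k) M" if "l < k" for l
    using that by (intro measurable_component_singleton) auto
  have "(\<Sum>l<k. \<integral>\<^sup>+ z. ennreal (t z) * indicator A (z l) \<partial>Pw k)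
      = (\<Sum>l<k. \<integral>\<^sup>+ x. (\<integral>\<^sup>+ y. ennreal (t (y(l := x))) \<partial>Pw k) * indicator A x \<partial>M)"
  proof (rule sum.cong[OF refl])
    fix l assume "l \<in> {..<k}"
    then have l: "l < k" by simp
    have [measurable]: "(\<lambda>z. z l) \<in> measurable (Pw k) M" using comp[OF l] .
    have "(\<integral>\<^sup>+ z. ennreal (t z) * indicator A (z l) \<partial>Pw k)
      = (\<integral>\<^sup>+ x. \<integral>\<^sup>+ y. ennreal (t (y(l := x))) * indicator A x \<partial>Pw k \<partial>M)"
      using l by (subst nn_integral_update[OF l, symmetric]) simp_all
    also have "\<dots> = (\<integral>\<^sup>+ x. (\<integral>\<^sup>+ y. ennreal (t (y(l := x))) \<partial>Pw k) * indicator A x \<partial>M)"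
      using l by (intro nn_integral_cong nn_integral_multc) measurable
    finally show "(\<integral>\<^sup>+ z. ennreal (t z) * indicator A (z l) \<partial>Pw k)
      = (\<integral>\<^sup>+ x. (\<integral>\<^sup>+ y. ennreal (t (y(l := x))) \<partial>Pw k) * indicator A x \<partial>M)" .
  qed
  also have "\<dots> = (\<integral>\<^sup>+ x. (\<Sum>l<k. \<integral>\<^sup>+ y. ennreal (t (y(l := x))) \<partial>Pw k) * indicator A x \<partial>M)"
  proof -
    interpret P: prob_space "Pw k" by (rule prob_space_Pw)
    have "(\<lambda>x. (\<integral>\<^sup>+ y. ennreal (t (y(l := x))) \<partial>Pw k) * indicator A x) \<in> borel_measurable M"
      if "l \<in> {..<k}" for l
    proof -
      have l: "l < k" using that by simp
      have "(\<lambda>p. t ((snd p)(l := fst p))) \<in> borel_measurable (M \<Otimes>\<^sub>M Pw k)"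
        using l by measurable
      then show ?thesis by (auto simp: split_beta' intro!: borel_measurable_times_ennreal P.borel_measurable_nn_integral)
    qed
    then show ?thesis
      unfolding sum_distrib_right by (subst nn_integral_sum) auto
  qed
  also have "\<dots> \<le> (\<integral>\<^sup>+ x. 1 * indicator A x \<partial>M)"
    using t unfolding is_tiling_def by (intro nn_integral_mono mult_right_mono) auto
  also have "\<dots> = emeasure M A" by simp
  finally show ?thesis .
qed

text \<open>With A the whole space, the summand of coordinate 0 alone is the full mass. Thus a graph
  with a vertex has tilings of bounded size, and the supremum in \<open>til\<close> is
  meaningful.\<close>

lemma tiling_total:
  assumes t: "is_tiling M k E W t" and k: "k \<ge> 1"
  shows "(\<integral>\<^sup>+ z. ennreal (t z) \<partial>Pw k) \<le> 1"
proof -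
  have "(\<integral>\<^sup>+ z. ennreal (t z) \<partial>Pw k) \<le> (\<Sum>l<k. \<integral>\<^sup>+ z. ennreal (t z) * indicator UNIV (z l) \<partial>Pw k)"
    using k member_le_sum[of 0 "{..<k}" "\<lambda>l. \<integral>\<^sup>+ z. ennreal (t z) * indicator UNIV (z l) \<partial>Pw k"] by simp
  also have "\<dots> \<le> emeasure M UNIV" using sets.top[of M] by (intro tiling_marginal[OF t]) simp
  finally show ?thesis using emeasure_space_1 by simp
qed

lemma tiling_size_le_1: "is_tiling M k E W t \<Longrightarrow> k \<ge> 1 \<Longrightarrow> tiling_size M k t \<le> 1"
  unfolding tiling_size_def using tiling_total[of k E W t] by (metis enn2real_mono enn2real_1 ennreal_one_less_top)

lemma tiling_le_til:
  assumes "is_tiling M k E W t" "k \<ge> 1" shows "tiling_size M k t \<le> til M k E W"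
  unfolding til_def
  by (rule cSUP_upper) (use assms tiling_size_le_1 in \<open>auto intro!: bdd_aboveI2[of _ _ 1]\<close>)

lemma zero_tiling: "is_tiling M k E W (\<lambda>_. 0)"
  by (simp add: is_tiling_def)

lemma til_leI:
  assumes "\<And>t. is_tiling M k E W t \<Longrightarrow> tiling_size M k t \<le> c" shows "til M k E W \<le> c"
  unfolding til_def using zero_tiling by (intro cSUP_least) (auto intro: assms)

lemma til_nonneg: "k \<ge> 1 \<Longrightarrow> 0 \<le> til M k E W"
  using tiling_le_til[OF zero_tiling[of k E W]] by (simp add: tiling_size_def)

text \<open>A tiling in W is cut down to the tuples that avoid D. These lie in the support of W',
  and \<open>tiling_marginal\<close> bounds the lost mass by the measure of D.\<close>

lemma til_le_off:
  assumes k: "k \<ge> 1" and E: "graph_on k E" and D: "D \<in> sets M"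
    and sub: "\<And>x y. x \<notin> D \<Longrightarrow> y \<notin> D \<Longrightarrow> W x y \<noteq> 0 \<Longrightarrow> W' x y \<noteq> 0"
  shows "til M k E W \<le> til M k E W' + measure M D"
proof (rule til_leI)
  fix t assume t: "is_tiling M k E W t"
  note [measurable] = D
  have [measurable]: "t \<in> borel_measurable (Pw k)" using t by (simp add: is_tiling_def)
  have comp [measurable]: "(\<lambda>z. z l) \<in> measurable (Pw k) M" if "l < k" for l
    using that by (intro measurable_component_singleton) auto
  define r where "r z = t z * (\<Prod>i<k. indicator (-D) (z i))" for z
  have Dc [measurable]: "- D \<in> sets M" using D sets.compl_sets[of D M] by (simp add: Compl_eq_Diff_UNIV)
  have r01: "0 \<le> (\<Prod>i<k. indicator (-D) (z i) :: real)" "(\<Prod>i<k. indicator (-D) (z i) :: real) \<le> 1" for z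
    by (auto intro!: prod_nonneg prod_le_1 split: split_indicator)
  have tn: "0 \<le> t z" if "z \<in> space (Pw k)" for z using t that by (simp add: is_tiling_def)
  have rt: "0 \<le> r z" "r z \<le> t z" if "z \<in> space (Pw k)" for z
    using tn[OF that] r01[of z] by (auto simp: r_def intro!: mult_right_le_one_le)
  have fin: "finite E" using E by (rule graph_on_finite)
  have rm [measurable]: "r \<in> borel_measurable (Pw k)"
    unfolding r_def by (intro borel_measurable_times borel_measurable_prod measurable_compose[OF comp]) auto
  have r: "is_tiling M k E W' r"
    unfolding is_tiling_def
  proof (intro conjI ballI)
    show "{x \<in> space (Pw k). r x \<noteq> 0} \<subseteq> F_support M k E W'"
    proof safe
      fix z assume z: "z \<in> space (Pw k)" "r z \<noteq> 0"
      then have "t z \<noteq> 0" and nD: "\<And>i. i < k \<Longrightarrow> z i \<notin> D"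
        by (auto simp: r_def indicator_def split: if_splits)
      then have "z \<in> F_support M k E W" using t z unfolding is_tiling_def by auto
      then have "W (z i) (z j) \<noteq> 0" if "(i, j) \<in> E" for i j
        using fin that by (auto simp: F_support_def tensorF_def)
      then have "W' (z i) (z j) \<noteq> 0" if "(i, j) \<in> E" for i j
        using that E sub nD unfolding graph_on_def by (metis (mono_tags, lifting) case_prodD less_trans)
      then show "z \<in> F_support M k E W'" using fin z by (auto simp: F_support_def tensorF_def)
    qed
    fix x assume "x \<in> space M"
    have "(\<Sum>l<k. \<integral>\<^sup>+ y. ennreal (r (y(l := x))) \<partial>Pw k) \<le> (\<Sum>l<k. \<integral>\<^sup>+ y. ennreal (t (y(l := x))) \<partial>Pw k)"
      by (intro sum_mono nn_integral_mono ennreal_leI rt(2) space_Pw_update) auto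
    also have "\<dots> \<le> 1" using t by (auto simp: is_tiling_def)
    finally show "(\<Sum>l<k. \<integral>\<^sup>+ y. ennreal (r (y(l := x))) \<partial>Pw k) \<le> 1" .
  qed (auto intro: rt)
  \<comment> \<open>A tuple meeting D is charged to a coordinate that lies in D.\<close>
  have pt: "t z \<le> r z + (\<Sum>l<k. t z * indicator D (z l))" if "z \<in> space (Pw k)" for z
  proof (cases "\<exists>l<k. z l \<in> D")
    case True
    then obtain l where l: "l < k" "z l \<in> D" by auto
    have "t z * indicator D (z l) \<le> (\<Sum>l<k. t z * indicator D (z l))"
      using l tn[OF that] by (intro member_le_sum) auto
    then show ?thesis using l rt[OF that] by simp
  next
    case False
    then have "r z = t z" by (auto simp: r_def)
    then show ?thesis using False by auto
  qed
  have "(\<integral>\<^sup>+ z. ennreal (t z) \<partial>Pw k) \<le> (\<integral>\<^sup>+ z. ennreal (r z) + (\<Sum>l<k. ennreal (t z) * indicator D (z l)) \<partial>Pw k)"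
  proof (rule nn_integral_mono)
    fix z assume z: "z \<in> space (Pw k)"
    have "ennreal (t z) \<le> ennreal (r z + (\<Sum>l<k. t z * indicator D (z l)))" using pt[OF z] by (rule ennreal_leI)
    also have "\<dots> = ennreal (r z) + (\<Sum>l<k. ennreal (t z * indicator D (z l)))"
      using rt[OF z] tn[OF z] by (subst ennreal_plus) (auto intro!: sum_nonneg)
    also have "(\<Sum>l<k. ennreal (t z * indicator D (z l))) = (\<Sum>l<k. ennreal (t z) * indicator D (z l))"
      using tn[OF z] by (intro sum.cong) (auto split: split_indicator)
    finally show "ennreal (t z) \<le> ennreal (r z) + (\<Sum>l<k. ennreal (t z) * indicator D (z l))" .
  qed
  also have "\<dots> = (\<integral>\<^sup>+ z. ennreal (r z) \<partial>Pw k) + (\<Sum>l<k. \<integral>\<^sup>+ z. ennreal (t z) * indicator D (z l) \<partial>Pw k)"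
    by (subst nn_integral_add) (auto simp: nn_integral_sum simp del: sum_mult_indicator sum_indicator_mult
        sum_mult_of_bool_eq sum_of_bool_mult_eq intro!: borel_measurable_sum)
  also have "\<dots> \<le> (\<integral>\<^sup>+ z. ennreal (r z) \<partial>Pw k) + emeasure M D"
    by (intro add_left_mono tiling_marginal[OF t] D)
  finally have le: "(\<integral>\<^sup>+ z. ennreal (t z) \<partial>Pw k) \<le> (\<integral>\<^sup>+ z. ennreal (r z) \<partial>Pw k) + emeasure M D" .
  have fr: "(\<integral>\<^sup>+ z. ennreal (r z) \<partial>Pw k) < \<infinity>"
    using tiling_total[OF r k] by (metis ennreal_one_less_top infinity_ennreal_def le_less_trans)
  have "tiling_size M k t \<le> enn2real ((\<integral>\<^sup>+ z. ennreal (r z) \<partial>Pw k) + emeasure M D)"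
    unfolding tiling_size_def using fr by (intro enn2real_mono le) (auto simp: less_top emeasure_eq_measure)
  also have "\<dots> = tiling_size M k r + measure M D"
    unfolding tiling_size_def measure_def using fr by (intro enn2real_plus) (auto simp: less_top emeasure_eq_measure)
  also have "\<dots> \<le> til M k E W' + measure M D" using tiling_le_til[OF r k] by simp
  finally show "tiling_size M k t \<le> til M k E W' + measure M D" .
qed

lemma til_mono_support:
  assumes "k \<ge> 1" "graph_on k E" "\<And>x y. W x y \<noteq> 0 \<Longrightarrow> W' x y \<noteq> 0"
  shows "til M k E W \<le> til M k E W'"
  using til_le_off[of k E "{}" W W'] assms by simp

section \<open>The robust tiling number\<close>

abbreviation MM :: "('a \<times> 'a) measure" where "MM \<equiv> M \<Otimes>\<^sub>M M"

abbreviation dint :: "('a \<Rightarrow> 'a \<Rightarrow> real) \<Rightarrow> real" where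
  "dint H \<equiv> (\<integral>p. H (fst p) (snd p) \<partial>MM)"

abbreviation rect :: "'a set \<Rightarrow> 'a set \<Rightarrow> ('a \<Rightarrow> 'a \<Rightarrow> real) \<Rightarrow> real" where
  "rect A B H \<equiv> (\<integral>p. indicator A (fst p) * indicator B (snd p) * H (fst p) (snd p) \<partial>MM)"

lemma space_MM [simp]: "space MM = UNIV" by (simp add: space_pair_measure)

lemma integrable_MM: "f \<in> bmeas MM \<Longrightarrow> integrable MM f"
  by (rule pair.P.bmeas_integrable)

lemma bmeas_fst [intro]: "f \<in> bmeas M \<Longrightarrow> (\<lambda>p. f (fst p)) \<in> bmeas MM"
  by (rule bmeas_compose) auto

lemma bmeas_snd [intro]: "f \<in> bmeas M \<Longrightarrow> (\<lambda>p. f (snd p)) \<in> bmeas MM"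
  by (rule bmeas_compose) auto

lemma graphon_bmeas: "graphon M W \<Longrightarrow> (\<lambda>p. W (fst p) (snd p)) \<in> bmeas MM"
  unfolding graphon_def by (auto intro!: bmeasI[of _ _ 1])

lemma graphonD:
  assumes "graphon M W"
  shows "W x y = W y x" "0 \<le> W x y" "W x y \<le> 1"
  using assms by (auto simp: graphon_def)

lemma nn_dint_le_iff:
  assumes "graphon M U" "e \<ge> 0"
  shows "(\<integral>\<^sup>+ p. ennreal \<bar>U (fst p) (snd p)\<bar> \<partial>MM) \<le> ennreal e \<longleftrightarrow> dint U \<le> e"
proof -
  have "(\<integral>\<^sup>+ p. ennreal \<bar>U (fst p) (snd p)\<bar> \<partial>MM) = (\<integral>\<^sup>+ p. ennreal (U (fst p) (snd p)) \<partial>MM)"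
    using graphonD[OF assms(1)] by simp
  also have "\<dots> = ennreal (dint U)"
    using graphonD[OF assms(1)] graphon_bmeas[OF assms(1)] by (intro nn_integral_eq_integral integrable_MM) auto
  finally show ?thesis using assms(2) by simp
qed

lemma til_eps_le:
  assumes "k \<ge> 1" "graphon M U" "\<And>x y. U x y \<le> W x y" "dint U \<le> e" "e \<ge> 0"
  shows "til_eps M e k E W \<le> til M k E (\<lambda>x y. W x y - U x y)"
  unfolding til_eps_def
proof (rule cINF_lower)
  show "bdd_below ((\<lambda>U. til M k E (\<lambda>x y. W x y - U x y)) `
     {U. graphon M U \<and> (\<forall>x\<in>space M. \<forall>y\<in>space M. U x y \<le> W x y) \<and>
        (\<integral>\<^sup>+ p. ennreal \<bar>U (fst p) (snd p)\<bar> \<partial>MM) \<le> ennreal e})"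
    by (rule bdd_belowI2[of _ 0]) (use til_nonneg assms in auto)
qed (use assms nn_dint_le_iff in auto)

lemma til_eps_geI:
  assumes "graphon M W" "e \<ge> 0"
    "\<And>U. graphon M U \<Longrightarrow> (\<And>x y. U x y \<le> W x y) \<Longrightarrow> dint U \<le> e \<Longrightarrow>
      c \<le> til M k E (\<lambda>x y. W x y - U x y)"
  shows "c \<le> til_eps M e k E W"
  unfolding til_eps_def
proof (rule cINF_greatest)
  have "(\<lambda>x y. 0) \<in> {U. graphon M U \<and> (\<forall>x\<in>space M. \<forall>y\<in>space M. U x y \<le> W x y) \<and>
        (\<integral>\<^sup>+ p. ennreal \<bar>U (fst p) (snd p)\<bar> \<partial>MM) \<le> ennreal e}"
    using graphonD[OF assms(1)] by (auto simp: graphon_def)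
  then show "{U. graphon M U \<and> (\<forall>x\<in>space M. \<forall>y\<in>space M. U x y \<le> W x y) \<and>
        (\<integral>\<^sup>+ p. ennreal \<bar>U (fst p) (snd p)\<bar> \<partial>MM) \<le> ennreal e} \<noteq> {}" by blast
qed (use assms nn_dint_le_iff in auto)

text \<open>If U exceeds eps in L1, the strips over the N sets of the cover carry more than eps
  altogether, so one of them carries at least eps / N. Erasing U on that strip and its mirror image
  repairs an excess of up to eps / N. As N depends only on eta, one constant c serves all W and
  U.\<close>

lemma til_eps_excess:
  assumes cover: "\<And>\<eta>::real. \<eta> > 0 \<Longrightarrow>
      \<exists>N D. (\<forall>i<N. D i \<in> sets M \<and> measure M (D i) \<le> \<eta>) \<and> (\<Union>i<N::nat. D i) = UNIV"
    and k: "k \<ge> 1" and E: "graph_on k E" and eps: "eps > 0" and eta: "(eta::real) > 0"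
  shows "\<exists>c>0. \<forall>W U. graphon M W \<longrightarrow> graphon M U \<longrightarrow> (\<forall>x y. U x y \<le> W x y) \<longrightarrow> dint U \<le> eps + c \<longrightarrow>
      til_eps M eps k E W \<le> til M k E (\<lambda>x y. W x y - U x y) + eta"
proof -
  obtain N D where D: "\<And>i. i < N \<Longrightarrow> D i \<in> sets M" "\<And>i. i < N \<Longrightarrow> measure M (D i) \<le> eta"
    and UN: "(\<Union>i<N::nat. D i) = UNIV"
    using cover[OF eta] by blast
  have N: "N > 0" using UN by (cases N) auto
  show ?thesis
  proof (intro exI[of _ "eps / N"] conjI allI impI)
    show "eps / real N > 0" using eps N by simp
    fix W U assume W: "graphon M W" and U: "graphon M U" and UW: "\<forall>x y. U x y \<le> W x y"
      and le: "dint U \<le> eps + eps / real N"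
    show "til_eps M eps k E W \<le> til M k E (\<lambda>x y. W x y - U x y) + eta"
    proof (cases "dint U \<le> eps")
      case True
      then show ?thesis using til_eps_le[OF k U _ True, of W E] UW eps eta by simp
    next
      case False
      note Ub = graphon_bmeas[OF U]
      have Ib: "(\<lambda>p. indicator (D i) (fst p) * U (fst p) (snd p)) \<in> bmeas MM" if "i < N" for i
        using that by (intro bmeas_mult Ub bmeas_fst bmeas_indicator D)
      \<comment> \<open>Only an inequality, as the sets of the cover may overlap.\<close>
      have "dint U \<le> (\<integral>p. (\<Sum>i<N. indicator (D i) (fst p) * U (fst p) (snd p)) \<partial>MM)"
      proof (rule integral_mono)
        fix p :: "'a \<times> 'a"
        from UN obtain i where i: "i < N" "fst p \<in> D i" by blast
        have "indicator (D i) (fst p) * U (fst p) (snd p) \<le> (\<Sum>i<N. indicator (D i) (fst p) * U (fst p) (snd p))"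
          using i graphonD[OF U] by (intro member_le_sum) auto
        then show "U (fst p) (snd p) \<le> (\<Sum>i<N. indicator (D i) (fst p) * U (fst p) (snd p))"
          using i by simp
      next
        show "integrable MM (\<lambda>p. \<Sum>i<N. indicator (D i) (fst p) * U (fst p) (snd p))"
          by (rule Bochner_Integration.integrable_sum) (use Ib in \<open>auto intro: integrable_MM\<close>)
      qed (intro integrable_MM Ub)
      also have "\<dots> = (\<Sum>i<N. \<integral>p. indicator (D i) (fst p) * U (fst p) (snd p) \<partial>MM)"
        using Ib by (intro Bochner_Integration.integral_sum integrable_MM) auto
      finally have sum: "eps < (\<Sum>i<N. \<integral>p. indicator (D i) (fst p) * U (fst p) (snd p) \<partial>MM)" using False by simp
      have "\<exists>i<N. eps / N \<le> (\<integral>p. indicator (D i) (fst p) * U (fst p) (snd p) \<partial>MM)"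
      proof (rule ccontr)
        assume "\<not> ?thesis"
        then have "(\<Sum>i<N. \<integral>p. indicator (D i) (fst p) * U (fst p) (snd p) \<partial>MM) \<le> (\<Sum>i<N. eps / N)"
          by (intro sum_mono) force
        then show False using sum N by simp
      qed
      then obtain i where i: "i < N" and big: "eps / N \<le> (\<integral>p. indicator (D i) (fst p) * U (fst p) (snd p) \<partial>MM)"
        by blast
      define I where "I x = (indicator (- D i) x :: real)" for x
      \<comment> \<open>Vanishing on both strips keeps U' symmetric.\<close>
      define U' where "U' x y = I x * I y * U x y" for x y
      have "- D i \<in> sets M" using D(1)[OF i] sets.compl_sets[of "D i" M] by (simp add: Compl_eq_Diff_UNIV)
      then have Im: "I \<in> bmeas M" unfolding I_def by (intro bmeas_indicator)
      have I01: "I x = 0 \<or> I x = 1" for x by (auto simp: I_def split: split_indicator)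
      have U'b: "(\<lambda>p. U' (fst p) (snd p)) \<in> bmeas MM"
        unfolding U'_def by (intro bmeas_mult Ub bmeas_fst bmeas_snd Im)
      have U'0: "0 \<le> U' x y" "U' x y \<le> U x y" for x y
        using I01[of x] I01[of y] graphonD(2)[OF U, of x y] by (auto simp: U'_def)
      have gU': "graphon M U'"
        unfolding graphon_def
      proof (intro conjI ballI)
        show "U' x y = U' y x" for x y using graphonD(1)[OF U, of x y] by (simp add: U'_def)
        show "U' x y \<le> 1" for x y using U'0(2)[of x y] graphonD(3)[OF U, of x y] by linarith
      qed (use U'0 bmeas_measurable[OF U'b] in auto)
      have "dint U' \<le> (\<integral>p. U (fst p) (snd p) - indicator (D i) (fst p) * U (fst p) (snd p) \<partial>MM)"
      proof (intro integral_mono integrable_MM U'b bmeas_diff Ub Ib i)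
        fix p :: "'a \<times> 'a"
        show "U' (fst p) (snd p) \<le> U (fst p) (snd p) - indicator (D i) (fst p) * U (fst p) (snd p)"
          using I01[of "snd p"] graphonD(2)[OF U, of "fst p" "snd p"]
          by (auto simp: U'_def I_def split: split_indicator)
      qed
      also have "\<dots> = dint U - (\<integral>p. indicator (D i) (fst p) * U (fst p) (snd p) \<partial>MM)"
        by (intro Bochner_Integration.integral_diff integrable_MM Ub Ib i)
      also have "\<dots> \<le> eps" using le big by simp
      finally have "dint U' \<le> eps" .
      then have "til_eps M eps k E W \<le> til M k E (\<lambda>x y. W x y - U' x y)"
        using U'0(2) UW eps by (intro til_eps_le k gU') (auto intro: order_trans[OF U'0(2)])
      also have "\<dots> \<le> til M k E (\<lambda>x y. W x y - U x y) + measure M (D i)"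
        by (intro til_le_off k E D i) (auto simp: U'_def I_def)
      also have "\<dots> \<le> til M k E (\<lambda>x y. W x y - U x y) + eta" using D(2)[OF i] by simp
      finally show ?thesis .
    qed
  qed
qed

text \<open>A finite measurable partition is encoded by the map sending a point to the index of its cell;
  cells may be empty.\<close>

definition labelling :: "nat \<Rightarrow> ('a \<Rightarrow> nat) \<Rightarrow> bool" where
  "labelling N q \<longleftrightarrow> (\<forall>x. q x < N) \<and> (\<forall>i. q -` {i} \<in> sets M)"

lemma labelling_sets: "labelling N q \<Longrightarrow> q -` {i} \<in> sets M"
  by (simp add: labelling_def)

text \<open>Here q is the finer partition: every cell of r is a union of cells of q.\<close>

definition refines :: "('a \<Rightarrow> nat) \<Rightarrow> ('a \<Rightarrow> nat) \<Rightarrow> bool" where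
  "refines q r \<longleftrightarrow> (\<exists>f. \<forall>x. r x = f (q x))"

lemma refines_trans: "refines q r \<Longrightarrow> refines r s \<Longrightarrow> refines q s"
  unfolding refines_def
proof (elim exE)
  fix f g assume "\<forall>x. r x = f (q x)" "\<forall>x. s x = g (r x)"
  then show "\<exists>f. \<forall>x. s x = f (q x)" by (intro exI[of _ "\<lambda>i. g (f i)"]) simp
qed

lemma labelling_const: "labelling 1 (\<lambda>_. 0)"
  using sets.top[of M] by (auto simp: labelling_def vimage_def)

lemma labelling_join:
  assumes "labelling N q" "labelling K r"
  shows "\<exists>s. labelling (N * K) s \<and> refines s q \<and> refines s r"
proof -
  have N: "q x < N" "r x < K" for x using assms by (auto simp: labelling_def)
  \<comment> \<open>The pair of labels in mixed radix, decoded by \<open>mod\<close> and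
    \<open>div\<close>.\<close>
  define s where "s x = q x + N * r x" for x
  have s: "s x mod N = q x" "s x div N = r x" for x
    using N[of x] by (auto simp: s_def)
  have "s x < N * K" for x
  proof -
    have "s x < N * (r x + 1)" using N[of x] by (simp add: s_def)
    also have "\<dots> \<le> N * K" using N[of x] by (intro mult_le_mono2) simp
    finally show ?thesis .
  qed
  moreover have "s -` {i} = q -` {i mod N} \<inter> r -` {i div N}" for i
    using N s by (auto simp: s_def)
  ultimately have "labelling (N * K) s" using assms by (auto simp: labelling_def)
  moreover have "refines s q" "refines s r"
    unfolding refines_def by (intro exI[of _ "\<lambda>i. i mod N"] allI, simp add: s) (intro exI[of _ "\<lambda>i. i div N"] allI, simp add: s)
  ultimately show ?thesis by blast
qed

lemma labelling_set:
  assumes "A \<in> sets M" shows "labelling 2 (indicator A)"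
proof -
  have "indicator A -` {i} \<in> sets M" for i :: nat
  proof -
    have "- A \<in> sets M" using assms sets.compl_sets[of A M] by (simp add: Compl_eq_Diff_UNIV)
    moreover have "indicator A -` {i} = (if i = 1 then A else if i = 0 then - A else {})"
    proof (rule set_eqI)
      show "x \<in> indicator A -` {i} \<longleftrightarrow> x \<in> (if i = 1 then A else if i = 0 then - A else {})" for x
        by (cases "x \<in> A") auto
    qed
    ultimately show ?thesis using assms by auto
  qed
  then show ?thesis by (auto simp: labelling_def indicator_def)
qed

text \<open>At each point exactly one pair of cells survives in the sum, so integrals of step
  functions reduce to integrals over rectangles.\<close>

lemma step_expand:
  fixes s :: "nat \<Rightarrow> nat \<Rightarrow> real"
  assumes "labelling N q"
  shows "s (q x) (q y) = (\<Sum>i<N. \<Sum>j<N. s i j * (indicator (q -` {i}) x * indicator (q -` {j}) y))"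
proof -
  have N: "q x < N" "q y < N" using assms by (auto simp: labelling_def)
  have "(\<Sum>i<N. \<Sum>j<N. s i j * (indicator (q -` {i}) x * indicator (q -` {j}) y))
    = (\<Sum>i<N. \<Sum>j<N. if i = q x then if j = q y then s i j else 0 else 0)"
    by (intro sum.cong refl) (auto split: split_indicator)
  also have "\<dots> = (\<Sum>i<N. if i = q x then (\<Sum>j<N. if j = q y then s i j else 0) else 0)"
    by (intro sum.cong refl) auto
  also have "\<dots> = s (q x) (q y)" using N by simp
  finally show ?thesis ..
qed

lemma bmeas_cell: "labelling N q \<Longrightarrow> indicator (q -` {i}) \<in> bmeas M"
  by (rule bmeas_indicator) (simp add: labelling_def)

lemma step_bmeas:
  fixes s :: "nat \<Rightarrow> nat \<Rightarrow> real"
  assumes "labelling N q" shows "(\<lambda>p. s (q (fst p)) (q (snd p))) \<in> bmeas MM"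
  unfolding step_expand[OF assms]
  by (intro bmeas_sum bmeas_mult bmeas_const bmeas_fst bmeas_snd bmeas_cell[OF assms])

section \<open>Density of step functions in L1 on the square\<close>

text \<open>One partition serves both coordinates, hence the joins in the proofs for sums and
  rectangles. The property passes from rectangles to measurable sets by a Dynkin argument and then
  to all integrable functions.\<close>

definition approximable :: "('a \<times> 'a \<Rightarrow> real) \<Rightarrow> bool" where
  "approximable f \<longleftrightarrow> integrable MM f \<and> (\<forall>\<beta>>0. \<exists>N q (s :: nat \<Rightarrow> nat \<Rightarrow> real). labelling N q \<and>
     (\<integral>p. \<bar>f p - s (q (fst p)) (q (snd p))\<bar> \<partial>MM) < \<beta>)"

lemma approximableE:
  assumes "approximable f" "\<beta> > 0"
  obtains N q and s :: "nat \<Rightarrow> nat \<Rightarrow> real"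
    where "labelling N q" "(\<integral>p. \<bar>f p - s (q (fst p)) (q (snd p))\<bar> \<partial>MM) < \<beta>"
  using assms unfolding approximable_def by blast

lemma approximable_add:
  assumes f: "approximable f" and g: "approximable g" shows "approximable (\<lambda>p. f p + g p)"
  unfolding approximable_def
proof (intro conjI allI impI)
  have [simp]: "integrable MM f" "integrable MM g" using f g by (auto simp: approximable_def)
  show "integrable MM (\<lambda>p. f p + g p)" by simp
  fix \<beta> :: real assume "\<beta> > 0"
  then have "\<beta> / 2 > 0" by simp
  obtain N1 q1 s1 where 1: "labelling N1 q1" "(\<integral>p. \<bar>f p - s1 (q1 (fst p)) (q1 (snd p))\<bar> \<partial>MM) < \<beta> / 2"
    by (rule approximableE[OF f \<open>\<beta> / 2 > 0\<close>])
  obtain N2 q2 s2 where 2: "labelling N2 q2" "(\<integral>p. \<bar>g p - s2 (q2 (fst p)) (q2 (snd p))\<bar> \<partial>MM) < \<beta> / 2"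
    by (rule approximableE[OF g \<open>\<beta> / 2 > 0\<close>])
  obtain q where q: "labelling (N1 * N2) q" "refines q q1" "refines q q2"
    using labelling_join[OF 1(1) 2(1)] by blast
  then obtain a b where ab: "\<And>x. q1 x = a (q x)" "\<And>x. q2 x = b (q x)"
    unfolding refines_def by metis
  define s where "s i j = s1 (a i) (a j) + s2 (b i) (b j)" for i j
  have [simp]: "integrable MM (\<lambda>p. s1 (q1 (fst p)) (q1 (snd p)))" "integrable MM (\<lambda>p. s2 (q2 (fst p)) (q2 (snd p)))"
    "integrable MM (\<lambda>p. s (q (fst p)) (q (snd p)))"
    by (intro integrable_MM step_bmeas[OF 1(1)] step_bmeas[OF 2(1)] step_bmeas[OF q(1)])+
  have "(\<integral>p. \<bar>f p + g p - s (q (fst p)) (q (snd p))\<bar> \<partial>MM)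
    \<le> (\<integral>p. \<bar>f p - s1 (q1 (fst p)) (q1 (snd p))\<bar> + \<bar>g p - s2 (q2 (fst p)) (q2 (snd p))\<bar> \<partial>MM)"
  proof (rule integral_mono)
    fix p :: "'a \<times> 'a"
    show "\<bar>f p + g p - s (q (fst p)) (q (snd p))\<bar>
      \<le> \<bar>f p - s1 (q1 (fst p)) (q1 (snd p))\<bar> + \<bar>g p - s2 (q2 (fst p)) (q2 (snd p))\<bar>"
      unfolding s_def ab by linarith
  qed auto
  also have "\<dots> = (\<integral>p. \<bar>f p - s1 (q1 (fst p)) (q1 (snd p))\<bar> \<partial>MM) + (\<integral>p. \<bar>g p - s2 (q2 (fst p)) (q2 (snd p))\<bar> \<partial>MM)"
    by (rule Bochner_Integration.integral_add) auto
  also have "\<dots> < \<beta>" using 1(2) 2(2) by linarith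
  finally show "\<exists>N q (s :: nat \<Rightarrow> nat \<Rightarrow> real). labelling N q \<and> (\<integral>p. \<bar>f p + g p - s (q (fst p)) (q (snd p))\<bar> \<partial>MM) < \<beta>"
    using q by blast
qed

lemma approximable_scale:
  assumes f: "approximable f" shows "approximable (\<lambda>p. f p * c)"
proof (cases "c = 0")
  case True
  have "\<exists>N q (s :: nat \<Rightarrow> nat \<Rightarrow> real). labelling N q \<and> (\<integral>p. \<bar>0 - s (q (fst p)) (q (snd p))\<bar> \<partial>MM) < \<beta>"
    if "\<beta> > 0" for \<beta>
    using that labelling_const
    by (intro exI[of _ 1] exI[of _ "\<lambda>_::'a. 0::nat"] exI[of _ "\<lambda>(_::nat) (_::nat). 0::real"] conjI) auto
  then show ?thesis using True by (simp add: approximable_def)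
next
  case False
  show ?thesis unfolding approximable_def
  proof (intro conjI allI impI)
    have [simp]: "integrable MM f" using f by (auto simp: approximable_def)
    show "integrable MM (\<lambda>p. f p * c)" by simp
    fix \<beta> :: real assume "\<beta> > 0"
    then have "\<beta> / \<bar>c\<bar> > 0" using False by simp
    with f obtain N q s where 1: "labelling N q" "(\<integral>p. \<bar>f p - s (q (fst p)) (q (snd p))\<bar> \<partial>MM) < \<beta> / \<bar>c\<bar>"
      by (rule approximableE)
    have "(\<integral>p. \<bar>f p * c - s (q (fst p)) (q (snd p)) * c\<bar> \<partial>MM) = (\<integral>p. \<bar>f p - s (q (fst p)) (q (snd p))\<bar> * \<bar>c\<bar> \<partial>MM)"
      by (simp add: abs_mult[symmetric] algebra_simps)
    also have "\<dots> = (\<integral>p. \<bar>f p - s (q (fst p)) (q (snd p))\<bar> \<partial>MM) * \<bar>c\<bar>" by simp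
    also have "\<dots> < \<beta>" using 1(2) False by (simp add: field_simps)
    finally show "\<exists>N q (s :: nat \<Rightarrow> nat \<Rightarrow> real). labelling N q \<and> (\<integral>p. \<bar>f p * c - s (q (fst p)) (q (snd p))\<bar> \<partial>MM) < \<beta>"
      using 1(1) by (intro exI[of _ N] exI[of _ q] exI[of _ "\<lambda>i j. s i j * c"]) simp
  qed
qed

text \<open>Dominated convergence brings some \<open>g i\<close> within half of \<beta>, and a step
  function for \<open>g i\<close> spends the other half. It serves disjoint unions as well as limits
  of simple functions.\<close>

lemma approximable_lim:
  assumes f: "integrable MM f" and g: "\<And>i. approximable (g i)"
    and lim: "\<And>p. (\<lambda>i. g i p) \<longlonglongrightarrow> f p" and bd: "\<And>i p. \<bar>g i p\<bar> \<le> h p" and h: "integrable MM h"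
  shows "approximable f"
  unfolding approximable_def
proof (intro conjI allI impI f)
  fix \<beta> :: real assume "\<beta> > 0"
  have gi [simp]: "integrable MM (g i)" for i using g by (simp add: approximable_def)
  note [simp] = f h
  have "(\<lambda>i. \<integral>p. \<bar>f p - g i p\<bar> \<partial>MM) \<longlonglongrightarrow> (\<integral>p. 0 \<partial>MM)"
  proof (rule integral_dominated_convergence)
    show "integrable MM (\<lambda>p. \<bar>f p\<bar> + h p)" by simp
    show "AE p in MM. (\<lambda>i. \<bar>f p - g i p\<bar>) \<longlonglongrightarrow> 0"
    proof (intro AE_I2 tendsto_rabs_zero)
      show "(\<lambda>i. f p - g i p) \<longlonglongrightarrow> 0" for p using tendsto_diff[OF tendsto_const lim[of p], of "f p"] by simp
    qed
    show "AE p in MM. norm \<bar>f p - g i p\<bar> \<le> \<bar>f p\<bar> + h p" for i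
    proof (rule AE_I2)
      show "norm \<bar>f p - g i p\<bar> \<le> \<bar>f p\<bar> + h p" for p using bd[of i p] by simp
    qed
  qed (simp_all add: borel_measurable_integrable)
  then have "eventually (\<lambda>i. (\<integral>p. \<bar>f p - g i p\<bar> \<partial>MM) < \<beta> / 2) sequentially"
    by (rule order_tendstoD) (use \<open>\<beta> > 0\<close> in simp)
  then obtain i where i: "(\<integral>p. \<bar>f p - g i p\<bar> \<partial>MM) < \<beta> / 2" by (auto simp: eventually_sequentially)
  have "\<beta> / 2 > 0" using \<open>\<beta> > 0\<close> by simp
  with g[of i] obtain N q s where 1: "labelling N q" "(\<integral>p. \<bar>g i p - s (q (fst p)) (q (snd p))\<bar> \<partial>MM) < \<beta> / 2"
    by (rule approximableE)
  have [simp]: "integrable MM (\<lambda>p. s (q (fst p)) (q (snd p)))"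
    using 1 by (auto intro!: integrable_MM step_bmeas)
  have "(\<integral>p. \<bar>f p - s (q (fst p)) (q (snd p))\<bar> \<partial>MM) \<le> (\<integral>p. \<bar>f p - g i p\<bar> + \<bar>g i p - s (q (fst p)) (q (snd p))\<bar> \<partial>MM)"
    by (rule integral_mono) auto
  also have "\<dots> = (\<integral>p. \<bar>f p - g i p\<bar> \<partial>MM) + (\<integral>p. \<bar>g i p - s (q (fst p)) (q (snd p))\<bar> \<partial>MM)"
    by (rule Bochner_Integration.integral_add) auto
  also have "\<dots> < \<beta>" using i 1 by linarith
  finally show "\<exists>N q (s :: nat \<Rightarrow> nat \<Rightarrow> real). labelling N q \<and> (\<integral>p. \<bar>f p - s (q (fst p)) (q (snd p))\<bar> \<partial>MM) < \<beta>"
    using 1(1) by blast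
qed

lemma approximable_rectangle:
  assumes A: "A \<in> sets M" and B: "B \<in> sets M" shows "approximable (indicator (A \<times> B))"
  unfolding approximable_def
proof (intro conjI allI impI)
  show "integrable MM (indicator (A \<times> B) :: _ \<Rightarrow> real)"
    using A B by (intro integrable_MM bmeas_indicator) auto
  fix \<beta> :: real assume "\<beta> > 0"
  obtain q where q: "labelling (2 * 2) q" "refines q (indicator A)" "refines q (indicator B)"
    using labelling_join[OF labelling_set[OF A] labelling_set[OF B]] by blast
  then obtain a b where ab: "\<And>x. (indicator A x :: nat) = a (q x)" "\<And>x. (indicator B x :: nat) = b (q x)"
    unfolding refines_def by metis
  have eq: "indicator (A \<times> B) p = real (a (q (fst p)) * b (q (snd p)))" for p
    by (simp add: ab[symmetric] indicator_def mem_Times_iff)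
  show "\<exists>N q (s :: nat \<Rightarrow> nat \<Rightarrow> real). labelling N q \<and> (\<integral>p. \<bar>indicator (A \<times> B) p - s (q (fst p)) (q (snd p))\<bar> \<partial>MM) < \<beta>"
    by (rule exI[of _ "2 * 2"], rule exI[of _ q], rule exI[of _ "\<lambda>i j. real (a i * b j)"])
      (use q \<open>\<beta> > 0\<close> in \<open>simp add: eq\<close>)
qed

lemma approximable_indicator:
  assumes "A \<in> sets MM" shows "approximable (indicator A)"
proof -
  let ?G = "{a \<times> b |a b. a \<in> sets M \<and> b \<in> sets M}"
  have s: "sets MM = sigma_sets (space M \<times> space M) ?G" by (rule sets_pair_measure)
  have "A \<in> sigma_sets (space M \<times> space M) ?G" using assms unfolding s .
  from Int_stable_pair_measure_generator pair_measure_closed this show ?thesis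
  proof (induction rule: sigma_sets_induct_disjoint)
    case (basic A)
    then show ?case using approximable_rectangle by auto
  next
    case empty
    have "approximable (\<lambda>p. indicator ({} \<times> {}) p * 0)" by (intro approximable_scale approximable_rectangle) auto
    then show ?case by simp
  next
    case (compl A)
    have "approximable (\<lambda>p. indicator (UNIV \<times> UNIV) p + indicator A p * (-1))"
      using sets.top[of M] by (intro approximable_add approximable_scale approximable_rectangle compl) auto
    moreover have "(\<lambda>p. indicator (UNIV \<times> UNIV) p + indicator A p * (-1) :: real) = indicator (space M \<times> space M - A)"
      by (auto simp: indicator_def fun_eq_iff)
    ultimately show ?case by metis
  next
    case (union A)
    have Am: "A i \<in> sets MM" for i using union s by auto
    have fin: "approximable (\<lambda>p. \<Sum>i<n. indicator (A i) p)" for n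
    proof (induction n)
      case 0
      have "approximable (\<lambda>p. indicator ({} \<times> {}) p * 0)" by (intro approximable_scale approximable_rectangle) auto
      then show ?case by simp
    next
      case (Suc n)
      then show ?case using approximable_add[OF Suc union(3)] by simp
    qed
    \<comment> \<open>Disjointness turns the partial sums into indicators of finite unions, which
      are dominated by 1.\<close>
    have ind: "(\<Sum>i<n. indicator (A i) p) = (indicator (\<Union>i<n. A i) p :: real)" for n p
      using union(1) by (subst indicator_UN_disjoint) (auto simp: disjoint_family_on_def)
    show ?case
    proof (rule approximable_lim[OF _ fin])
      show "integrable MM (indicator (\<Union> (range A)) :: _ \<Rightarrow> real)"
        using Am by (intro integrable_MM bmeas_indicator) auto
      show "(\<lambda>n. \<Sum>i<n. indicator (A i) p) \<longlonglongrightarrow> (indicator (\<Union> (range A)) p :: real)" for p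
        unfolding ind by (rule LIMSEQ_indicator_UN)
      show "integrable MM (\<lambda>_. 1 :: real)" by simp
      show "\<bar>\<Sum>i<n. indicator (A i) p\<bar> \<le> (1::real)" for n p
        unfolding ind by (auto split: split_indicator)
    qed
  qed
qed

lemma approximable_integrable:
  assumes "integrable MM f" shows "approximable f"
  using assms
proof (induction rule: integrable_induct)
  case (base A c)
  then show ?case using approximable_scale[OF approximable_indicator[of A], of c] by simp
next
  case (add f g)
  then show ?case by (intro approximable_add)
next
  case (lim f g)
  show ?case
    \<comment> \<open>The factor 2 comes from the domination clause of the induction rule.\<close>
    by (rule approximable_lim[of f g "\<lambda>p. 2 * \<bar>f p\<bar>"]) (use lim in auto)
qed

section \<open>Step functions against the cut-norm\<close>

text \<open>A supremum bounds its members only once it is known to be bounded above; the pointwise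
  bound on H provides this.\<close>

lemma rectangle_le_cut_norm:
  assumes H: "(\<lambda>p. H (fst p) (snd p)) \<in> bmeas MM" and A: "A \<in> sets M" and B: "B \<in> sets M"
  shows "\<bar>rect A B H\<bar> \<le> cut_norm M H"
proof -
  obtain C where C: "\<And>x y. \<bar>H x y\<bar> \<le> C" using H unfolding bmeas_def by auto
  have Hm: "(\<lambda>p. indicator (A \<times> B) p * H (fst p) (snd p)) \<in> bmeas MM" if "A \<in> sets M" "B \<in> sets M" for A B
    using that by (intro bmeas_mult H bmeas_indicator) auto
  let ?F = "\<lambda>AB. \<bar>integral\<^sup>L MM (\<lambda>p. indicator (fst AB \<times> snd AB) p * H (fst p) (snd p))\<bar>"
  have "bdd_above (?F ` (sets M \<times> sets M))"
  proof (rule bdd_aboveI2[of _ _ C])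
    fix AB assume "AB \<in> sets M \<times> sets M"
    then have m: "fst AB \<in> sets M" "snd AB \<in> sets M" by auto
    have "?F AB \<le> (\<integral>p. \<bar>indicator (fst AB \<times> snd AB) p * H (fst p) (snd p)\<bar> \<partial>MM)" by (rule integral_abs_bound)
    also have "\<dots> \<le> (\<integral>p. C \<partial>MM)"
    proof (intro integral_mono integrable_MM bmeas_abs Hm m bmeas_const)
      fix p show "\<bar>indicator (fst AB \<times> snd AB) p * H (fst p) (snd p)\<bar> \<le> C"
        using C[of "fst p" "snd p"] abs_ge_zero[of "H (fst p) (snd p)"] by (auto split: split_indicator)
    qed
    also have "\<dots> = C" using pair.P.prob_space by simp
    finally show "?F AB \<le> C" .
  qed
  then have "?F (A, B) \<le> cut_norm M H"
    unfolding cut_norm_def using A B by (intro cSUP_upper) auto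
  then show ?thesis by (simp add: indicator_times)
qed

lemma step_integral_sum:
  fixes s :: "nat \<Rightarrow> nat \<Rightarrow> real"
  assumes q: "labelling N q" and H: "(\<lambda>p. H (fst p) (snd p)) \<in> bmeas MM"
  shows "(\<integral>p. s (q (fst p)) (q (snd p)) * H (fst p) (snd p) \<partial>MM)
    = (\<Sum>i<N. \<Sum>j<N. s i j * rect (q -` {i}) (q -` {j}) H)"
proof -
  let ?c = "\<lambda>i j p. indicator (q -` {i}) (fst p) * indicator (q -` {j}) (snd p) * H (fst p) (snd p)"
  have cb: "(\<lambda>p. s i j * ?c i j p) \<in> bmeas MM" for i j
    by (intro bmeas_mult bmeas_const bmeas_fst bmeas_snd bmeas_cell[OF q] H)
  have "(\<integral>p. s (q (fst p)) (q (snd p)) * H (fst p) (snd p) \<partial>MM) = (\<integral>p. (\<Sum>i<N. \<Sum>j<N. s i j * ?c i j p) \<partial>MM)"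
    by (subst step_expand[OF q]) (simp add: sum_distrib_right mult.assoc)
  also have "\<dots> = (\<Sum>i<N. \<integral>p. (\<Sum>j<N. s i j * ?c i j p) \<partial>MM)"
    by (intro Bochner_Integration.integral_sum integrable_MM bmeas_sum cb)
  also have "\<dots> = (\<Sum>i<N. \<Sum>j<N. \<integral>p. s i j * ?c i j p \<partial>MM)"
    by (intro sum.cong refl Bochner_Integration.integral_sum integrable_MM cb)
  finally show ?thesis by simp
qed

text \<open>The price of passing from sets to step functions is the sum of the coefficients. It can
  grow with the number of cells, so that number has to be controlled before the cut-norm is made
  small.\<close>

lemma step_le_cut_norm:
  fixes s :: "nat \<Rightarrow> nat \<Rightarrow> real"
  assumes H: "(\<lambda>p. H (fst p) (snd p)) \<in> bmeas MM" and q: "labelling N q"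
  shows "\<bar>\<integral>p. s (q (fst p)) (q (snd p)) * H (fst p) (snd p) \<partial>MM\<bar> \<le> (\<Sum>i<N. \<Sum>j<N. \<bar>s i j\<bar>) * cut_norm M H"
proof -
  have "\<bar>\<integral>p. s (q (fst p)) (q (snd p)) * H (fst p) (snd p) \<partial>MM\<bar>
      \<le> (\<Sum>i<N. \<Sum>j<N. \<bar>s i j\<bar> * \<bar>rect (q -` {i}) (q -` {j}) H\<bar>)"
    unfolding step_integral_sum[OF q H] abs_mult[symmetric]
    by (intro order_trans[OF sum_abs] sum_mono sum_abs)
  also have "\<dots> \<le> (\<Sum>i<N. \<Sum>j<N. \<bar>s i j\<bar> * cut_norm M H)"
    by (intro sum_mono mult_left_mono rectangle_le_cut_norm H labelling_sets[OF q]) auto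
  also have "\<dots> = (\<Sum>i<N. \<Sum>j<N. \<bar>s i j\<bar>) * cut_norm M H" by (simp add: sum_distrib_right)
  finally show ?thesis .
qed

text \<open>The ratio h of U to W does not involve W'. It is replaced in L1 by a step function, and
  only that step function is tested against W' - W; the tolerance depends on its
  coefficients.\<close>

lemma til_eps_upper:
  assumes cover: "\<And>\<eta>::real. \<eta> > 0 \<Longrightarrow>
      \<exists>N D. (\<forall>i<N. D i \<in> sets M \<and> measure M (D i) \<le> \<eta>) \<and> (\<Union>i<N::nat. D i) = UNIV"
    and k: "k \<ge> 1" and E: "graph_on k E" and eps: "eps > 0" and eta: "(eta::real) > 0"
    and W: "graphon M W" and U: "graphon M U" and UW: "\<And>x y. U x y \<le> W x y" and le: "dint U \<le> eps"
  shows "\<exists>\<gamma>>0. \<forall>W'. graphon M W' \<longrightarrow> cut_norm M (\<lambda>x y. W' x y - W x y) \<le> \<gamma> \<longrightarrow>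
      til_eps M eps k E W' \<le> til M k E (\<lambda>x y. W x y - U x y) + eta"
proof -
  obtain c where c: "c > 0" and ex: "\<And>W U :: 'a \<Rightarrow> 'a \<Rightarrow> real. graphon M W \<Longrightarrow> graphon M U \<Longrightarrow> (\<And>x y. U x y \<le> W x y) \<Longrightarrow> dint U \<le> eps + c \<Longrightarrow>
      til_eps M eps k E W \<le> til M k E (\<lambda>x y. W x y - U x y) + eta"
    using til_eps_excess[OF cover k E eps eta] by blast
  note Wb = graphon_bmeas[OF W] and Ub = graphon_bmeas[OF U]
  \<comment> \<open>The value 1 on the zeros of W removes all of W' there.\<close>
  define h where "h x y = (if W x y = 0 then 1 else U x y / W x y)" for x y
  have h01: "0 \<le> h x y" "h x y \<le> 1" for x y
    using graphonD(2)[OF W, of x y] graphonD(2)[OF U, of x y] UW[of x y] by (auto simp: h_def divide_le_eq)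
  have [measurable]: "(\<lambda>p. W (fst p) (snd p)) \<in> borel_measurable MM" "(\<lambda>p. U (fst p) (snd p)) \<in> borel_measurable MM"
    using Wb Ub by (auto intro: bmeas_measurable)
  have hb: "(\<lambda>p. h (fst p) (snd p)) \<in> bmeas MM"
    unfolding h_def by (rule bmeasI[of _ _ 1]) (use h01 in \<open>auto simp: h_def\<close>)
  have Wh: "W x y * h x y = U x y" for x y
    using UW[of x y] graphonD(2)[OF U, of x y] by (auto simp: h_def)
  have "approximable (\<lambda>p. h (fst p) (snd p))" by (intro approximable_integrable integrable_MM hb)
  moreover have "c / 2 > 0" using c by simp
  ultimately obtain N q s where q: "labelling N q" and s: "(\<integral>p. \<bar>h (fst p) (snd p) - s (q (fst p)) (q (snd p))\<bar> \<partial>MM) < c / 2"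
    by (rule approximableE)
  let ?S = "\<Sum>i<N. \<Sum>j<N. \<bar>s i j\<bar>"
  have S: "?S \<ge> 0" by (intro sum_nonneg) auto
  show ?thesis
  \<comment> \<open>The added 1 keeps the denominator positive, and \<open>?S\<close> times this
    constant is at most c / 2.\<close>
  proof (intro exI[of _ "c / (2 * (?S + 1))"] conjI allI impI)
    show "c / (2 * (?S + 1)) > 0" using c S by simp
    fix W' assume W': "graphon M W'" and cut: "cut_norm M (\<lambda>x y. W' x y - W x y) \<le> c / (2 * (?S + 1))"
    note W'b = graphon_bmeas[OF W']
    define U' where "U' x y = W' x y * h x y" for x y
    have U'b: "(\<lambda>p. U' (fst p) (snd p)) \<in> bmeas MM" unfolding U'_def by (intro bmeas_mult W'b hb)
    have U'01: "0 \<le> U' x y" "U' x y \<le> W' x y" for x y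
      using graphonD(2)[OF W', of x y] h01[of x y] by (auto simp: U'_def intro: mult_left_le)
    have gU': "graphon M U'"
      unfolding graphon_def
    proof (intro conjI ballI)
      show "U' x y = U' y x" for x y
        using graphonD(1)[OF U, of x y] graphonD(1)[OF W, of x y] graphonD(1)[OF W', of x y] by (simp add: U'_def h_def)
      show "U' x y \<le> 1" for x y using U'01(2)[of x y] graphonD(3)[OF W', of x y] by linarith
    qed (use U'01 bmeas_measurable[OF U'b] in auto)
    have db: "(\<lambda>p. W' (fst p) (snd p) - W (fst p) (snd p)) \<in> bmeas MM" by (intro bmeas_diff W'b Wb)
    have sb: "(\<lambda>p. s (q (fst p)) (q (snd p))) \<in> bmeas MM" by (rule step_bmeas[OF q])
    have "dint U' - dint U = (\<integral>p. U' (fst p) (snd p) - U (fst p) (snd p) \<partial>MM)"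
      by (intro Bochner_Integration.integral_diff[symmetric] integrable_MM U'b Ub)
    also have "\<dots> \<le> (\<integral>p. \<bar>h (fst p) (snd p) - s (q (fst p)) (q (snd p))\<bar>
        + s (q (fst p)) (q (snd p)) * (W' (fst p) (snd p) - W (fst p) (snd p)) \<partial>MM)"
    proof (intro integral_mono integrable_MM bmeas_add bmeas_mult bmeas_diff bmeas_abs U'b Ub W'b Wb hb sb)
      fix p :: "'a \<times> 'a"
      obtain x y where p: "p = (x, y)" by (cases p)
      \<comment> \<open>The part of h missed by the step function is paid in L1, because \<bar>W' -
        W\<bar> is at most 1.\<close>
      have "U' x y - U x y = (h x y - s (q x) (q y)) * (W' x y - W x y) + s (q x) (q y) * (W' x y - W x y)"
        by (simp add: U'_def Wh[symmetric] algebra_simps)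
      also have "(h x y - s (q x) (q y)) * (W' x y - W x y) \<le> \<bar>h x y - s (q x) (q y)\<bar> * \<bar>W' x y - W x y\<bar>"
        by (simp add: abs_mult[symmetric])
      also have "\<dots> \<le> \<bar>h x y - s (q x) (q y)\<bar> * 1"
        using graphonD(2,3)[OF W, of x y] graphonD(2,3)[OF W', of x y] by (intro mult_left_mono) auto
      finally show "U' (fst p) (snd p) - U (fst p) (snd p) \<le> \<bar>h (fst p) (snd p) - s (q (fst p)) (q (snd p))\<bar>
        + s (q (fst p)) (q (snd p)) * (W' (fst p) (snd p) - W (fst p) (snd p))" using p by simp
    qed
    also have "\<dots> = (\<integral>p. \<bar>h (fst p) (snd p) - s (q (fst p)) (q (snd p))\<bar> \<partial>MM)
        + (\<integral>p. s (q (fst p)) (q (snd p)) * (W' (fst p) (snd p) - W (fst p) (snd p)) \<partial>MM)"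
      by (intro Bochner_Integration.integral_add integrable_MM bmeas_mult bmeas_diff bmeas_abs W'b Wb hb sb)
    also have "\<dots> \<le> c / 2 + ?S * cut_norm M (\<lambda>x y. W' x y - W x y)"
      using s step_le_cut_norm[OF db q, of s] by linarith
    also have "\<dots> \<le> c / 2 + ?S * (c / (2 * (?S + 1)))" by (intro add_left_mono mult_left_mono cut S)
    also have "?S * (c / (2 * (?S + 1))) \<le> c / 2" using S c by (simp add: field_simps)
    finally have "dint U' \<le> eps + c" using le by simp
    then have "til_eps M eps k E W' \<le> til M k E (\<lambda>x y. W' x y - U' x y) + eta"
      using U'01 by (intro ex W' gU') auto
    also have "til M k E (\<lambda>x y. W' x y - U' x y) \<le> til M k E (\<lambda>x y. W x y - U x y)"
    proof (rule til_mono_support[OF k E])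
      \<comment> \<open>Contrapositive: where W = U, the ratio h is 1 whether W vanishes or not, and
        so U' = W'.\<close>
      fix x y assume "W' x y - U' x y \<noteq> 0"
      then show "W x y - U x y \<noteq> 0" by (auto simp: U'_def h_def split: if_splits)
    qed
    finally show "til_eps M eps k E W' \<le> til M k E (\<lambda>x y. W x y - U x y) + eta" by simp
  qed
qed

section \<open>Szemeredi regularity for graphons\<close>

definition cell_wt :: "('a \<Rightarrow> nat) \<Rightarrow> nat \<Rightarrow> real" where
  "cell_wt q i = measure M (q -` {i})"

text \<open>The density is \<open>0\<close> when one of the cells is null.\<close>

definition avg :: "('a \<Rightarrow> 'a \<Rightarrow> real) \<Rightarrow> ('a \<Rightarrow> nat) \<Rightarrow> nat \<Rightarrow> nat \<Rightarrow> real" where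
  "avg V q i j = rect (q -` {i}) (q -` {j}) V / (cell_wt q i * cell_wt q j)"

text \<open>Regularity in cut-norm form: all measurable subsets are tested, however small, and the
  error is relative to the product of the full cells. Pairs with a null cell are thus regular, and i
  = j is allowed.\<close>

definition regular_pair :: "('a \<Rightarrow> 'a \<Rightarrow> real) \<Rightarrow> ('a \<Rightarrow> nat) \<Rightarrow> real \<Rightarrow> nat \<Rightarrow> nat \<Rightarrow> bool" where
  "regular_pair V q \<delta> i j \<longleftrightarrow> (\<forall>A\<in>sets M. \<forall>B\<in>sets M. A \<subseteq> q -` {i} \<longrightarrow> B \<subseteq> q -` {j} \<longrightarrow>
     \<bar>rect A B V - avg V q i j * (measure M A * measure M B)\<bar> \<le> \<delta> * (cell_wt q i * cell_wt q j))"

definition irregular_mass :: "('a \<Rightarrow> 'a \<Rightarrow> real) \<Rightarrow> ('a \<Rightarrow> nat) \<Rightarrow> real \<Rightarrow> nat \<Rightarrow> real" where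
  "irregular_mass V q \<delta> N =
     (\<Sum>i<N. \<Sum>j<N. if regular_pair V q \<delta> i j then 0 else cell_wt q i * cell_wt q j)"

text \<open>The squared L2 norm of the conditional expectation of V on the product
  partition.\<close>

definition energy :: "('a \<Rightarrow> 'a \<Rightarrow> real) \<Rightarrow> ('a \<Rightarrow> nat) \<Rightarrow> real" where
  "energy V q = dint (\<lambda>x y. (avg V q (q x) (q y))\<^sup>2)"

lemma rect_bmeas:
  assumes "(\<lambda>p. H (fst p) (snd p)) \<in> bmeas MM" "A \<in> sets M" "B \<in> sets M"
  shows "(\<lambda>p. indicator A (fst p) * indicator B (snd p) * H (fst p) (snd p)) \<in> bmeas MM"
  using assms by (intro bmeas_mult bmeas_fst bmeas_snd bmeas_indicator)

lemma rect_const: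
  assumes "A \<in> sets M" "B \<in> sets M"
  shows "rect A B (\<lambda>_ _. c) = c * (measure M A * measure M B)"
proof -
  have "rect A B (\<lambda>_ _. c) = (\<integral>p. c * indicator (A \<times> B) p \<partial>MM)"
    by (intro Bochner_Integration.integral_cong) (auto simp: indicator_times)
  also have "\<dots> = c * measure MM (A \<times> B)" using assms by simp
  also have "measure MM (A \<times> B) = measure M A * measure M B"
    using assms by (simp add: measure_def emeasure_pair_measure_Times enn2real_mult)
  finally show ?thesis .
qed

lemma rect_diff:
  assumes "(\<lambda>p. H (fst p) (snd p)) \<in> bmeas MM" "A \<in> sets M" "B \<in> sets M"
  shows "rect A B (\<lambda>x y. H x y - c) = rect A B H - c * (measure M A * measure M B)"
proof -
  have "rect A B (\<lambda>x y. H x y - c) = (\<integral>p. indicator A (fst p) * indicator B (snd p) * H (fst p) (snd p)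
      - indicator A (fst p) * indicator B (snd p) * c \<partial>MM)"
    by (simp add: right_diff_distrib)
  also have "\<dots> = rect A B H - rect A B (\<lambda>_ _. c)"
    by (intro Bochner_Integration.integral_diff integrable_MM rect_bmeas assms rect_bmeas[where H="\<lambda>_ _. c"]) auto
  finally show ?thesis using rect_const assms by simp
qed

lemma rect_swap:
  assumes H: "(\<lambda>p. H (fst p) (snd p)) \<in> bmeas MM" and sym: "\<And>x y. H x y = H y x"
    and "A \<in> sets M" "B \<in> sets M"
  shows "rect A B H = rect B A H"
proof -
  let ?f = "\<lambda>p. indicator A (fst p) * indicator B (snd p) * H (fst p) (snd p)"
  have "(\<integral>(x, y). ?f (y, x) \<partial>MM) = integral\<^sup>L MM ?f"
    by (intro pair.integral_product_swap bmeas_measurable rect_bmeas assms)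
  moreover have "(\<integral>(x, y). ?f (y, x) \<partial>MM) = rect B A H"
    by (intro Bochner_Integration.integral_cong) (auto simp: sym split: split_indicator)
  ultimately show ?thesis by simp
qed

lemma cell_wt_nonneg [simp]: "0 \<le> cell_wt q i" by (simp add: cell_wt_def)

text \<open>On null cells both sides vanish, so the product form spares later identities a case
  distinction.\<close>

lemma avg_mult:
  assumes q: "labelling N q" and H: "(\<lambda>p. H (fst p) (snd p)) \<in> bmeas MM"
  shows "avg H q i j * (cell_wt q i * cell_wt q j) = rect (q -` {i}) (q -` {j}) H"
proof (cases "cell_wt q i * cell_wt q j = 0")
  case True
  obtain C where C: "\<And>x y. \<bar>H x y\<bar> \<le> C" using H unfolding bmeas_def by auto
  note qs = labelling_sets[OF q]
  have "\<bar>rect (q -` {i}) (q -` {j}) H\<bar> \<le> (\<integral>p. \<bar>indicator (q -` {i}) (fst p) * indicator (q -` {j}) (snd p) * H (fst p) (snd p)\<bar> \<partial>MM)"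
    by (rule integral_abs_bound)
  also have "\<dots> \<le> rect (q -` {i}) (q -` {j}) (\<lambda>_ _. C)"
    by (intro integral_mono integrable_MM bmeas_abs rect_bmeas H qs bmeas_const)
      (use C in \<open>auto split: split_indicator\<close>)
  also have "\<dots> = 0" unfolding rect_const[OF qs qs] using True by (simp add: cell_wt_def)
  finally show ?thesis using True by simp
qed (simp add: avg_def)

text \<open>The projection property of conditional expectation: step functions of the partition do
  not distinguish H from its averages.\<close>

lemma step_integral_avg:
  fixes s :: "nat \<Rightarrow> nat \<Rightarrow> real"
  assumes q: "labelling N q" and H: "(\<lambda>p. H (fst p) (snd p)) \<in> bmeas MM"
  shows "(\<integral>p. s (q (fst p)) (q (snd p)) * avg H q (q (fst p)) (q (snd p)) \<partial>MM)
    = (\<integral>p. s (q (fst p)) (q (snd p)) * H (fst p) (snd p) \<partial>MM)"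
proof -
  note qs = labelling_sets[OF q]
  have "rect (q -` {i}) (q -` {j}) (\<lambda>x y. avg H q (q x) (q y)) = rect (q -` {i}) (q -` {j}) (\<lambda>x y. avg H q i j)" for i j
    by (intro Bochner_Integration.integral_cong refl) (auto split: split_indicator)
  then have *: "rect (q -` {i}) (q -` {j}) (\<lambda>x y. avg H q (q x) (q y)) = rect (q -` {i}) (q -` {j}) H" for i j
    unfolding rect_const[OF qs qs] using avg_mult[OF q H, of i j] by (simp add: cell_wt_def)
  show ?thesis
    unfolding step_integral_sum[OF q H] step_integral_sum[OF q step_bmeas[OF q, of "avg H q"], of s] * ..
qed

lemma avg_bounds:
  assumes q: "labelling N q" and V: "graphon M V"
  shows "0 \<le> avg V q i j" "avg V q i j \<le> 1"
proof -
  note qs = labelling_sets[OF q]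
  have "0 \<le> rect (q -` {i}) (q -` {j}) V"
    using graphonD(2)[OF V] by (intro integral_nonneg_AE AE_I2) auto
  then show "0 \<le> avg V q i j" by (simp add: avg_def)
  have "rect (q -` {i}) (q -` {j}) V \<le> rect (q -` {i}) (q -` {j}) (\<lambda>_ _. 1)"
    by (intro integral_mono integrable_MM rect_bmeas graphon_bmeas V qs bmeas_const)
      (use graphonD(3)[OF V] in \<open>auto split: split_indicator\<close>)
  then have "rect (q -` {i}) (q -` {j}) V \<le> cell_wt q i * cell_wt q j"
    unfolding rect_const[OF qs qs] by (simp add: cell_wt_def)
  then show "avg V q i j \<le> 1"
    unfolding avg_def by (cases "cell_wt q i * cell_wt q j = 0") (auto simp: divide_le_eq_1 zero_less_mult_iff less_le)
qed

lemma energy_bounds: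
  assumes q: "labelling N q" and V: "graphon M V"
  shows "0 \<le> energy V q" "energy V q \<le> 1"
proof -
  show "0 \<le> energy V q" unfolding energy_def by simp
  have "energy V q \<le> (\<integral>p. 1 \<partial>MM)"
    unfolding energy_def
  proof (rule integral_mono)
    show "integrable MM (\<lambda>p. (avg V q (q (fst p)) (q (snd p)))\<^sup>2)"
      using step_bmeas[OF q, of "\<lambda>i j. (avg V q i j)\<^sup>2"] by (rule integrable_MM)
    show "(avg V q (q (fst p)) (q (snd p)))\<^sup>2 \<le> 1" for p :: "'a \<times> 'a"
      using avg_bounds[OF q V] by (intro power_le_one)
  qed simp
  also have "\<dots> = 1" using pair.P.prob_space by simp
  finally show "energy V q \<le> 1" .
qed

text \<open>Pythagoras: the averages on q are a step function of r, so by the projection property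
  the cross term equals the energy of q.\<close>

lemma energy_diff:
  assumes q: "labelling N q" and r: "labelling K r" and rq: "refines r q"
    and V: "graphon M V"
  shows "energy V r - energy V q = dint (\<lambda>x y. (avg V r (r x) (r y) - avg V q (q x) (q y))\<^sup>2)"
proof -
  note Vb = graphon_bmeas[OF V]
  obtain f where f: "\<And>x. q x = f (r x)" using rq unfolding refines_def by blast
  let ?a = "\<lambda>p. avg V r (r (fst p)) (r (snd p))" and ?b = "\<lambda>p. avg V q (q (fst p)) (q (snd p))"
  have ab: "?a \<in> bmeas MM" "?b \<in> bmeas MM" by (rule step_bmeas[OF r] step_bmeas[OF q])+
  have bm: "(\<lambda>p. ?b p * ?a p) \<in> bmeas MM" "(\<lambda>p. ?b p * ?b p) \<in> bmeas MM" "(\<lambda>p. ?a p * ?a p) \<in> bmeas MM"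
    by (intro bmeas_mult ab)+
  have "(\<integral>p. ?b p * ?a p \<partial>MM) = (\<integral>p. ?b p * V (fst p) (snd p) \<partial>MM)"
    unfolding f by (rule step_integral_avg[OF r Vb, of "\<lambda>i j. avg V q (f i) (f j)", unfolded f])
  also have "\<dots> = (\<integral>p. ?b p * ?b p \<partial>MM)"
    by (rule step_integral_avg[OF q Vb, symmetric])
  finally have cross: "(\<integral>p. ?b p * ?a p \<partial>MM) = (\<integral>p. ?b p * ?b p \<partial>MM)" .
  have "(\<integral>p. (?a p - ?b p)\<^sup>2 \<partial>MM) = (\<integral>p. (?a p * ?a p - 2 * (?b p * ?a p)) + ?b p * ?b p \<partial>MM)"
    by (simp add: power2_eq_square algebra_simps)
  also have "\<dots> = (\<integral>p. ?a p * ?a p - 2 * (?b p * ?a p) \<partial>MM) + (\<integral>p. ?b p * ?b p \<partial>MM)"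
    by (intro Bochner_Integration.integral_add integrable_MM bmeas_diff bmeas_mult bmeas_const ab)
  also have "(\<integral>p. ?a p * ?a p - 2 * (?b p * ?a p) \<partial>MM) = (\<integral>p. ?a p * ?a p \<partial>MM) - (\<integral>p. 2 * (?b p * ?a p) \<partial>MM)"
    by (intro Bochner_Integration.integral_diff integrable_MM bmeas_mult bmeas_const ab)
  finally show ?thesis using cross by (simp add: energy_def power2_eq_square)
qed

text \<open>Joining with one more set doubles the label bound, which therefore depends on the family
  only through its size.\<close>

lemma labelling_refine_family:
  assumes q: "labelling N q" and I: "finite I" and F: "\<And>i. i \<in> I \<Longrightarrow> F i \<in> sets M"
  shows "\<exists>r. labelling (N * 2 ^ card I) r \<and> refines r q \<and> (\<forall>i\<in>I. refines r (indicator (F i)))"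
  using I F
proof (induction I)
  case empty
  have "refines q q" unfolding refines_def by auto
  then show ?case using q by auto
next
  case (insert i I)
  then obtain r where r: "labelling (N * 2 ^ card I) r" "refines r q" "\<forall>i\<in>I. refines r (indicator (F i))"
    by auto
  obtain s where s: "labelling (N * 2 ^ card I * 2) s" "refines s r" "refines s (indicator (F i))"
    using labelling_join[OF r(1) labelling_set[of "F i"]] insert by auto
  have "refines s (indicator (F j))" if "j \<in> insert i I" for j
  proof (cases "j = i")
    case False
    then show ?thesis using that r(3) by (intro refines_trans[OF s(2)]) auto
  qed (use s(3) in simp)
  then have "\<forall>j\<in>insert i I. refines s (indicator (F j))" by blast
  moreover have "refines s q" using s r refines_trans by blast
  ultimately show ?case using s(1) insert by (auto simp: mult_ac)
qed

text \<open>Refine by the witnesses of irregularity and test \<open>avg V r - avg V q\<close> against the signed sum of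
  their rectangles; that sum is bounded by \<open>1\<close> since the rectangles lie in distinct cells.\<close>

lemma energy_increment:
  assumes q: "labelling N q" and V: "graphon M V" and \<delta>: "\<delta> > 0" and irr: "irregular_mass V q \<delta> N > \<delta>"
  shows "\<exists>r. labelling (N * 2 ^ (2 * N * N)) r \<and> refines r q \<and> energy V r \<ge> energy V q + \<delta> ^ 4"
proof -
  note Vb = graphon_bmeas[OF V]
  let ?P = "\<lambda>i. q -` {i}"
  let ?D = "\<lambda>i j A B. rect A B V - avg V q i j * (measure M A * measure M B)"
  let ?R = "\<lambda>i j A B. A \<in> sets M \<and> B \<in> sets M \<and> A \<subseteq> ?P i \<and> B \<subseteq> ?P j \<and>
      (\<not> regular_pair V q \<delta> i j \<longrightarrow> \<bar>?D i j A B\<bar> > \<delta> * (cell_wt q i * cell_wt q j))"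
  \<comment> \<open>Regular pairs receive empty witnesses, so that the choice is total.\<close>
  have "\<exists>A B. ?R i j A B" for i j
  proof (cases "regular_pair V q \<delta> i j")
    case True
    then show ?thesis by (intro exI[of _ "{}"]) auto
  next
    case False
    then show ?thesis unfolding regular_pair_def by (auto simp: not_le)
  qed
  then have "\<forall>ij. \<exists>AB. ?R (fst ij) (snd ij) (fst AB) (snd AB)" by simp
  then obtain T where T: "\<And>ij. ?R (fst ij) (snd ij) (fst (T ij)) (snd (T ij))" by (rule choice[THEN exE]) blast
  define A B where "A i j = fst (T (i, j))" and "B i j = snd (T (i, j))" for i j
  have A: "\<And>i j. A i j \<in> sets M" and B: "\<And>i j. B i j \<in> sets M"
    and AP: "\<And>i j. A i j \<subseteq> ?P i" and BP: "\<And>i j. B i j \<subseteq> ?P j"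
    and big: "\<And>i j. \<not> regular_pair V q \<delta> i j \<Longrightarrow> \<bar>?D i j (A i j) (B i j)\<bar> > \<delta> * (cell_wt q i * cell_wt q j)"
    using T[of "(i, j)" for i j] unfolding A_def B_def fst_conv snd_conv by blast+
  \<comment> \<open>The Boolean tells the two witnesses of a pair apart; this makes 2 * N * N
    sets.\<close>
  define I where "I = ({..<N} \<times> {..<N}) \<times> (UNIV :: bool set)"
  define F where "F = (\<lambda>((i, j), c). if c then A i j else B i j)"
  have "finite I" by (simp add: I_def)
  moreover have "F i \<in> sets M" for i using A B by (auto simp: F_def split: prod.split)
  ultimately obtain r where r: "labelling (N * 2 ^ card I) r" and rq: "refines r q" and rF: "\<And>i. i \<in> I \<Longrightarrow> refines r (indicator (F i))"
    using labelling_refine_family[OF q, of I F] by blast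
  have cI: "card I = 2 * N * N" by (simp add: I_def card_cartesian_product)
  obtain f where f: "\<And>x. q x = f (r x)" using rq unfolding refines_def by blast
  have "\<forall>i\<in>I. \<exists>g. \<forall>x. (indicator (F i) x :: nat) = g (r x)" using rF unfolding refines_def by blast
  then obtain g where g: "\<And>i x. i \<in> I \<Longrightarrow> (indicator (F i) x :: nat) = g i (r x)"
    by (metis (no_types, lifting) bchoice)
  \<comment> \<open>The sign lets every irregular pair contribute the absolute value of its
    deviation.\<close>
  define \<sigma> where "\<sigma> i j = (if regular_pair V q \<delta> i j then 0 else sgn (?D i j (A i j) (B i j)))" for i j
  define \<phi> where "\<phi> x y = \<sigma> (q x) (q y) * (indicator (A (q x) (q y)) x * indicator (B (q x) (q y)) y)" for x y
  define t where "t u v = \<sigma> (f u) (f v) * (real (g ((f u, f v), True) u) * real (g ((f u, f v), False) v))" for u v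
  have qN: "q x < N" for x using q by (simp add: labelling_def)
  \<comment> \<open>Because r refines all witnesses, \<phi> is a step function of r.\<close>
  have \<phi>t: "\<phi> x y = t (r x) (r y)" for x y
  proof -
    have I: "((q x, q y), c) \<in> I" for c using qN by (simp add: I_def)
    have "real (indicator (A (q x) (q y)) x) = real (g ((q x, q y), True) (r x))"
      "real (indicator (B (q x) (q y)) y) = real (g ((q x, q y), False) (r y))"
      using g[OF I[of True], of x] g[OF I[of False], of y] by (simp_all add: F_def)
    then show ?thesis unfolding \<phi>_def t_def f[symmetric] by (simp add: indicator_def)
  qed
  have \<sigma>1: "\<bar>\<sigma> i j\<bar> \<le> 1" for i j by (auto simp: \<sigma>_def sgn_if)
  have \<phi>1: "(\<phi> x y)\<^sup>2 \<le> 1" for x y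
  proof -
    have "\<bar>\<phi> x y\<bar> \<le> 1" using \<sigma>1[of "q x" "q y"] by (auto simp: \<phi>_def split: split_indicator)
    then show ?thesis by (simp add: abs_square_le_1)
  qed
  have \<phi>b: "(\<lambda>p. \<phi> (fst p) (snd p)) \<in> bmeas MM" unfolding \<phi>t by (rule step_bmeas[OF r])
  let ?a = "\<lambda>p. avg V r (r (fst p)) (r (snd p))" and ?b = "\<lambda>p. avg V q (q (fst p)) (q (snd p))"
  have ab: "?a \<in> bmeas MM" "?b \<in> bmeas MM" by (rule step_bmeas[OF r] step_bmeas[OF q])+
  have eq1: "(\<integral>p. \<phi> (fst p) (snd p) * ?a p \<partial>MM) = (\<integral>p. \<phi> (fst p) (snd p) * V (fst p) (snd p) \<partial>MM)"
    unfolding \<phi>t by (rule step_integral_avg[OF r Vb])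
  have Rb: "(\<lambda>p. \<sigma> i j * (indicator (A i j) (fst p) * indicator (B i j) (snd p) * (V (fst p) (snd p) - avg V q i j))) \<in> bmeas MM" for i j
    by (intro bmeas_mult bmeas_const rect_bmeas[where H="\<lambda>x y. V x y - avg V q i j"] bmeas_diff Vb A B)
  have "(\<integral>p. \<phi> (fst p) (snd p) * (V (fst p) (snd p) - ?b p) \<partial>MM)
      = (\<integral>p. (\<Sum>i<N. \<Sum>j<N. \<sigma> i j * (indicator (A i j) (fst p) * indicator (B i j) (snd p) * (V (fst p) (snd p) - avg V q i j))) \<partial>MM)"
  proof (intro Bochner_Integration.integral_cong refl)
    fix p :: "'a \<times> 'a"
    obtain x y where p: "p = (x, y)" by (cases p)
    let ?G = "\<lambda>i j. \<sigma> i j * (indicator (A i j) x * indicator (B i j) y * (V x y - avg V q i j))"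
    have "\<phi> x y * (V x y - avg V q (q x) (q y)) = ?G (q x) (q y)" by (simp add: \<phi>_def)
    also have "\<dots> = (\<Sum>i<N. \<Sum>j<N. ?G i j * (indicator (?P i) x * indicator (?P j) y))"
      by (rule step_expand[OF q])
    also have "\<dots> = (\<Sum>i<N. \<Sum>j<N. ?G i j)"
      using AP BP by (intro sum.cong refl) (force split: split_indicator)
    finally show "\<phi> (fst p) (snd p) * (V (fst p) (snd p) - ?b p) = (\<Sum>i<N. \<Sum>j<N. \<sigma> i j *
      (indicator (A i j) (fst p) * indicator (B i j) (snd p) * (V (fst p) (snd p) - avg V q i j)))"
      using p by simp
  qed
  also have "\<dots> = (\<Sum>i<N. \<integral>p. (\<Sum>j<N. \<sigma> i j * (indicator (A i j) (fst p) * indicator (B i j) (snd p) * (V (fst p) (snd p) - avg V q i j))) \<partial>MM)"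
    by (intro Bochner_Integration.integral_sum integrable_MM bmeas_sum Rb)
  also have "\<dots> = (\<Sum>i<N. \<Sum>j<N. \<integral>p. \<sigma> i j * (indicator (A i j) (fst p) * indicator (B i j) (snd p) * (V (fst p) (snd p) - avg V q i j)) \<partial>MM)"
    by (intro sum.cong refl Bochner_Integration.integral_sum integrable_MM Rb)
  also have "\<dots> = (\<Sum>i<N. \<Sum>j<N. \<sigma> i j * ?D i j (A i j) (B i j))"
    using rect_diff[OF Vb A B] by simp
  also have "\<dots> \<ge> (\<Sum>i<N. \<Sum>j<N. \<delta> * (if regular_pair V q \<delta> i j then 0 else cell_wt q i * cell_wt q j))"
  proof (intro sum_mono)
    fix i j
    show "\<delta> * (if regular_pair V q \<delta> i j then 0 else cell_wt q i * cell_wt q j) \<le> \<sigma> i j * ?D i j (A i j) (B i j)"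
    proof (cases "regular_pair V q \<delta> i j")
      case False
      then have "\<sigma> i j * ?D i j (A i j) (B i j) = \<bar>?D i j (A i j) (B i j)\<bar>"
        by (simp add: \<sigma>_def abs_sgn mult.commute)
      then show ?thesis using big[OF False] False by simp
    qed (simp add: \<sigma>_def)
  qed
  also have "(\<Sum>i<N. \<Sum>j<N. \<delta> * (if regular_pair V q \<delta> i j then 0 else cell_wt q i * cell_wt q j)) = \<delta> * irregular_mass V q \<delta> N"
    by (simp add: irregular_mass_def sum_distrib_left)
  finally have "\<delta> * irregular_mass V q \<delta> N \<le> (\<integral>p. \<phi> (fst p) (snd p) * (V (fst p) (snd p) - ?b p) \<partial>MM)" .
  moreover have "\<delta> * \<delta> \<le> \<delta> * irregular_mass V q \<delta> N" using irr \<delta> by simp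
  ultimately have low: "\<delta>\<^sup>2 \<le> (\<integral>p. \<phi> (fst p) (snd p) * (V (fst p) (snd p) - ?b p) \<partial>MM)"
    by (simp add: power2_eq_square)
  also have "\<dots> = (\<integral>p. \<phi> (fst p) (snd p) * V (fst p) (snd p) - \<phi> (fst p) (snd p) * ?b p \<partial>MM)"
    by (simp add: right_diff_distrib)
  also have "\<dots> = (\<integral>p. \<phi> (fst p) (snd p) * ?a p \<partial>MM) - (\<integral>p. \<phi> (fst p) (snd p) * ?b p \<partial>MM)"
    unfolding eq1 by (intro Bochner_Integration.integral_diff integrable_MM bmeas_mult \<phi>b Vb ab)
  also have "\<dots> = (\<integral>p. \<phi> (fst p) (snd p) * (?a p - ?b p) \<partial>MM)"
    unfolding right_diff_distrib by (intro Bochner_Integration.integral_diff[symmetric] integrable_MM bmeas_mult \<phi>b ab)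
  finally have low: "\<delta>\<^sup>2 \<le> (\<integral>p. \<phi> (fst p) (snd p) * (?a p - ?b p) \<partial>MM)" .
  \<comment> \<open>Completing the square does the work of Cauchy-Schwarz: \<open>(a - b)^2 \<ge> 2
    * \<delta>^2 * \<phi> * (a - b) - \<delta>^4\<close>, since \<phi> is bounded by 1 in absolute
    value.\<close>
  have "\<delta> ^ 4 \<le> 2 * \<delta>\<^sup>2 * (\<integral>p. \<phi> (fst p) (snd p) * (?a p - ?b p) \<partial>MM) - \<delta> ^ 4"
    using mult_left_mono[OF low, of "2 * \<delta>\<^sup>2"] by (simp add: power2_eq_square power4_eq_xxxx)
  also have "\<dots> = (\<integral>p. 2 * \<delta>\<^sup>2 * (\<phi> (fst p) (snd p) * (?a p - ?b p)) \<partial>MM) - (\<integral>p. \<delta> ^ 4 \<partial>MM)"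
    using pair.P.prob_space by simp
  also have "\<dots> = (\<integral>p. 2 * \<delta>\<^sup>2 * (\<phi> (fst p) (snd p) * (?a p - ?b p)) - \<delta> ^ 4 \<partial>MM)"
    by (intro Bochner_Integration.integral_diff[symmetric] integrable_MM bmeas_mult bmeas_diff bmeas_const \<phi>b ab)
  also have "\<dots> \<le> (\<integral>p. (?a p - ?b p)\<^sup>2 \<partial>MM)"
  proof (intro integral_mono integrable_MM bmeas_mult bmeas_diff bmeas_const \<phi>b ab)
    show "(\<lambda>p. (?a p - ?b p)\<^sup>2) \<in> bmeas MM" unfolding power2_eq_square by (intro bmeas_mult bmeas_diff ab)
    fix p :: "'a \<times> 'a"
    have "0 \<le> ((?a p - ?b p) - \<delta>\<^sup>2 * \<phi> (fst p) (snd p))\<^sup>2" by simp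
    also have "\<dots> = (?a p - ?b p)\<^sup>2 - 2 * \<delta>\<^sup>2 * (\<phi> (fst p) (snd p) * (?a p - ?b p)) + \<delta> ^ 4 * (\<phi> (fst p) (snd p))\<^sup>2"
      by (simp add: power2_eq_square power4_eq_xxxx algebra_simps)
    also have "\<dots> \<le> (?a p - ?b p)\<^sup>2 - 2 * \<delta>\<^sup>2 * (\<phi> (fst p) (snd p) * (?a p - ?b p)) + \<delta> ^ 4 * 1"
      by (intro add_left_mono mult_left_mono \<phi>1) simp
    finally show "2 * \<delta>\<^sup>2 * (\<phi> (fst p) (snd p) * (?a p - ?b p)) - \<delta> ^ 4 \<le> (?a p - ?b p)\<^sup>2" by simp
  qed
  finally have "energy V r \<ge> energy V q + \<delta> ^ 4"
    using energy_diff[OF q r rq V] by simp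
  then show ?thesis using r rq unfolding cI by blast
qed

text \<open>Here m bounds the number of increments of \<open>\<delta> ^ 4\<close> that fit below the
  maximal energy 1. K is found before V and q, and N varies in the induction because a refinement
  has a larger label bound.\<close>

lemma regularity_iterate:
  assumes \<delta>: "\<delta> > 0"
  shows "\<exists>K. \<forall>V q. graphon M V \<longrightarrow> labelling N q \<longrightarrow> energy V q \<ge> 1 - real m * \<delta> ^ 4 \<longrightarrow>
    (\<exists>n r. n \<le> K \<and> labelling n r \<and> refines r q \<and> irregular_mass V r \<delta> n \<le> \<delta>)"
proof (induction m arbitrary: N)
  case 0
  have "\<exists>n r. n \<le> N \<and> labelling n r \<and> refines r q \<and> irregular_mass V r \<delta> n \<le> \<delta>"
    if V: "graphon M V" and q: "labelling N q" and e: "1 \<le> energy V q" for V q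
  proof -
    have "irregular_mass V q \<delta> N \<le> \<delta>"
    proof (rule ccontr)
      assume "\<not> ?thesis"
      then obtain r where r: "labelling (N * 2 ^ (2 * N * N)) r" "energy V r \<ge> energy V q + \<delta> ^ 4"
        using energy_increment[OF q V \<delta>] by auto
      have "1 + \<delta> ^ 4 \<le> 1" using energy_bounds(2)[OF r(1) V] r(2) e by linarith
      then show False using \<delta> by simp
    qed
    then show ?thesis
      using q by (intro exI[of _ N] exI[of _ q]) (auto simp: refines_def)
  qed
  then show ?case by (intro exI[of _ N]) simp
next
  case (Suc m)
  obtain K where K: "\<And>V q. graphon M V \<Longrightarrow> labelling (N * 2 ^ (2 * N * N)) q \<Longrightarrow> energy V q \<ge> 1 - real m * \<delta> ^ 4 \<Longrightarrow>
    (\<exists>n r. n \<le> K \<and> labelling n r \<and> refines r q \<and> irregular_mass V r \<delta> n \<le> \<delta>)"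
    using Suc by blast
  show ?case
  proof (rule exI[of _ "max N K"], intro allI impI)
    fix V q assume V: "graphon M V" and q: "labelling N q" and e: "1 - real (Suc m) * \<delta> ^ 4 \<le> energy V q"
    show "\<exists>n r. n \<le> max N K \<and> labelling n r \<and> refines r q \<and> irregular_mass V r \<delta> n \<le> \<delta>"
    proof (cases "irregular_mass V q \<delta> N \<le> \<delta>")
      case True
      then show ?thesis using q by (intro exI[of _ N] exI[of _ q]) (auto simp: refines_def)
    next
      case False
      then obtain r where r: "labelling (N * 2 ^ (2 * N * N)) r" "refines r q" "energy V r \<ge> energy V q + \<delta> ^ 4"
        using energy_increment[OF q V \<delta>] by auto
      have "energy V r \<ge> 1 - real m * \<delta> ^ 4" using r(3) e by (simp add: algebra_simps)
      then obtain n s where "n \<le> K" "labelling n s" "refines s r" "irregular_mass V s \<delta> n \<le> \<delta>"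
        using K[OF V r(1)] by blast
      then show ?thesis using refines_trans[of s r q] r(2) by (intro exI[of _ n] exI[of _ s]) auto
    qed
  qed
qed

text \<open>Once m * \<open>\<delta> ^ 4\<close> exceeds 1, the energy hypothesis of the iteration
  holds for every partition. The number of labels is bounded uniformly in V.\<close>

lemma regularity:
  assumes \<delta>: "\<delta> > 0"
  shows "\<exists>K. \<forall>V q. graphon M V \<longrightarrow> labelling N q \<longrightarrow>
    (\<exists>n r. n \<le> K \<and> labelling n r \<and> refines r q \<and> irregular_mass V r \<delta> n \<le> \<delta>)"
proof -
  obtain m where m: "1 < real m * \<delta> ^ 4"
    using reals_Archimedean3[of "\<delta> ^ 4"] \<delta> by auto
  obtain K where K: "\<And>V q. graphon M V \<Longrightarrow> labelling N q \<Longrightarrow> energy V q \<ge> 1 - real m * \<delta> ^ 4 \<Longrightarrow>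
    (\<exists>n r. n \<le> K \<and> labelling n r \<and> refines r q \<and> irregular_mass V r \<delta> n \<le> \<delta>)"
    using regularity_iterate[OF \<delta>, of N m] by blast
  have "\<exists>n r. n \<le> K \<and> labelling n r \<and> refines r q \<and> irregular_mass V r \<delta> n \<le> \<delta>"
    if "graphon M V" "labelling N q" for V q
  proof (rule K[OF that])
    show "1 - real m * \<delta> ^ 4 \<le> energy V q" using energy_bounds(1)[OF that(2,1)] m by linarith
  qed
  then show ?thesis by blast
qed

section \<open>From rectangles to weight functions\<close>

text \<open>A functional linear in u, with u between 0 and the indicator of P, is largest at an
  indicator: A collects the points of P where the inner integral is positive.\<close>

lemma integral_le_rect_fst:
  assumes H: "(\<lambda>p. H (fst p) (snd p)) \<in> bmeas MM" and P: "P \<in> sets M"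
    and u: "u \<in> bmeas M" and v: "v \<in> bmeas M"
    and ub: "\<And>x. 0 \<le> u x" "\<And>x. u x \<le> indicator P x"
  shows "\<exists>A\<in>sets M. A \<subseteq> P \<and> (\<integral>p. u (fst p) * v (snd p) * H (fst p) (snd p) \<partial>MM)
      \<le> (\<integral>p. indicator A (fst p) * v (snd p) * H (fst p) (snd p) \<partial>MM)"
proof -
  have [measurable]: "(\<lambda>p. H (fst p) (snd p)) \<in> borel_measurable MM" "v \<in> borel_measurable M"
    using H v by (auto intro: bmeas_measurable)
  define a where "a x = (\<integral>y. v y * H x y \<partial>M)" for x
  have eq: "(\<integral>p. w (fst p) * v (snd p) * H (fst p) (snd p) \<partial>MM) = (\<integral>x. w x * a x \<partial>M)"
    and ib: "integrable M (\<lambda>x. w x * a x)" if w: "w \<in> bmeas M" for w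
  proof -
    have i: "integrable MM (\<lambda>p. w (fst p) * v (snd p) * H (fst p) (snd p))"
      by (intro integrable_MM bmeas_mult bmeas_fst bmeas_snd w v H)
    have c: "(\<integral>y. w x * v y * H x y \<partial>M) = w x * a x" for x
      unfolding a_def by (subst integral_mult_right_zero[symmetric]) (simp add: mult.assoc)
    show "(\<integral>p. w (fst p) * v (snd p) * H (fst p) (snd p) \<partial>MM) = (\<integral>x. w x * a x \<partial>M)"
      using pair.integral_fst'[OF i] by (simp add: c)
    show "integrable M (\<lambda>x. w x * a x)"
      using pair.integrable_fst'[OF i] by (simp add: c)
  qed
  have am: "a \<in> borel_measurable M"
    unfolding a_def by (intro borel_measurable_lebesgue_integral) (simp add: split_beta')
  define A where "A = P \<inter> {x \<in> space M. a x > 0}"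
  have A: "A \<in> sets M" unfolding A_def using P am by measurable
  have "(\<integral>x. u x * a x \<partial>M) \<le> (\<integral>x. indicator A x * a x \<partial>M)"
  proof (intro integral_mono ib u bmeas_indicator A)
    fix x
    show "u x * a x \<le> indicator A x * a x"
    proof (cases "x \<in> P \<and> a x > 0")
      case True
      then have "u x * a x \<le> 1 * a x" using ub(2)[of x] by (intro mult_right_mono) auto
      then show ?thesis using True by (simp add: A_def)
    next
      case False
      have "u x * a x \<le> 0"
      proof (cases "x \<in> P")
        case True
        then show ?thesis using False ub(1)[of x] by (intro mult_nonneg_nonpos) auto
      next
        case False
        then have "u x = 0" using ub[of x] by simp
        then show ?thesis by simp
      qed
      then show ?thesis using False by (auto simp: A_def)
    qed
  qed
  then have "(\<integral>p. u (fst p) * v (snd p) * H (fst p) (snd p) \<partial>MM)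
      \<le> (\<integral>p. indicator A (fst p) * v (snd p) * H (fst p) (snd p) \<partial>MM)"
    by (simp add: eq[OF u] eq[OF bmeas_indicator[OF A]])
  then show ?thesis using A by (auto simp: A_def)
qed

text \<open>The two variables are rounded in turn, the second after exchanging the
  coordinates.\<close>

lemma integral_le_rect:
  assumes H: "(\<lambda>p. H (fst p) (snd p)) \<in> bmeas MM" and P: "P \<in> sets M" and Q: "Q \<in> sets M"
    and u: "u \<in> bmeas M" and v: "v \<in> bmeas M"
    and ub: "\<And>x. 0 \<le> u x" "\<And>x. u x \<le> indicator P x"
    and vb: "\<And>x. 0 \<le> v x" "\<And>x. v x \<le> indicator Q x"
  shows "\<exists>A\<in>sets M. \<exists>B\<in>sets M. A \<subseteq> P \<and> B \<subseteq> Q \<and> (\<integral>p. u (fst p) * v (snd p) * H (fst p) (snd p) \<partial>MM) \<le> rect A B H"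
proof -
  have swap: "(\<integral>p. f (fst p) * g (snd p) * H (fst p) (snd p) \<partial>MM) = (\<integral>p. g (fst p) * f (snd p) * H (snd p) (fst p) \<partial>MM)"
    if "f \<in> bmeas M" "g \<in> bmeas M" for f g
  proof -
    have "(\<lambda>p. f (fst p) * g (snd p) * H (fst p) (snd p)) \<in> borel_measurable MM"
      by (intro bmeas_measurable bmeas_mult bmeas_fst bmeas_snd that H)
    from pair.integral_product_swap[OF this] show ?thesis by (simp add: split_beta' mult_ac)
  qed
  have Hs: "(\<lambda>p. H (snd p) (fst p)) \<in> bmeas MM"
    using bmeas_compose[OF H, of "\<lambda>p. (snd p, fst p)" MM] by simp
  obtain A where A: "A \<in> sets M" "A \<subseteq> P" and 1: "(\<integral>p. u (fst p) * v (snd p) * H (fst p) (snd p) \<partial>MM)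
      \<le> (\<integral>p. indicator A (fst p) * v (snd p) * H (fst p) (snd p) \<partial>MM)"
    using integral_le_rect_fst[OF H P u v ub] by blast
  obtain B where B: "B \<in> sets M" "B \<subseteq> Q" and 2: "(\<integral>p. v (fst p) * indicator A (snd p) * H (snd p) (fst p) \<partial>MM)
      \<le> (\<integral>p. indicator B (fst p) * indicator A (snd p) * H (snd p) (fst p) \<partial>MM)"
    using integral_le_rect_fst[of "\<lambda>x y. H y x", OF Hs Q v bmeas_indicator[OF A(1)] vb] by blast
  have "(\<integral>p. u (fst p) * v (snd p) * H (fst p) (snd p) \<partial>MM) \<le> rect A B H"
    using 1 2 by (simp add: swap[OF bmeas_indicator[OF A(1)] v] swap[OF bmeas_indicator[OF A(1)] bmeas_indicator[OF B(1)]])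
  then show ?thesis using A B by blast
qed

text \<open>In the counting lemma the factors attached to one endpoint of an edge take values in
  [0,1] and are not indicators. Rounding to rectangles is applied to V minus its density and to the
  negative of that.\<close>

lemma regular_pair_functions:
  assumes q: "labelling N q" and V: "graphon M V" and reg: "regular_pair V q \<delta> i j"
    and u: "u \<in> bmeas M" and v: "v \<in> bmeas M"
    and ub: "\<And>x. 0 \<le> u x" "\<And>x. u x \<le> indicator (q -` {i}) x"
    and vb: "\<And>x. 0 \<le> v x" "\<And>x. v x \<le> indicator (q -` {j}) x"
  shows "\<bar>\<integral>p. u (fst p) * v (snd p) * (V (fst p) (snd p) - avg V q i j) \<partial>MM\<bar> \<le> \<delta> * (cell_wt q i * cell_wt q j)"
proof -
  note qs = labelling_sets[OF q] and Vb = graphon_bmeas[OF V]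
  let ?H = "\<lambda>x y. V x y - avg V q i j"
  have Hb: "(\<lambda>p. ?H (fst p) (snd p)) \<in> bmeas MM" "(\<lambda>p. - ?H (fst p) (snd p)) \<in> bmeas MM"
    by (intro bmeas_diff Vb bmeas_const bmeas_uminus)+
  have bd: "\<bar>rect A B ?H\<bar> \<le> \<delta> * (cell_wt q i * cell_wt q j)"
    if "A \<in> sets M" "B \<in> sets M" "A \<subseteq> q -` {i}" "B \<subseteq> q -` {j}" for A B
    using reg that unfolding regular_pair_def by (simp add: rect_diff[OF Vb])
  have "(\<integral>p. u (fst p) * v (snd p) * ?H (fst p) (snd p) \<partial>MM) \<le> \<delta> * (cell_wt q i * cell_wt q j)"
    using integral_le_rect[of ?H, OF Hb(1) qs qs u v ub vb] bd by fastforce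
  moreover have "(\<integral>p. u (fst p) * v (snd p) * - ?H (fst p) (snd p) \<partial>MM) \<le> \<delta> * (cell_wt q i * cell_wt q j)"
  proof -
    obtain A B where AB: "A \<in> sets M" "B \<in> sets M" "A \<subseteq> q -` {i}" "B \<subseteq> q -` {j}" and
      le: "(\<integral>p. u (fst p) * v (snd p) * - ?H (fst p) (snd p) \<partial>MM) \<le> rect A B (\<lambda>x y. - ?H x y)"
      using integral_le_rect[of "\<lambda>x y. - ?H x y", OF Hb(2) qs qs u v ub vb] by blast
    have "rect A B (\<lambda>x y. - ?H x y) = - rect A B ?H"
      by (subst Bochner_Integration.integral_minus[symmetric]) (simp only: mult_minus_right)
    then show ?thesis using bd[OF AB] le by linarith
  qed
  moreover have "(\<integral>p. u (fst p) * v (snd p) * - ?H (fst p) (snd p) \<partial>MM) = - (\<integral>p. u (fst p) * v (snd p) * ?H (fst p) (snd p) \<partial>MM)"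
    by (subst Bochner_Integration.integral_minus[symmetric]) (simp only: mult_minus_right)
  ultimately show ?thesis by linarith
qed

section \<open>Counting and redistribution of tilings\<close>

lemma bmeas_integrable_Pw: "f \<in> bmeas (Pw k) \<Longrightarrow> integrable (Pw k) f"
  using prob_space_Pw[of k] by (intro finite_measure.bmeas_integrable) (rule prob_space.finite_measure)

lemma bmeas_component: "f \<in> bmeas M \<Longrightarrow> l < k \<Longrightarrow> (\<lambda>z. f (z l)) \<in> bmeas (Pw k)"
  by (rule bmeas_compose) (auto intro: measurable_component_singleton)

lemma bmeas_edge:
  assumes "(\<lambda>p. H (fst p) (snd p)) \<in> bmeas MM" "i < k" "j < k"
  shows "(\<lambda>z. H (z i) (z j)) \<in> bmeas (Pw k)"
proof -
  have "(\<lambda>z. (z i, z j)) \<in> measurable (Pw k) MM"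
    using assms by (intro measurable_Pair measurable_component_singleton) auto
  from bmeas_compose[OF assms(1) this] show ?thesis by simp
qed

lemma tensorF_bmeas:
  assumes "graphon M V" "graph_on k E" shows "tensorF E V \<in> bmeas (Pw k)"
proof -
  have "(\<lambda>z. \<Prod>e\<in>E. V (z (fst e)) (z (snd e))) \<in> bmeas (Pw k)"
    using assms(2) by (intro bmeas_prod bmeas_edge graphon_bmeas assms(1)) (auto simp: graph_on_def)
  moreover have "(\<lambda>z. \<Prod>e\<in>E. V (z (fst e)) (z (snd e))) = tensorF E V"
    by (simp add: tensorF_def fun_eq_iff split_beta)
  ultimately show ?thesis by simp
qed

lemma tensorF_bounds:
  assumes "graphon M V" shows "0 \<le> tensorF E V z" "tensorF E V z \<le> 1"
  unfolding tensorF_def using graphonD[OF assms] by (auto intro!: prod_nonneg prod_le_1)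

lemma integral_prod_Pw:
  assumes "\<And>i. i < k \<Longrightarrow> f i \<in> bmeas M"
  shows "(\<integral>z. (\<Prod>i<k. f i (z i)) \<partial>Pw k) = (\<Prod>i<k. \<integral>x. f i x \<partial>M)"
  using assms by (intro product_sigma_finite.product_integral_prod[OF product_sigma_finite_M] bmeas_integrable) auto

lemma prod_remove_two:
  fixes f :: "nat \<Rightarrow> real"
  assumes "i < j" "j < k" shows "(\<Prod>m<k. f m) = f i * (f j * (\<Prod>m\<in>{..<k}-{i,j}. f m))"
proof -
  have "{..<k} - {i} - {j} = {..<k} - {i, j}" by auto
  then show ?thesis
    using assms prod.remove[of "{..<k}" i f] prod.remove[of "{..<k} - {i}" j f] by simp
qed

lemma integral_prod_Pw_remove_two:
  assumes f: "\<And>m. m < k \<Longrightarrow> f m \<in> bmeas M" and ij: "i < j" "j < k"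
  shows "(\<integral>z. (\<Prod>m\<in>{..<k}-{i,j}. f m (z m)) \<partial>Pw k) = (\<Prod>m\<in>{..<k}-{i,j}. \<integral>x. f m x \<partial>M)"
proof -
  \<comment> \<open>The two missing factors are filled with the constant 1, so that the formula for
    all k coordinates applies.\<close>
  define h where "h m = (if m = i \<or> m = j then (\<lambda>_. 1) else f m)" for m
  have hb: "h m \<in> bmeas M" if "m < k" for m using f[OF that] by (auto simp: h_def)
  \<comment> \<open>Stated for an abstract c, to be used once for the integrand and once for the
    integrals.\<close>
  have eq: "(\<Prod>m<k. c m (h m)) = (\<Prod>m\<in>{..<k}-{i,j}. c m (f m))"
    if "\<And>m. c m (\<lambda>_. 1) = 1" for c :: "nat \<Rightarrow> ('a \<Rightarrow> real) \<Rightarrow> real"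
    unfolding prod_remove_two[OF ij, of "\<lambda>m. c m (h m)"] using that by (auto simp: h_def intro!: prod.cong)
  show ?thesis
    using integral_prod_Pw[OF hb, of k]
    by (subst eq[of "\<lambda>m g. g (z m)" for z, symmetric] eq[of "\<lambda>m g. integral\<^sup>L M g", symmetric],
        simp add: prob_space[simplified])+ simp
qed

text \<open>Replacing the factor of a single edge by its density: the edge occurs only once in the
  graph, so all other factors split into one depending on \<open>x\<^sub>i\<close> and one depending on \<open>x\<^sub>j\<close>.\<close>

lemma counting_edge:
  assumes q: "labelling N q" and V: "graphon M V" and E: "graph_on k E" and ij: "i < j" "j < k"
    and new: "(i, j) \<notin> E" and reg: "regular_pair V q \<delta> (b i) (b j)" and \<delta>: "\<delta> \<ge> 0"
    and f: "\<And>m. m < k \<Longrightarrow> f m \<in> bmeas M" "\<And>m x. 0 \<le> f m x" "\<And>m x. f m x \<le> indicator (q -` {b m}) x"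
  shows "\<bar>\<integral>z. (\<Prod>m<k. f m (z m)) * tensorF E V z * (V (z i) (z j) - avg V q (b i) (b j)) \<partial>Pw k\<bar>
    \<le> \<delta> * (\<Prod>m<k. cell_wt q (b m))"
proof -
  note Vb = graphon_bmeas[OF V]
  let ?d = "avg V q (b i) (b j)"
  have i: "i < k" using ij by simp
  define g where "g z = (\<Prod>m<k. f m (z m)) * tensorF E V z * (V (z i) (z j) - ?d)" for z
  have gb: "g \<in> bmeas (Pw k)"
    unfolding g_def using E
    by (intro bmeas_mult bmeas_prod bmeas_component bmeas_diff bmeas_edge Vb tensorF_bmeas V bmeas_const f ij i) auto
  \<comment> \<open>Coordinate i is integrated out, then j; the result depends on the other
    coordinates only.\<close>
  define G where "G z = (\<integral>x. g (z(i := x)) \<partial>M)" for z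
  have Gb: "G \<in> bmeas (Pw k)" unfolding G_def by (rule bmeas_update_integral(1)[OF i gb])
  define J where "J z = (\<integral>y. G (z(j := y)) \<partial>M)" for z
  have Jb: "J \<in> bmeas (Pw k)" unfolding J_def by (rule bmeas_update_integral(1)[OF ij(2) Gb])
  have "(\<integral>z. g z \<partial>Pw k) = (\<integral>z. J z \<partial>Pw k)"
    using integral_update(2)[OF i gb] integral_update(2)[OF ij(2) Gb] by (simp add: G_def J_def)
  moreover define c where "c z = (\<Prod>m\<in>{..<k}-{i,j}. f m (z m))" for z
  have cb: "c \<in> bmeas (Pw k)" unfolding c_def by (intro bmeas_prod bmeas_component f) auto
  let ?w = "\<delta> * (cell_wt q (b i) * cell_wt q (b j))"
  have bound: "\<bar>J z\<bar> \<le> c z * ?w" if z: "z \<in> space (Pw k)" for z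
  proof -
    \<comment> \<open>The edges at i. As (i, j) is new and edges are increasing, none of them meets
      j, while the remaining edges do not meet i.\<close>
    define E1 where "E1 = {e \<in> E. fst e = i \<or> snd e = i}"
    have fin: "finite E" using E by (rule graph_on_finite)
    let ?e = "\<lambda>e z. V (z (fst e)) (z (snd e))"
    define u where "u x = f i x * (\<Prod>e\<in>E1. ?e e (z(i := x)))" for x
    define v where "v y = f j y * (\<Prod>e\<in>E-E1. ?e e (z(j := y)))" for y
    have Ek: "fst e < k" "snd e < k" "fst e < snd e" if "e \<in> E" for e
      using E that by (auto simp: graph_on_def)
    have eb: "(\<lambda>x. ?e e (z(l := x))) \<in> bmeas M" if "e \<in> E" "l < k" for e l
      using bmeas_compose[OF bmeas_edge[OF Vb Ek(1,2)[OF that(1)]] measurable_update_point[OF that(2) z]] .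
    have ub: "u \<in> bmeas M" unfolding u_def E1_def
      by (intro bmeas_mult f i bmeas_prod eb) auto
    have vb: "v \<in> bmeas M" unfolding v_def
      by (intro bmeas_mult f ij bmeas_prod eb) auto
    have e01: "0 \<le> (\<Prod>e\<in>S. ?e e z')" "(\<Prod>e\<in>S. ?e e z') \<le> 1" for S z'
      using graphonD[OF V] by (auto intro!: prod_nonneg prod_le_1)
    have u0: "0 \<le> u x" and u1: "u x \<le> indicator (q -` {b i}) x" for x
      using mult_nonneg_nonneg[OF f(2)[of i x] e01(1)[of "z(i := x)" E1]] f(3)[of i x]
        mult_right_le_one_le[OF f(2)[of i x] e01(1)[of "z(i := x)" E1] e01(2)[of "z(i := x)" E1]]
      unfolding u_def by linarith+
    have v0: "0 \<le> v x" and v1: "v x \<le> indicator (q -` {b j}) x" for x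
      using mult_nonneg_nonneg[OF f(2)[of j x] e01(1)[of "z(j := x)" "E - E1"]] f(3)[of j x]
        mult_right_le_one_le[OF f(2)[of j x] e01(1)[of "z(j := x)" "E - E1"] e01(2)[of "z(j := x)" "E - E1"]]
      unfolding v_def by linarith+
    have split: "g (z(j := y, i := x)) = c z * (u x * v y * (V x y - ?d))" for x y
    proof -
      let ?z = "z(j := y, i := x)"
      have 1: "(\<Prod>m<k. f m (?z m)) = f i x * (f j y * c z)"
        unfolding prod_remove_two[OF ij] c_def using ij by (auto intro!: prod.cong)
      have E1E: "(\<Prod>e\<in>E. ?e e ?z) = (\<Prod>e\<in>E1. ?e e ?z) * (\<Prod>e\<in>E-E1. ?e e ?z)"
        using fin by (subst prod.subset_diff[of E1 E]) (auto simp: E1_def mult.commute)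
      have 2: "(\<Prod>e\<in>E1. ?e e ?z) = (\<Prod>e\<in>E1. ?e e (z(i := x)))"
      proof (rule prod.cong[OF refl])
        fix e assume e: "e \<in> E1"
        then have "fst e \<noteq> j" "snd e \<noteq> j"
          using new ij Ek[of e] by (auto simp: E1_def)
        then show "?e e ?z = ?e e (z(i := x))" by auto
      qed
      have 3: "(\<Prod>e\<in>E-E1. ?e e ?z) = (\<Prod>e\<in>E-E1. ?e e (z(j := y)))"
        by (intro prod.cong refl) (auto simp: E1_def)
      have 4: "tensorF E V ?z = (\<Prod>e\<in>E. ?e e ?z)" by (simp add: tensorF_def split_beta)
      show ?thesis
        unfolding g_def 1 4 E1E 2 3 u_def v_def using ij by (simp add: mult_ac)
    qed
    have "J z = (\<integral>y. \<integral>x. c z * (u x * v y * (V x y - ?d)) \<partial>M \<partial>M)"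
      unfolding J_def G_def split ..
    also have "\<dots> = c z * (\<integral>y. \<integral>x. u x * v y * (V x y - ?d) \<partial>M \<partial>M)" by simp
    also have "(\<integral>y. \<integral>x. u x * v y * (V x y - ?d) \<partial>M \<partial>M) = (\<integral>p. u (fst p) * v (snd p) * (V (fst p) (snd p) - ?d) \<partial>MM)"
    proof -
      have "integrable MM (\<lambda>p. u (fst p) * v (snd p) * (V (fst p) (snd p) - ?d))"
        by (intro integrable_MM bmeas_mult bmeas_fst bmeas_snd ub vb bmeas_diff Vb bmeas_const)
      then show ?thesis
        using pair.integral_snd[of "\<lambda>x y. u x * v y * (V x y - ?d)"] by (simp add: split_beta')
    qed
    finally have "\<bar>J z\<bar> = c z * \<bar>\<integral>p. u (fst p) * v (snd p) * (V (fst p) (snd p) - ?d) \<partial>MM\<bar>"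
      using f(2) by (simp add: abs_mult c_def prod_nonneg)
    also have "\<dots> \<le> c z * ?w"
      using f(2) by (intro mult_left_mono regular_pair_functions[OF q V reg ub vb u0 u1 v0 v1])
        (simp add: c_def prod_nonneg)
    finally show ?thesis .
  qed
  have "\<bar>\<integral>z. J z \<partial>Pw k\<bar> \<le> (\<integral>z. \<bar>J z\<bar> \<partial>Pw k)" by (rule integral_abs_bound)
  also have "\<dots> \<le> (\<integral>z. c z * ?w \<partial>Pw k)"
    by (intro integral_mono bmeas_integrable_Pw bmeas_abs Jb bmeas_mult cb bmeas_const bound)
  also have "\<dots> = (\<Prod>m\<in>{..<k}-{i,j}. \<integral>x. f m x \<partial>M) * ?w"
    using integral_prod_Pw_remove_two[OF f(1) ij] by (simp add: c_def)
  also have "\<dots> \<le> (\<Prod>m\<in>{..<k}-{i,j}. cell_wt q (b m)) * ?w"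
  proof (intro mult_right_mono prod_mono conjI)
    fix m assume "m \<in> {..<k} - {i, j}"
    then have m: "m < k" by simp
    show "0 \<le> (\<integral>x. f m x \<partial>M)" using f(2) by simp
    have "(\<integral>x. f m x \<partial>M) \<le> (\<integral>x. indicator (q -` {b m}) x \<partial>M)"
      by (intro integral_mono bmeas_integrable bmeas_cell[OF q] f m)
    then show "(\<integral>x. f m x \<partial>M) \<le> cell_wt q (b m)" by (simp add: cell_wt_def)
  qed (use \<delta> in auto)
  also have "\<dots> = \<delta> * (\<Prod>m<k. cell_wt q (b m))"
    by (subst prod_remove_two[OF ij]) (simp add: mult_ac)
  ultimately show ?thesis by (simp add: g_def)
qed


text \<open>Each edge in turn is exchanged for its density, at a cost of \<delta> times the measure
  of the box; densities are at most 1, so earlier errors are not magnified. The weights f allow one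
  coordinate to be restricted to a part of its cell.\<close>

lemma counting:
  assumes q: "labelling N q" and V: "graphon M V" and E: "graph_on k E"
    and reg: "\<And>i j. (i, j) \<in> E \<Longrightarrow> regular_pair V q \<delta> (b i) (b j)" and \<delta>: "\<delta> \<ge> 0"
    and f: "\<And>m. m < k \<Longrightarrow> f m \<in> bmeas M" "\<And>m x. 0 \<le> f m x" "\<And>m x. f m x \<le> indicator (q -` {b m}) x"
  shows "\<bar>(\<integral>z. (\<Prod>m<k. f m (z m)) * tensorF E V z \<partial>Pw k)
      - (\<Prod>e\<in>E. avg V q (b (fst e)) (b (snd e))) * (\<Prod>m<k. \<integral>x. f m x \<partial>M)\<bar>
    \<le> real (card E) * \<delta> * (\<Prod>m<k. cell_wt q (b m))"
  using graph_on_finite[OF E] E reg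
proof (induction E)
  case empty
  then show ?case using integral_prod_Pw[OF f(1), of k] by (simp add: tensorF_def)
next
  case (insert e E)
  obtain i j where e: "e = (i, j)" by (cases e)
  let ?d = "avg V q (b i) (b j)" and ?P = "\<Prod>e\<in>E. avg V q (b (fst e)) (b (snd e))"
  let ?I = "\<Prod>m<k. \<integral>x. f m x \<partial>M" and ?w = "\<Prod>m<k. cell_wt q (b m)"
  let ?F = "\<lambda>z. \<Prod>m<k. f m (z m)"
  have ij: "i < j" "j < k" and E': "graph_on k E" using insert(4) e by (auto simp: graph_on_def)
  have IH: "\<bar>(\<integral>z. ?F z * tensorF E V z \<partial>Pw k) - ?P * ?I\<bar> \<le> real (card E) * \<delta> * ?w"
    using insert E' by auto
  have Fb: "?F \<in> bmeas (Pw k)" by (intro bmeas_prod bmeas_component f) auto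
  note Tb = tensorF_bmeas[OF V E']
  have t: "tensorF (insert e E) V z = V (z i) (z j) * tensorF E V z" for z
    using insert(1,2) e by (simp add: tensorF_def)
  have "(\<integral>z. ?F z * tensorF (insert e E) V z \<partial>Pw k)
      = (\<integral>z. ?F z * tensorF E V z * (V (z i) (z j) - ?d) + ?d * (?F z * tensorF E V z) \<partial>Pw k)"
    unfolding t by (simp add: algebra_simps)
  also have "\<dots> = (\<integral>z. ?F z * tensorF E V z * (V (z i) (z j) - ?d) \<partial>Pw k) + (\<integral>z. ?d * (?F z * tensorF E V z) \<partial>Pw k)"
    using ij by (intro Bochner_Integration.integral_add bmeas_integrable_Pw bmeas_mult Fb Tb bmeas_diff bmeas_edge
        graphon_bmeas V bmeas_const) auto
  finally have eq: "(\<integral>z. ?F z * tensorF (insert e E) V z \<partial>Pw k)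
      = (\<integral>z. ?F z * tensorF E V z * (V (z i) (z j) - ?d) \<partial>Pw k) + ?d * (\<integral>z. ?F z * tensorF E V z \<partial>Pw k)"
    by simp
  have d: "0 \<le> ?d" "?d \<le> 1" using avg_bounds[OF q V] by auto
  have ed: "\<bar>\<integral>z. ?F z * tensorF E V z * (V (z i) (z j) - ?d) \<partial>Pw k\<bar> \<le> \<delta> * ?w"
    using insert(2,5) e by (intro counting_edge[OF q V E' ij _ _ \<delta> f]) auto
  have pe: "(\<Prod>e\<in>insert e E. avg V q (b (fst e)) (b (snd e))) = ?d * ?P"
    using insert(1,2) e by simp
  have ce: "real (card (insert e E)) = real (card E) + 1" using insert(1,2) by simp
  have "\<bar>?d * (\<integral>z. ?F z * tensorF E V z \<partial>Pw k) - ?d * (?P * ?I)\<bar>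
      = ?d * \<bar>(\<integral>z. ?F z * tensorF E V z \<partial>Pw k) - ?P * ?I\<bar>"
    using d by (simp add: abs_mult right_diff_distrib[symmetric])
  also have "\<dots> \<le> 1 * (real (card E) * \<delta> * ?w)" using d IH by (intro mult_mono) auto
  finally show ?case unfolding eq pe ce using ed by (simp add: algebra_simps)
qed

lemma tiling_integrable:
  assumes "is_tiling M k E W t" "k \<ge> 1" shows "integrable (Pw k) t"
proof (rule integrableI_nonneg)
  have "(\<integral>\<^sup>+ z. ennreal (t z) \<partial>Pw k) \<le> 1" by (rule tiling_total[OF assms])
  then show "(\<integral>\<^sup>+ z. ennreal (t z) \<partial>Pw k) < \<infinity>" by (simp add: le_less_trans[OF _ ennreal_one_less_top])
qed (use assms in \<open>auto simp: is_tiling_def intro!: AE_I2\<close>)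

lemma tiling_size_integral:
  assumes "is_tiling M k E W t" shows "tiling_size M k t = (\<integral>z. t z \<partial>Pw k)"
  unfolding tiling_size_def using assms
  by (intro integral_eq_nn_integral[symmetric]) (auto simp: is_tiling_def intro!: AE_I2)

lemma integrable_mult_bmeas:
  assumes t: "integrable (Pw k) t" and f: "f \<in> bmeas (Pw k)"
  shows "integrable (Pw k) (\<lambda>z. t z * f z :: real)"
proof -
  obtain C where C: "\<And>z. z \<in> space (Pw k) \<Longrightarrow> \<bar>f z\<bar> \<le> C" using f unfolding bmeas_def by blast
  have [measurable]: "t \<in> borel_measurable (Pw k)" "f \<in> borel_measurable (Pw k)"
    using t f by (auto intro: bmeas_measurable)
  show ?thesis
  proof (rule Bochner_Integration.integrable_bound)
    show "integrable (Pw k) (\<lambda>z. C * t z)" using t by simp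
    show "AE z in Pw k. norm (t z * f z) \<le> norm (C * t z)"
    proof (rule AE_I2)
      fix z assume z: "z \<in> space (Pw k)"
      have "\<bar>t z\<bar> * \<bar>f z\<bar> \<le> \<bar>t z\<bar> * \<bar>C\<bar>" using C[OF z] by (intro mult_left_mono) auto
      then show "norm (t z * f z) \<le> norm (C * t z)" by (simp add: abs_mult mult.commute)
    qed
  qed simp
qed

lemma tiling_marginal_integral:
  assumes t: "is_tiling M k E W t" and k: "k \<ge> 1" and A: "A \<in> sets M"
  shows "(\<Sum>l<k. \<integral>z. t z * indicator A (z l) \<partial>Pw k) \<le> measure M A"
proof -
  have tn: "0 \<le> t z" if "z \<in> space (Pw k)" for z using t that by (simp add: is_tiling_def)
  have eq: "(\<integral>\<^sup>+ z. ennreal (t z) * indicator A (z l) \<partial>Pw k) = ennreal (\<integral>z. t z * indicator A (z l) \<partial>Pw k)"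
    if l: "l \<in> {..<k}" for l
  proof -
    have "(\<integral>\<^sup>+ z. ennreal (t z) * indicator A (z l) \<partial>Pw k) = (\<integral>\<^sup>+ z. ennreal (t z * indicator A (z l)) \<partial>Pw k)"
      by (intro nn_integral_cong) (auto split: split_indicator)
    also have "\<dots> = ennreal (\<integral>z. t z * indicator A (z l) \<partial>Pw k)"
      using l tn by (intro nn_integral_eq_integral integrable_mult_bmeas tiling_integrable[OF t k]
          bmeas_component bmeas_indicator A AE_I2) (auto split: split_indicator)
    finally show ?thesis .
  qed
  have "ennreal (\<Sum>l<k. \<integral>z. t z * indicator A (z l) \<partial>Pw k) = (\<Sum>l<k. \<integral>\<^sup>+ z. ennreal (t z) * indicator A (z l) \<partial>Pw k)"
    using tn by (subst sum_ennreal[symmetric]) (auto simp: eq intro!: Bochner_Integration.integral_nonneg)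
  also have "\<dots> \<le> ennreal (measure M A)"
    using tiling_marginal[OF t A] by (simp add: emeasure_eq_measure)
  finally show ?thesis by simp
qed

text \<open>Used with b in \<open>PiE {..<k} (\<lambda>_. {..<N})\<close>, where extensionality
  makes every tuple lie in exactly one box.\<close>

definition box :: "nat \<Rightarrow> ('a \<Rightarrow> nat) \<Rightarrow> (nat \<Rightarrow> nat) \<Rightarrow> (nat \<Rightarrow> 'a) \<Rightarrow> real" where
  "box k q b z = (\<Prod>i<k. indicator (q -` {b i}) (z i))"

lemma box_bmeas: "labelling N q \<Longrightarrow> box k q b \<in> bmeas (Pw k)"
  unfolding box_def[abs_def] by (intro bmeas_prod bmeas_component bmeas_cell) auto

lemma box_nonneg: "0 \<le> box k q b z"
  unfolding box_def by (intro prod_nonneg) auto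

lemma box_eq:
  assumes "b \<in> PiE {..<k} B" shows "box k q b z = of_bool (b = (\<lambda>i\<in>{..<k}. q (z i)))"
proof (cases "\<forall>i<k. q (z i) = b i")
  case True
  then have "b = (\<lambda>i\<in>{..<k}. q (z i))" using assms by (auto simp: fun_eq_iff PiE_iff extensional_def)
  then show ?thesis using True by (simp add: box_def)
next
  case False
  then obtain i where "i < k" "q (z i) \<noteq> b i" by blast
  then have "box k q b z = 0" "b \<noteq> (\<lambda>i\<in>{..<k}. q (z i))" by (auto simp: box_def intro!: prod_zero bexI[of _ i])
  then show ?thesis by simp
qed

lemma sum_box:
  fixes h :: "(nat \<Rightarrow> nat) \<Rightarrow> real"
  assumes "labelling N q"
  shows "(\<Sum>b\<in>PiE {..<k} (\<lambda>_. {..<N}). h b * box k q b z) = h (\<lambda>i\<in>{..<k}. q (z i))"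
proof -
  have "(\<lambda>i\<in>{..<k}. q (z i)) \<in> PiE {..<k} (\<lambda>_. {..<N})" using assms by (auto simp: labelling_def)
  moreover have "(\<Sum>b\<in>PiE {..<k} (\<lambda>_. {..<N}). h b * box k q b z)
    = (\<Sum>b\<in>PiE {..<k} (\<lambda>_. {..<N}). if b = (\<lambda>i\<in>{..<k}. q (z i)) then h b else 0)"
    by (intro sum.cong refl) (auto simp: box_eq)
  ultimately show ?thesis by (simp add: finite_PiE)
qed

text \<open>The weight of \<open>t\<close> on each box is redistributed proportionally to the tensor of \<open>V\<close>. By
  counting, this nearly preserves all marginals; dividing by \<open>max 1 (h (z i))\<close> then restores the
  constraint at a cost of the integral of the positive part of \<open>h - 1\<close>.\<close>

lemma til_le_regular:
  fixes \<tau> \<delta> :: real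
  assumes k: "k \<ge> 1" and E: "graph_on k E" and V: "graphon M V" and q: "labelling N q"
    and \<tau>: "\<tau> > 0" and \<delta>: "\<delta> \<ge> 0"
    and W: "\<And>x y. W x y \<noteq> 0 \<Longrightarrow> regular_pair V q \<delta> (q x) (q y) \<and> avg V q (q x) (q y) \<ge> \<tau>"
  shows "til M k E W \<le> til M k E V + real (k + 1) * (real (card E) * \<delta> / \<tau> ^ card E)"
proof (rule til_leI)
  fix t assume t: "is_tiling M k E W t"
  have fin: "finite E" using E by (rule graph_on_finite)
  note ti = tiling_integrable[OF t k]
  have tn: "0 \<le> t z" if "z \<in> space (Pw k)" for z using t that by (simp add: is_tiling_def)
  \<comment> \<open>The relative counting error: \<open>card E * \<delta>\<close> over the least
    product of densities in a box that carries weight.\<close>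
  define \<kappa> where "\<kappa> = real (card E) * \<delta> / \<tau> ^ card E"
  have \<kappa>0: "\<kappa> \<ge> 0" using \<tau> \<delta> by (simp add: \<kappa>_def)
  let ?B = "PiE {..<k} (\<lambda>_. {..<N})"
  have finB: "finite ?B" by (simp add: finite_PiE)
  define T where "T b = (\<integral>z. t z * box k q b z \<partial>Pw k)" for b
  define w where "w b = (\<Prod>i<k. cell_wt q (b i))" for b
  define d where "d b = (\<Prod>e\<in>E. avg V q (b (fst e)) (b (snd e)))" for b
  have T0: "0 \<le> T b" for b
    unfolding T_def using tn box_nonneg by (intro Bochner_Integration.integral_nonneg) auto
  have w0: "0 \<le> w b" for b unfolding w_def by (intro prod_nonneg) auto
  have Tsum: "(\<Sum>b\<in>?B. T b * h b) = (\<integral>z. t z * h (\<lambda>i\<in>{..<k}. q (z i)) \<partial>Pw k)" for h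
  proof -
    have "(\<Sum>b\<in>?B. T b * h b) = (\<Sum>b\<in>?B. \<integral>z. h b * (t z * box k q b z) \<partial>Pw k)"
      by (simp add: T_def mult.commute)
    also have "\<dots> = (\<integral>z. (\<Sum>b\<in>?B. h b * (t z * box k q b z)) \<partial>Pw k)"
      by (intro Bochner_Integration.integral_sum[symmetric] Bochner_Integration.integrable_mult_right
          integrable_mult_bmeas ti box_bmeas[OF q])
    also have "\<dots> = (\<integral>z. t z * (\<Sum>b\<in>?B. h b * box k q b z) \<partial>Pw k)"
      by (simp add: sum_distrib_left mult_ac)
    finally show ?thesis unfolding sum_box[OF q] .
  qed
  have size: "tiling_size M k t = (\<Sum>b\<in>?B. T b)"
    using Tsum[of "\<lambda>_. 1"] tiling_size_integral[OF t] by simp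
  have size1: "(\<Sum>b\<in>?B. T b) \<le> 1" using tiling_size_le_1[OF t k] size by simp
  \<comment> \<open>A box with nonzero weight contains a tuple in the support of t, hence in the
    support of W along every edge.\<close>
  have good: "regular_pair V q \<delta> (b i) (b j) \<and> avg V q (b i) (b j) \<ge> \<tau>"
    if b: "b \<in> ?B" "T b \<noteq> 0" and e: "(i, j) \<in> E" for b i j
  proof -
    have "\<exists>z\<in>space (Pw k). t z * box k q b z \<noteq> 0"
    proof (rule ccontr)
      assume "\<not> ?thesis"
      then have "T b = (\<integral>z. 0 \<partial>Pw k)" unfolding T_def by (intro Bochner_Integration.integral_cong) auto
      then show False using b by simp
    qed
    then obtain z where z: "z \<in> space (Pw k)" "t z \<noteq> 0" "box k q b z \<noteq> 0" by auto
    then have "z \<in> F_support M k E W" using t unfolding is_tiling_def by auto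
    then have "W (z i) (z j) \<noteq> 0" using fin e by (auto simp: F_support_def tensorF_def)
    moreover have "b = (\<lambda>i\<in>{..<k}. q (z i))" using z(3) box_eq[OF b(1), of q z] by auto
    moreover have "i < k" "j < k" using E e by (auto simp: graph_on_def)
    ultimately show ?thesis using W by simp
  qed
  have dpos: "d b \<ge> \<tau> ^ card E" if b: "b \<in> ?B" "T b \<noteq> 0" for b
  proof -
    have "(\<Prod>e\<in>E. \<tau>) \<le> d b" unfolding d_def using good[OF b] \<tau> by (intro prod_mono) auto
    then show ?thesis by simp
  qed
  \<comment> \<open>The marginal constraint of t, tested on functions of the cell.\<close>
  have margT: "(\<Sum>l<k. \<Sum>b\<in>?B. T b * \<phi> (b l)) \<le> (\<Sum>i<N. \<phi> i * cell_wt q i)"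
    if \<phi>: "\<And>i. \<phi> i \<ge> 0" for \<phi> :: "nat \<Rightarrow> real"
  proof -
    have qN: "q x < N" for x using q by (simp add: labelling_def)
    have "(\<Sum>l<k. \<Sum>b\<in>?B. T b * \<phi> (b l)) = (\<Sum>l<k. \<integral>z. t z * \<phi> (q (z l)) \<partial>Pw k)"
      unfolding Tsum by (intro sum.cong refl) simp
    also have "\<dots> = (\<Sum>l<k. \<integral>z. (\<Sum>i<N. \<phi> i * (t z * indicator (q -` {i}) (z l))) \<partial>Pw k)"
    proof (intro sum.cong refl Bochner_Integration.integral_cong)
      fix l z
      have "(\<Sum>i<N. \<phi> i * (t z * indicator (q -` {i}) (z l))) = (\<Sum>i<N. if i = q (z l) then \<phi> i * t z else 0)"
        by (intro sum.cong refl) (auto split: split_indicator)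
      also have "\<dots> = t z * \<phi> (q (z l))" using qN by simp
      finally show "t z * \<phi> (q (z l)) = (\<Sum>i<N. \<phi> i * (t z * indicator (q -` {i}) (z l)))" ..
    qed
    also have "\<dots> = (\<Sum>l<k. \<Sum>i<N. \<phi> i * (\<integral>z. t z * indicator (q -` {i}) (z l) \<partial>Pw k))"
    proof (intro sum.cong refl)
      fix l assume "l \<in> {..<k}"
      then have l: "l < k" by simp
      have "(\<integral>z. (\<Sum>i<N. \<phi> i * (t z * indicator (q -` {i}) (z l))) \<partial>Pw k)
          = (\<Sum>i<N. \<integral>z. \<phi> i * (t z * indicator (q -` {i}) (z l)) \<partial>Pw k)"
        by (intro Bochner_Integration.integral_sum Bochner_Integration.integrable_mult_right
          integrable_mult_bmeas ti bmeas_component bmeas_cell[OF q] l)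
      then show "(\<integral>z. (\<Sum>i<N. \<phi> i * (t z * indicator (q -` {i}) (z l))) \<partial>Pw k)
          = (\<Sum>i<N. \<phi> i * (\<integral>z. t z * indicator (q -` {i}) (z l) \<partial>Pw k))" by simp
    qed
    also have "\<dots> = (\<Sum>i<N. \<phi> i * (\<Sum>l<k. \<integral>z. t z * indicator (q -` {i}) (z l) \<partial>Pw k))"
      by (subst sum.swap) (simp add: sum_distrib_left)
    also have "\<dots> \<le> (\<Sum>i<N. \<phi> i * cell_wt q i)"
      unfolding cell_wt_def
      by (intro sum_mono mult_left_mono tiling_marginal_integral[OF t k] labelling_sets[OF q] \<phi>)
    finally show ?thesis .
  qed
  \<comment> \<open>A null cell has no room for weight, so the division by \<open>w b\<close> below
    is harmless.\<close>
  have wpos: "w b > 0" if b: "b \<in> ?B" "T b \<noteq> 0" for b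
  proof (rule ccontr)
    assume "\<not> w b > 0"
    then obtain l where l: "l < k" "cell_wt q (b l) = 0" using w0[of b] by (auto simp: w_def less_le)
    let ?\<phi> = "\<lambda>i. of_bool (i = b l) :: real"
    have bl: "b l < N" using b(1) l(1) by auto
    have "T b * ?\<phi> (b l) \<le> (\<Sum>b'\<in>?B. T b' * ?\<phi> (b' l))"
      using T0 b finB by (intro member_le_sum) auto
    also have "\<dots> \<le> (\<Sum>l<k. \<Sum>b'\<in>?B. T b' * ?\<phi> (b' l))"
      using T0 l by (intro member_le_sum[of l "{..<k}" "\<lambda>l. \<Sum>b'\<in>?B. T b' * ?\<phi> (b' l)"] sum_nonneg) auto
    also have "\<dots> \<le> (\<Sum>i<N. ?\<phi> i * cell_wt q i)" by (rule margT) simp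
    also have "\<dots> = (\<Sum>i<N. if i = b l then cell_wt q i else 0)" by (intro sum.cong) auto
    also have "\<dots> = 0" using l bl by simp
    finally show False using T0[of b] b by simp
  qed
  \<comment> \<open>The height at which G b times the tensor of V would have mass T b on the box if
    the tensor were equal to its expected density \<open>d b\<close>. It is 0 when T b is 0.\<close>
  define G where "G b = T b / (w b * d b)" for b
  have d0: "0 \<le> d b" for b unfolding d_def using avg_bounds[OF q V] by (intro prod_nonneg) auto
  have G0: "0 \<le> G b" for b using T0 w0 d0 by (simp add: G_def)
  have Gwd: "G b * (d b * w b) = T b" if b: "b \<in> ?B" for b
  proof (cases "T b = 0")
    case False
    have "0 < \<tau> ^ card E" using \<tau> by simp
    then have "d b > 0" using dpos[OF b False] by linarith
    then show ?thesis using wpos[OF b False] by (simp add: G_def)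
  qed (simp add: G_def)
  have G\<kappa>: "G b * (real (card E) * \<delta> * w b) \<le> T b * \<kappa>" if b: "b \<in> ?B" for b
  proof (cases "T b = 0")
    case False
    have \<tau>': "0 < \<tau> ^ card E" using \<tau> by simp
    have "G b * (real (card E) * \<delta> * w b) = T b * (real (card E) * \<delta> / d b)"
      using wpos[OF b False] by (simp add: G_def)
    also have "\<dots> \<le> T b * \<kappa>"
      unfolding \<kappa>_def using \<delta> \<tau>' dpos[OF b False] T0 by (intro mult_left_mono divide_left_mono) auto
    finally show ?thesis .
  qed (simp add: G_def)
  note Eb = tensorF_bmeas[OF V E]
  have count: "\<bar>G b * (\<integral>z. (\<Prod>m<k. f m (z m)) * tensorF E V z \<partial>Pw k) - G b * (d b * (\<Prod>m<k. \<integral>x. f m x \<partial>M))\<bar> \<le> T b * \<kappa>"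
    if b: "b \<in> ?B" and f: "\<And>m. m < k \<Longrightarrow> f m \<in> bmeas M" "\<And>m x. 0 \<le> f m x" "\<And>m x. f m x \<le> indicator (q -` {b m}) x" for b f
  proof (cases "T b = 0")
    case False
    have "\<bar>G b * (\<integral>z. (\<Prod>m<k. f m (z m)) * tensorF E V z \<partial>Pw k) - G b * (d b * (\<Prod>m<k. \<integral>x. f m x \<partial>M))\<bar>
       = G b * \<bar>(\<integral>z. (\<Prod>m<k. f m (z m)) * tensorF E V z \<partial>Pw k) - d b * (\<Prod>m<k. \<integral>x. f m x \<partial>M)\<bar>"
      using G0[of b] by (simp add: abs_mult right_diff_distrib[symmetric])
    also have "\<dots> \<le> G b * (real (card E) * \<delta> * w b)"
      unfolding d_def w_def using good[OF b False] by (intro mult_left_mono G0 counting[OF q V E _ \<delta> f]) auto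
    also have "\<dots> \<le> T b * \<kappa>" by (rule G\<kappa>[OF b])
    finally show ?thesis .
  qed (simp add: G_def)
  define t1 where "t1 z = (\<Sum>b\<in>?B. G b * box k q b z) * tensorF E V z" for z
  have t1b: "t1 \<in> bmeas (Pw k)"
    unfolding t1_def by (intro bmeas_mult bmeas_sum bmeas_const box_bmeas[OF q] Eb)
  have t10: "0 \<le> t1 z" for z
    unfolding t1_def using G0 box_nonneg tensorF_bounds[OF V] by (intro mult_nonneg_nonneg sum_nonneg) auto
  have t1int: "(\<integral>z. t1 z * g z \<partial>Pw k) = (\<Sum>b\<in>?B. G b * (\<integral>z. box k q b z * g z * tensorF E V z \<partial>Pw k))"
    if g: "g \<in> bmeas (Pw k)" for g
  proof -
    have "(\<integral>z. t1 z * g z \<partial>Pw k) = (\<integral>z. (\<Sum>b\<in>?B. G b * (box k q b z * g z * tensorF E V z)) \<partial>Pw k)"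
      unfolding t1_def by (simp add: sum_distrib_left sum_distrib_right mult_ac)
    also have "\<dots> = (\<Sum>b\<in>?B. \<integral>z. G b * (box k q b z * g z * tensorF E V z) \<partial>Pw k)"
      by (intro Bochner_Integration.integral_sum bmeas_integrable_Pw bmeas_mult bmeas_const box_bmeas[OF q] g Eb)
    finally show ?thesis by simp
  qed
  \<comment> \<open>The error on a box is at most \<kappa> times its weight T b. The weights add up
    to at most 1, so the total error is at most \<kappa> for any number of boxes.\<close>
  have size_t1: "tiling_size M k t - \<kappa> \<le> (\<integral>z. t1 z \<partial>Pw k)"
  proof -
    have "tiling_size M k t - \<kappa> \<le> (\<Sum>b\<in>?B. T b) - (\<Sum>b\<in>?B. T b) * \<kappa>"
      using size size1 mult_right_mono[OF size1 \<kappa>0] by simp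
    also have "\<dots> = (\<Sum>b\<in>?B. T b - T b * \<kappa>)" by (simp add: sum_subtractf sum_distrib_right)
    also have "\<dots> \<le> (\<Sum>b\<in>?B. G b * (\<integral>z. box k q b z * 1 * tensorF E V z \<partial>Pw k))"
    proof (rule sum_mono)
      fix b assume b: "b \<in> ?B"
      let ?f = "\<lambda>m. indicator (q -` {b m}) :: 'a \<Rightarrow> real"
      have "\<bar>G b * (\<integral>z. (\<Prod>m<k. ?f m (z m)) * tensorF E V z \<partial>Pw k) - G b * (d b * (\<Prod>m<k. \<integral>x. ?f m x \<partial>M))\<bar> \<le> T b * \<kappa>"
        by (intro count[OF b] bmeas_cell[OF q]) auto
      moreover have "(\<Prod>m<k. \<integral>x. ?f m x \<partial>M) = w b" by (simp add: w_def cell_wt_def)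
      ultimately show "T b - T b * \<kappa> \<le> G b * (\<integral>z. box k q b z * 1 * tensorF E V z \<partial>Pw k)"
        using Gwd[OF b] by (simp add: box_def)
    qed
    also have "\<dots> = (\<integral>z. t1 z \<partial>Pw k)" using t1int[of "\<lambda>_. 1"] by simp
    finally show ?thesis .
  qed
  define marg where "marg l x = (\<integral>y. t1 (y(l := x)) \<partial>Pw k)" for l x
  have margb: "marg l \<in> bmeas M" if "l < k" for l
    unfolding marg_def[abs_def] by (rule bmeas_update_integral(2)[OF that t1b])
  have marg0: "0 \<le> marg l x" for l x unfolding marg_def using t10 by simp
  \<comment> \<open>The load that t1 puts on the vertex x, which a tiling must keep at most
    1.\<close>
  define h where "h x = (\<Sum>l<k. marg l x)" for x
  have hb: "h \<in> bmeas M" unfolding h_def[abs_def] by (intro bmeas_sum margb) auto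
  have h0: "0 \<le> h x" for x unfolding h_def by (intro sum_nonneg marg0)
  have hint: "(\<integral>x. h x * g x \<partial>M) = (\<Sum>l<k. \<integral>z. t1 z * g (z l) \<partial>Pw k)" if g: "g \<in> bmeas M" for g
  proof -
    have "(\<integral>x. h x * g x \<partial>M) = (\<Sum>l<k. \<integral>x. marg l x * g x \<partial>M)"
      unfolding h_def sum_distrib_right
      by (intro Bochner_Integration.integral_sum bmeas_integrable bmeas_mult margb g) auto
    also have "\<dots> = (\<Sum>l<k. \<integral>z. t1 z * g (z l) \<partial>Pw k)"
    proof (rule sum.cong[OF refl])
      fix l assume "l \<in> {..<k}"
      then have l: "l < k" by simp
      have "(\<lambda>z. t1 z * g (z l)) \<in> bmeas (Pw k)" by (intro bmeas_mult t1b bmeas_component g l)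
      from integral_update(1)[OF l this] show "(\<integral>x. marg l x * g x \<partial>M) = (\<integral>z. t1 z * g (z l) \<partial>Pw k)"
        by (simp add: marg_def)
    qed
    finally show ?thesis .
  qed
  define A where "A = {x \<in> space M. h x > 1}"
  have A: "A \<in> sets M" unfolding A_def using bmeas_measurable[OF hb] by measurable
  have over: "(\<integral>x. h x * indicator A x \<partial>M) \<le> measure M A + real k * \<kappa>"
  proof -
    \<comment> \<open>The share of A in a cell, 0 for a null cell. Restricting coordinate l to A
      multiplies the mass on a box by this share, up to the counting error, so the load on A is
      compared with that of t spread evenly over each cell.\<close>
    define \<phi> where "\<phi> i = measure M (A \<inter> q -` {i}) / cell_wt q i" for i
    have \<phi>0: "\<phi> i \<ge> 0" for i by (simp add: \<phi>_def)
    have Aq: "A \<inter> q -` {i} \<in> sets M" for i using A labelling_sets[OF q] by auto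
    have one: "(\<integral>z. t1 z * indicator A (z l) \<partial>Pw k) \<le> (\<Sum>b\<in>?B. T b * \<phi> (b l)) + \<kappa>" if l: "l < k" for l
    proof -
      have "(\<integral>z. t1 z * indicator A (z l) \<partial>Pw k) = (\<Sum>b\<in>?B. G b * (\<integral>z. box k q b z * indicator A (z l) * tensorF E V z \<partial>Pw k))"
        by (intro t1int bmeas_component bmeas_indicator A l)
      also have "\<dots> \<le> (\<Sum>b\<in>?B. T b * \<phi> (b l) + T b * \<kappa>)"
      proof (rule sum_mono)
        fix b assume b: "b \<in> ?B"
        let ?f = "\<lambda>m. if m = l then indicator (A \<inter> q -` {b m}) else indicator (q -` {b m}) :: 'a \<Rightarrow> real"
        have "\<bar>G b * (\<integral>z. (\<Prod>m<k. ?f m (z m)) * tensorF E V z \<partial>Pw k) - G b * (d b * (\<Prod>m<k. \<integral>x. ?f m x \<partial>M))\<bar> \<le> T b * \<kappa>"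
          by (intro count[OF b]) (auto intro: bmeas_cell[OF q] bmeas_indicator Aq split: split_indicator)
        moreover have "(\<Prod>m<k. ?f m (z m)) = box k q b z * indicator A (z l)" for z
          unfolding box_def prod_lessThan_remove[OF l]
          by (auto intro!: prod.cong split: split_indicator)
        moreover have "G b * (d b * (\<Prod>m<k. \<integral>x. ?f m x \<partial>M)) = T b * \<phi> (b l)"
        proof (cases "T b = 0")
          case False
          let ?R = "\<Prod>m\<in>{..<k}-{l}. cell_wt q (b m)"
          have "(\<Prod>m<k. \<integral>x. ?f m x \<partial>M) = measure M (A \<inter> q -` {b l}) * ?R"
            unfolding prod_lessThan_remove[OF l] by (simp add: cell_wt_def)
          moreover have wR: "w b = cell_wt q (b l) * ?R" unfolding w_def by (rule prod_lessThan_remove[OF l])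
          moreover have "cell_wt q (b l) \<noteq> 0" using wpos[OF b False] wR by auto
          ultimately have "(\<Prod>m<k. \<integral>x. ?f m x \<partial>M) = \<phi> (b l) * w b" by (simp add: \<phi>_def)
          then show ?thesis using Gwd[OF b] by (simp add: mult_ac)
        qed (simp add: G_def)
        ultimately show "G b * (\<integral>z. box k q b z * indicator A (z l) * tensorF E V z \<partial>Pw k) \<le> T b * \<phi> (b l) + T b * \<kappa>"
          by simp
      qed
      also have "\<dots> = (\<Sum>b\<in>?B. T b * \<phi> (b l)) + (\<Sum>b\<in>?B. T b) * \<kappa>"
        by (simp add: sum.distrib sum_distrib_right)
      finally show ?thesis using mult_right_mono[OF size1 \<kappa>0] by simp
    qed
    have "(\<integral>x. h x * indicator A x \<partial>M) = (\<Sum>l<k. \<integral>z. t1 z * indicator A (z l) \<partial>Pw k)"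
      by (intro hint bmeas_indicator A)
    also have "\<dots> \<le> (\<Sum>l<k. (\<Sum>b\<in>?B. T b * \<phi> (b l)) + \<kappa>)"
      by (intro sum_mono one) simp
    also have "\<dots> \<le> (\<Sum>i<N. \<phi> i * cell_wt q i) + real k * \<kappa>"
      using margT[of \<phi>, OF \<phi>0] by (simp add: sum.distrib)
    also have "(\<Sum>i<N. \<phi> i * cell_wt q i) \<le> (\<Sum>i<N. measure M (A \<inter> q -` {i}))"
      by (intro sum_mono) (simp add: \<phi>_def)
    also have "\<dots> = measure M (\<Union>i<N. A \<inter> q -` {i})"
      using Aq by (intro finite_measure_finite_Union[symmetric]) (auto simp: disjoint_family_on_def)
    also have "\<dots> \<le> measure M A" using A by (intro finite_measure_mono) auto
    finally show ?thesis by simp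
  qed
  \<comment> \<open>The factor 1 - c x brings the load down to 1 where it exceeds 1, and h * c is
    the positive part of h - 1.\<close>
  define c where "c x = 1 - 1 / max 1 (h x)" for x
  have c01: "0 \<le> c x" "c x \<le> 1" for x by (auto simp: c_def divide_le_eq_1)
  have cb: "c \<in> bmeas M"
    using bmeas_measurable[OF hb] c01 by (intro bmeasI[of _ _ 1]) (auto simp: c_def[abs_def])
  define t2 where "t2 z = t1 z * (\<Prod>i<k. 1 - c (z i))" for z
  have t2b: "t2 \<in> bmeas (Pw k)"
    unfolding t2_def[abs_def] by (intro bmeas_mult t1b bmeas_prod bmeas_diff bmeas_const bmeas_component cb) auto
  have t20: "0 \<le> t2 z" for z unfolding t2_def using c01 by (intro mult_nonneg_nonneg t10 prod_nonneg) auto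
  have hc: "h x * c x = h x * indicator A x - indicator A x" for x
    by (auto simp: c_def A_def max_def field_simps split: split_indicator)
  have tile: "is_tiling M k E V t2"
    unfolding is_tiling_def
  proof (intro conjI ballI)
    show "t2 \<in> borel_measurable (Pw k)" by (rule bmeas_measurable[OF t2b])
    show "{z \<in> space (Pw k). t2 z \<noteq> 0} \<subseteq> F_support M k E V"
      by (auto simp: F_support_def t2_def t1_def)
    fix x assume "x \<in> space M"
    have "(\<integral>\<^sup>+ y. ennreal (t2 (y(l := x))) \<partial>Pw k) \<le> ennreal (marg l x * (1 - c x))" if l: "l < k" for l
    proof -
      have "(\<lambda>y. t1 (y(l := x))) \<in> bmeas (Pw k)" by (rule bmeas_compose[OF t1b measurable_update_tuple[OF l]])
      then have ub: "(\<lambda>y. t1 (y(l := x)) * (1 - c x)) \<in> bmeas (Pw k)" by (intro bmeas_mult bmeas_const)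
      have "(\<integral>\<^sup>+ y. ennreal (t2 (y(l := x))) \<partial>Pw k) \<le> (\<integral>\<^sup>+ y. ennreal (t1 (y(l := x)) * (1 - c x)) \<partial>Pw k)"
      proof (intro nn_integral_mono ennreal_leI)
        fix y
        \<comment> \<open>The factor of coordinate l alone restores the constraint; the others are
          at most 1.\<close>
        have "(\<Prod>i<k. 1 - c ((y(l := x)) i)) = (1 - c x) * (\<Prod>i\<in>{..<k}-{l}. 1 - c ((y(l := x)) i))"
          by (subst prod_lessThan_remove[OF l]) simp
        also have "\<dots> \<le> (1 - c x) * 1" using c01 by (intro mult_left_mono prod_le_1) auto
        finally show "t2 (y(l := x)) \<le> t1 (y(l := x)) * (1 - c x)"
          unfolding t2_def using t10 by (intro mult_left_mono) auto
      qed
      also have "\<dots> = ennreal (\<integral>y. t1 (y(l := x)) * (1 - c x) \<partial>Pw k)"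
        using t10 c01 by (intro nn_integral_eq_integral bmeas_integrable_Pw ub AE_I2) auto
      finally show ?thesis by (simp add: marg_def)
    qed
    then have "(\<Sum>l<k. \<integral>\<^sup>+ y. ennreal (t2 (y(l := x))) \<partial>Pw k) \<le> (\<Sum>l<k. ennreal (marg l x * (1 - c x)))"
      by (intro sum_mono) auto
    also have "\<dots> = ennreal (h x * (1 - c x))"
      using marg0 c01 by (subst sum_ennreal) (auto simp: h_def sum_distrib_right)
    also have "h x * (1 - c x) \<le> 1" using h0[of x] by (auto simp: c_def max_def)
    then have "ennreal (h x * (1 - c x)) \<le> 1" by (metis ennreal_1 ennreal_leI)
    finally show "(\<Sum>l<k. \<integral>\<^sup>+ y. ennreal (t2 (y(l := x))) \<partial>Pw k) \<le> 1" .
  qed (use t20 in auto)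
  have "(\<integral>z. t1 z \<partial>Pw k) - (\<Sum>l<k. \<integral>z. t1 z * c (z l) \<partial>Pw k) = (\<integral>z. t1 z - (\<Sum>l<k. t1 z * c (z l)) \<partial>Pw k)"
  proof -
    have "(\<integral>z. (\<Sum>l<k. t1 z * c (z l)) \<partial>Pw k) = (\<Sum>l<k. \<integral>z. t1 z * c (z l) \<partial>Pw k)"
      by (intro Bochner_Integration.integral_sum bmeas_integrable_Pw bmeas_mult t1b bmeas_component cb) auto
    moreover have "(\<integral>z. t1 z - (\<Sum>l<k. t1 z * c (z l)) \<partial>Pw k) = (\<integral>z. t1 z \<partial>Pw k) - (\<integral>z. (\<Sum>l<k. t1 z * c (z l)) \<partial>Pw k)"
      by (intro Bochner_Integration.integral_diff bmeas_integrable_Pw bmeas_sum bmeas_mult t1b bmeas_component cb) auto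
    ultimately show ?thesis by simp
  qed
  also have "\<dots> \<le> (\<integral>z. t2 z \<partial>Pw k)"
  proof (intro integral_mono bmeas_integrable_Pw t2b bmeas_diff t1b bmeas_sum bmeas_mult bmeas_component cb)
    fix z
    \<comment> \<open>A union bound for products: the scaling loses at most the sum of the losses of
      single coordinates, and these integrate to the integral of h * c.\<close>
    have "1 - (\<Sum>l<k. c (z l)) \<le> (\<Prod>l<k. 1 - c (z l))" using c01 by (intro Weierstrass_prod_ineq) auto
    then have "t1 z * (1 - (\<Sum>l<k. c (z l))) \<le> t2 z" unfolding t2_def by (intro mult_left_mono t10)
    then show "t1 z - (\<Sum>l<k. t1 z * c (z l)) \<le> t2 z" by (simp add: right_diff_distrib sum_distrib_left)
  qed auto
  also have "\<dots> = tiling_size M k t2" using tiling_size_integral[OF tile] by simp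
  also have "\<dots> \<le> til M k E V" by (rule tiling_le_til[OF tile k])
  finally have "(\<integral>z. t1 z \<partial>Pw k) - (\<Sum>l<k. \<integral>z. t1 z * c (z l) \<partial>Pw k) \<le> til M k E V" .
  moreover have "(\<Sum>l<k. \<integral>z. t1 z * c (z l) \<partial>Pw k) \<le> real k * \<kappa>"
  proof -
    have "(\<Sum>l<k. \<integral>z. t1 z * c (z l) \<partial>Pw k) = (\<integral>x. h x * indicator A x - indicator A x \<partial>M)"
      by (simp add: hint[OF cb, symmetric] hc)
    also have "\<dots> = (\<integral>x. h x * indicator A x \<partial>M) - (\<integral>x. indicator A x \<partial>M)"
      by (intro Bochner_Integration.integral_diff bmeas_integrable bmeas_mult hb bmeas_indicator A)
    finally show ?thesis using over by simp
  qed
  \<comment> \<open>The redistribution loses \<kappa>, the scaling k * \<kappa>.\<close>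
  ultimately have "tiling_size M k t \<le> til M k E V + (real k * \<kappa> + \<kappa>)" using size_t1 by linarith
  then show "tiling_size M k t \<le> til M k E V + real (k + 1) * (real (card E) * \<delta> / \<tau> ^ card E)"
    unfolding \<kappa>_def[symmetric] by (simp add: algebra_simps)
qed

section \<open>Continuity\<close>

lemma avg_symmetric:
  assumes "labelling N q" "graphon M V" shows "avg V q i j = avg V q j i"
  unfolding avg_def
  using rect_swap[OF graphon_bmeas[OF assms(2)] graphonD(1)[OF assms(2)] labelling_sets[OF assms(1)] labelling_sets[OF assms(1)]]
  by (simp add: mult.commute)

lemma cut_norm_nonneg: "(\<lambda>p. H (fst p) (snd p)) \<in> bmeas MM \<Longrightarrow> 0 \<le> cut_norm M H"
  using rectangle_le_cut_norm[of H "{}" "{}"] by simp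

lemma irregular_mass_integral:
  assumes q: "labelling N q"
  shows "(\<integral>p. of_bool (\<not> regular_pair V q \<delta> (q (fst p)) (q (snd p))) \<partial>MM) = irregular_mass V q \<delta> N"
    and "(\<integral>p. of_bool (\<not> regular_pair V q \<delta> (q (snd p)) (q (fst p))) \<partial>MM) = irregular_mass V q \<delta> N"
proof -
  note qs = labelling_sets[OF q]
  let ?r = "\<lambda>i j. of_bool (\<not> regular_pair V q \<delta> i j) :: real"
  have *: "(\<integral>p. s (q (fst p)) (q (snd p)) \<partial>MM) = (\<Sum>i<N. \<Sum>j<N. s i j * (cell_wt q i * cell_wt q j))" for s
    using step_integral_sum[OF q bmeas_const[of 1], of s] rect_const[OF qs qs, of _ _ 1] by (simp add: cell_wt_def)
  show "(\<integral>p. ?r (q (fst p)) (q (snd p)) \<partial>MM) = irregular_mass V q \<delta> N"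
    unfolding *[of ?r] irregular_mass_def by (intro sum.cong) auto
  show "(\<integral>p. ?r (q (snd p)) (q (fst p)) \<partial>MM) = irregular_mass V q \<delta> N"
    unfolding *[of "\<lambda>i j. ?r j i"] irregular_mass_def
    by (subst sum.swap) (intro sum.cong, auto)
qed

text \<open>Budget for the excess of U: c / 8 for sparse pairs, 2 * \<delta> \<le> c / 8 for
  irregular ones, twice c / 16 for the step approximation of W, c / 8 for the cut-norm; in total at
  most c / 2. All these constants are fixed before W' and U'.\<close>

lemma til_eps_lower:
  assumes cover: "\<And>\<eta>::real. \<eta> > 0 \<Longrightarrow>
      \<exists>N D. (\<forall>i<N. D i \<in> sets M \<and> measure M (D i) \<le> \<eta>) \<and> (\<Union>i<N::nat. D i) = UNIV"
    and k: "k \<ge> 1" and E: "graph_on k E" and eps: "eps > 0" and eta: "(eta::real) > 0"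
    and W: "graphon M W"
  shows "\<exists>\<gamma>>0. \<forall>W'. graphon M W' \<longrightarrow> cut_norm M (\<lambda>x y. W' x y - W x y) \<le> \<gamma> \<longrightarrow>
      til_eps M eps k E W \<le> til_eps M eps k E W' + 2 * eta"
proof -
  obtain c where c: "c > 0" and ex: "\<And>W U :: 'a \<Rightarrow> 'a \<Rightarrow> real. graphon M W \<Longrightarrow> graphon M U \<Longrightarrow> (\<And>x y. U x y \<le> W x y) \<Longrightarrow>
      dint U \<le> eps + c \<Longrightarrow> til_eps M eps k E W \<le> til M k E (\<lambda>x y. W x y - U x y) + eta"
    using til_eps_excess[OF cover k E eps eta] by blast
  note Wb = graphon_bmeas[OF W]
  define \<tau> where "\<tau> = c / 8"
  have \<tau>: "\<tau> > 0" using c by (simp add: \<tau>_def)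
  \<comment> \<open>The first entry controls the irregular pairs, the second brings the loss of
    redistribution below eta; adding 1 to \<open>card E\<close> avoids a division by 0 for an
    edgeless F.\<close>
  define \<delta> where "\<delta> = min (c / 16) (eta * \<tau> ^ card E / (real (k + 1) * (real (card E) + 1)))"
  have \<delta>: "\<delta> > 0" using c eta \<tau> by (simp add: \<delta>_def add_pos_pos)
  have \<delta>c: "2 * \<delta> \<le> c / 8" by (simp add: \<delta>_def)
  have \<delta>\<eta>: "real (k + 1) * (real (card E) * \<delta> / \<tau> ^ card E) \<le> eta"
  proof -
    have "real (k + 1) * (real (card E) * \<delta> / \<tau> ^ card E)
        \<le> real (k + 1) * (real (card E) * (eta * \<tau> ^ card E / (real (k + 1) * (real (card E) + 1))) / \<tau> ^ card E)"
      using \<tau> by (intro mult_left_mono divide_right_mono) (auto simp: \<delta>_def)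
    also have "\<dots> = eta * (real (card E) / (real (card E) + 1))"
    proof -
      have "a * (e * (eta * t / (a * (e + 1))) / t) = eta * (e / (e + 1))" if "a > 0" "t > 0" "e \<ge> 0" for a t e :: real
      proof -
        have "a * (e + 1) \<noteq> 0" using that by simp
        then show ?thesis using that by (simp add: divide_simps)
      qed
      then show ?thesis using \<tau> by simp
    qed
    also have "\<dots> \<le> eta * 1" using eta by (intro mult_left_mono) auto
    finally show ?thesis by simp
  qed
  have "approximable (\<lambda>p. W (fst p) (snd p))" by (intro approximable_integrable integrable_MM Wb)
  moreover have "c / 16 > 0" using c by simp
  ultimately obtain N0 q0 s0 where q0: "labelling N0 q0"
    and s0: "(\<integral>p. \<bar>W (fst p) (snd p) - s0 (q0 (fst p)) (q0 (snd p))\<bar> \<partial>MM) < c / 16"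
    by (rule approximableE)
  obtain K where K: "\<And>V q. graphon M V \<Longrightarrow> labelling N0 q \<Longrightarrow>
      \<exists>n r. n \<le> K \<and> labelling n r \<and> refines r q \<and> irregular_mass V r \<delta> n \<le> \<delta>"
    using regularity[OF \<delta>, of N0] by blast
  \<comment> \<open>One \<gamma> pays for comparing the integrals of W and W', and
    \<open>K^2\<close> of them pay for the step function \<phi>.\<close>
  define \<gamma> where "\<gamma> = c / 8 / (1 + (real K)\<^sup>2)"
  have K2: "1 + (real K)\<^sup>2 > 0" by (simp add: add_pos_nonneg)
  have \<gamma>: "\<gamma> > 0" using c K2 by (simp add: \<gamma>_def)
  have \<gamma>K: "\<gamma> * (1 + (real K)\<^sup>2) = c / 8" using K2 \<gamma>_def by (metis less_irrefl nonzero_eq_divide_eq)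
  have main: "til_eps M eps k E W \<le> til M k E (\<lambda>x y. W' x y - U' x y) + 2 * eta"
    if W': "graphon M W'" and cut: "cut_norm M (\<lambda>x y. W' x y - W x y) \<le> \<gamma>"
      and U': "graphon M U'" and UW': "\<And>x y. U' x y \<le> W' x y" and le: "dint U' \<le> eps" for W' U'
  proof -
    note W'b = graphon_bmeas[OF W'] and U'b = graphon_bmeas[OF U']
    define V' where "V' x y = W' x y - U' x y" for x y
    have V'b: "(\<lambda>p. V' (fst p) (snd p)) \<in> bmeas MM" unfolding V'_def by (intro bmeas_diff W'b U'b)
    have V'1: "0 \<le> V' x y" "V' x y \<le> W' x y" for x y
      using UW'[of x y] graphonD(2)[OF U', of x y] by (auto simp: V'_def)
    have V': "graphon M V'"
      unfolding graphon_def
    proof (intro conjI ballI)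
      show "V' x y = V' y x" for x y
        using graphonD(1)[OF W', of x y] graphonD(1)[OF U', of x y] by (simp add: V'_def)
      show "V' x y \<le> 1" for x y using V'1(2)[of x y] graphonD(3)[OF W', of x y] by linarith
    qed (use V'1 bmeas_measurable[OF V'b] in auto)
    obtain n q where n: "n \<le> K" and q: "labelling n q" and qq: "refines q q0" and irr: "irregular_mass V' q \<delta> n \<le> \<delta>"
      using K[OF V' q0] by blast
    obtain f where f: "\<And>x. q0 x = f (q x)" using qq unfolding refines_def by blast
    define s where "s i j = s0 (f i) (f j)" for i j
    \<comment> \<open>Asking for regularity in both orders makes D visibly symmetric, at the cost of
      counting the irregular mass twice.\<close>
    define good where "good i j \<longleftrightarrow> regular_pair V' q \<delta> i j \<and> regular_pair V' q \<delta> j i \<and> avg V' q i j \<ge> \<tau>" for i j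
    define D where "D i j = (if good i j then avg V' q i j else 0)" for i j
    define V where "V x y = min (D (q x) (q y)) (W x y)" for x y
    define U where "U x y = W x y - V x y" for x y
    have D0: "0 \<le> D i j" for i j using avg_bounds[OF q V'] by (simp add: D_def)
    have Dsym: "D i j = D j i" for i j
      using avg_symmetric[OF q V', of i j] by (auto simp: D_def good_def)
    have V01: "0 \<le> V x y" "V x y \<le> W x y" for x y
      using D0 graphonD(2)[OF W, of x y] by (auto simp: V_def)
    have Db: "(\<lambda>p. D (q (fst p)) (q (snd p))) \<in> bmeas MM" by (rule step_bmeas[OF q])
    have Vb: "(\<lambda>p. V (fst p) (snd p)) \<in> bmeas MM"
    proof (rule bmeasI[of _ _ 1])
      show "(\<lambda>p. V (fst p) (snd p)) \<in> borel_measurable MM"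
        unfolding V_def using bmeas_measurable[OF Wb] bmeas_measurable[OF Db] by measurable
      show "\<bar>V (fst p) (snd p)\<bar> \<le> 1" for p :: "'a \<times> 'a"
        using V01[of "fst p" "snd p"] graphonD(3)[OF W, of "fst p" "snd p"] by auto
    qed
    have Ub: "(\<lambda>p. U (fst p) (snd p)) \<in> bmeas MM" unfolding U_def by (intro bmeas_diff Wb Vb)
    have U: "graphon M U"
      unfolding graphon_def
    proof (intro conjI ballI)
      show "U x y = U y x" for x y
        using graphonD(1)[OF W, of x y] Dsym[of "q x" "q y"] by (simp add: U_def V_def)
      show "0 \<le> U x y" for x y using V01 by (simp add: U_def)
      show "U x y \<le> 1" for x y using V01(1)[of x y] graphonD(3)[OF W, of x y] by (simp add: U_def)
    qed (use bmeas_measurable[OF Ub] in auto)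
    \<comment> \<open>Marks the pairs of cells on which D overshoots the step approximation of W.
      Its coefficients are 0 or 1, so their sum is at most \<open>K^2\<close>.\<close>
    define \<phi> where "\<phi> i j = (of_bool (D i j > s i j) :: real)" for i j
    let ?irr1 = "\<lambda>p. of_bool (\<not> regular_pair V' q \<delta> (q (fst p)) (q (snd p))) :: real"
    let ?irr2 = "\<lambda>p. of_bool (\<not> regular_pair V' q \<delta> (q (snd p)) (q (fst p))) :: real"
    let ?W = "\<lambda>p. W (fst p) (snd p)" and ?W' = "\<lambda>p. W' (fst p) (snd p)"
      and ?V' = "\<lambda>p. V' (fst p) (snd p)" and ?V = "\<lambda>p. V (fst p) (snd p)" and ?U' = "\<lambda>p. U' (fst p) (snd p)"
    let ?s = "\<lambda>p. s (q (fst p)) (q (snd p))" and ?\<phi> = "\<lambda>p. \<phi> (q (fst p)) (q (snd p))"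
      and ?a = "\<lambda>p. avg V' q (q (fst p)) (q (snd p))"
    have b: "?irr1 \<in> bmeas MM" "?irr2 \<in> bmeas MM" "?s \<in> bmeas MM" "?\<phi> \<in> bmeas MM" "?a \<in> bmeas MM"
      using step_bmeas[OF q, of "\<lambda>i j. of_bool (\<not> regular_pair V' q \<delta> i j)"]
        step_bmeas[OF q, of "\<lambda>i j. of_bool (\<not> regular_pair V' q \<delta> j i)"]
        step_bmeas[OF q, of s] step_bmeas[OF q, of \<phi>] step_bmeas[OF q, of "avg V' q"] by auto
    note bm = b Wb W'b V'b Vb U'b
    have [simp]: "integrable MM ?irr1" "integrable MM ?irr2" "integrable MM ?a" "integrable MM ?W"
      "integrable MM ?W'" "integrable MM ?V'" "integrable MM ?V" "integrable MM ?U'"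
      "integrable MM (\<lambda>p. \<bar>?W p - ?s p\<bar>)" "integrable MM (\<lambda>p. ?\<phi> p * ?a p)" "integrable MM (\<lambda>p. ?\<phi> p * ?s p)"
      "integrable MM (\<lambda>p. ?\<phi> p * ?V' p)" "integrable MM (\<lambda>p. ?\<phi> p * (?W' p - ?W p))"
      by (intro integrable_MM bmeas_abs bmeas_diff bmeas_mult bm)+
    have \<beta>: "(\<integral>p. \<bar>?W p - ?s p\<bar> \<partial>MM) \<le> c / 16" using s0 by (simp add: s_def f[symmetric])
    \<comment> \<open>D falls short of the average by at most \<tau> on sparse pairs and by at most
      1 on irregular ones; V falls short of D by at most the overshoot
      \<open>\<phi> * (D - s)\<close> plus the distance of W from s.\<close>
    have pt: "?a p - (\<tau> + ?irr1 p + ?irr2 p) - \<bar>?W p - ?s p\<bar> - (?\<phi> p * ?a p - ?\<phi> p * ?s p) \<le> ?V p" for p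
    proof -
      obtain x y where p: "p = (x, y)" by (cases p)
      let ?i = "q x" and ?j = "q y"
      have a0: "0 \<le> avg V' q ?i ?j" "avg V' q ?i ?j \<le> 1" using avg_bounds[OF q V'] by auto
      have 1: "avg V' q ?i ?j - (\<tau> + ?irr1 p + ?irr2 p) \<le> D ?i ?j"
        using a0 \<tau> by (auto simp: D_def good_def p)
      have 2: "D ?i ?j \<le> avg V' q ?i ?j" using a0 by (simp add: D_def)
      have 3: "D ?i ?j - \<bar>W x y - s ?i ?j\<bar> - \<phi> ?i ?j * (D ?i ?j - s ?i ?j) \<le> V x y"
        by (auto simp: V_def \<phi>_def)
      have "\<phi> ?i ?j * (D ?i ?j - s ?i ?j) \<le> \<phi> ?i ?j * (avg V' q ?i ?j - s ?i ?j)"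
        using 2 by (intro mult_left_mono) (auto simp: \<phi>_def)
      then show ?thesis using 1 3 by (simp add: p right_diff_distrib)
    qed
    have "(\<integral>p. ?a p - (\<tau> + ?irr1 p + ?irr2 p) - \<bar>?W p - ?s p\<bar> - (?\<phi> p * ?a p - ?\<phi> p * ?s p) \<partial>MM) \<le> dint V"
      by (intro integral_mono pt) simp_all
    also have "(\<integral>p. ?a p - (\<tau> + ?irr1 p + ?irr2 p) - \<bar>?W p - ?s p\<bar> - (?\<phi> p * ?a p - ?\<phi> p * ?s p) \<partial>MM)
      = (\<integral>p. ?a p \<partial>MM) - (\<tau> + (\<integral>p. ?irr1 p \<partial>MM) + (\<integral>p. ?irr2 p \<partial>MM)) - (\<integral>p. \<bar>?W p - ?s p\<bar> \<partial>MM)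
        - ((\<integral>p. ?\<phi> p * ?a p \<partial>MM) - (\<integral>p. ?\<phi> p * ?s p \<partial>MM))"
      using pair.P.prob_space by simp
    finally have dV: "(\<integral>p. ?a p \<partial>MM) - (\<tau> + 2 * \<delta>) - c / 16 - ((\<integral>p. ?\<phi> p * ?a p \<partial>MM) - (\<integral>p. ?\<phi> p * ?s p \<partial>MM)) \<le> dint V"
      using irregular_mass_integral[OF q, of V' \<delta>] irr \<beta> by linarith
    have a1: "(\<integral>p. ?a p \<partial>MM) = dint W' - dint U'"
    proof -
      have "(\<integral>p. ?a p \<partial>MM) = dint V'" using step_integral_avg[OF q V'b, of "\<lambda>_ _. 1"] by simp
      also have "\<dots> = dint W' - dint U'" by (simp add: V'_def)
      finally show ?thesis .
    qed
    have cut0: "0 \<le> cut_norm M (\<lambda>x y. W' x y - W x y)"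
      by (intro cut_norm_nonneg bmeas_diff W'b Wb)
    have db: "(\<lambda>p. ?W' p - ?W p) \<in> bmeas MM" by (intro bmeas_diff W'b Wb)
    have a2: "dint W - \<gamma> \<le> dint W'"
      using rectangle_le_cut_norm[of "\<lambda>x y. W' x y - W x y" UNIV UNIV] db cut sets.top[of M] by simp
    \<comment> \<open>Against \<phi> the average may be replaced by V', which lies below W'. The
      passage from W' to W is paid in cut-norm, that from W to s in L1.\<close>
    have a3: "(\<integral>p. ?\<phi> p * ?a p \<partial>MM) - (\<integral>p. ?\<phi> p * ?s p \<partial>MM) \<le> (real K)\<^sup>2 * \<gamma> + c / 16"
    proof -
      have "(\<integral>p. ?\<phi> p * ?a p \<partial>MM) - (\<integral>p. ?\<phi> p * ?s p \<partial>MM) = (\<integral>p. ?\<phi> p * ?V' p - ?\<phi> p * ?s p \<partial>MM)"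
        using step_integral_avg[OF q V'b, of \<phi>] by simp
      also have "\<dots> \<le> (\<integral>p. ?\<phi> p * (?W' p - ?W p) + \<bar>?W p - ?s p\<bar> \<partial>MM)"
      proof (rule integral_mono)
        fix p :: "'a \<times> 'a"
        have "?\<phi> p = 0 \<or> ?\<phi> p = 1" by (simp add: \<phi>_def)
        then show "?\<phi> p * ?V' p - ?\<phi> p * ?s p \<le> ?\<phi> p * (?W' p - ?W p) + \<bar>?W p - ?s p\<bar>"
          using V'1(2)[of "fst p" "snd p"] by auto
      qed simp_all
      also have "\<dots> = (\<integral>p. ?\<phi> p * (?W' p - ?W p) \<partial>MM) + (\<integral>p. \<bar>?W p - ?s p\<bar> \<partial>MM)" by simp
      also have "(\<integral>p. ?\<phi> p * (?W' p - ?W p) \<partial>MM) \<le> (\<Sum>i<n. \<Sum>j<n. \<bar>\<phi> i j\<bar>) * cut_norm M (\<lambda>x y. W' x y - W x y)"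
        using step_le_cut_norm[of "\<lambda>x y. W' x y - W x y", OF db q, of \<phi>] by simp
      also have "\<dots> \<le> (real K)\<^sup>2 * \<gamma>"
      proof (intro mult_mono cut cut0)
        have "(\<Sum>i<n. \<Sum>j<n. \<bar>\<phi> i j\<bar>) \<le> (\<Sum>i<n. \<Sum>j<n. 1)" by (intro sum_mono) (simp add: \<phi>_def)
        also have "\<dots> = (real n)\<^sup>2" by (simp add: power2_eq_square)
        also have "\<dots> \<le> (real K)\<^sup>2" using n by (intro power_mono) auto
        finally show "(\<Sum>i<n. \<Sum>j<n. \<bar>\<phi> i j\<bar>) \<le> (real K)\<^sup>2" .
      qed simp
      finally show ?thesis using \<beta> by simp
    qed
    have "dint U = dint W - dint V" by (simp add: U_def)
    also have "\<dots> \<le> eps + c"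
      using dV a1 a2 a3 le \<gamma>K \<delta>c c by (simp add: \<tau>_def algebra_simps)
    finally have "til_eps M eps k E W \<le> til M k E (\<lambda>x y. W x y - U x y) + eta"
      using V01 by (intro ex W U) (auto simp: U_def)
    also have "(\<lambda>x y. W x y - U x y) = V" by (simp add: U_def)
    also have "til M k E V \<le> til M k E V' + real (k + 1) * (real (card E) * \<delta> / \<tau> ^ card E)"
    proof (rule til_le_regular[OF k E V' q \<tau>])
      fix x y assume "V x y \<noteq> 0"
      then have "D (q x) (q y) \<noteq> 0" using graphonD(2)[OF W, of x y] by (auto simp: V_def)
      then show "regular_pair V' q \<delta> (q x) (q y) \<and> avg V' q (q x) (q y) \<ge> \<tau>"
        by (auto simp: D_def good_def split: if_splits)
    qed (use \<delta> in simp)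
    finally show ?thesis using \<delta>\<eta> by (simp add: V'_def[abs_def])
  qed
  show ?thesis
  proof (intro exI[of _ \<gamma>] conjI allI impI \<gamma>)
    fix W' assume W': "graphon M W'" and cut: "cut_norm M (\<lambda>x y. W' x y - W x y) \<le> \<gamma>"
    have "til_eps M eps k E W - 2 * eta \<le> til_eps M eps k E W'"
    proof (rule til_eps_geI[OF W'])
      fix U' assume "graphon M U'" "\<And>x y. U' x y \<le> W' x y" "dint U' \<le> eps"
      then show "til_eps M eps k E W - 2 * eta \<le> til M k E (\<lambda>x y. W' x y - U' x y)"
        using main[OF W' cut, of U'] by simp
    qed (use eps in simp)
    then show "til_eps M eps k E W \<le> til_eps M eps k E W' + 2 * eta" by simp
  qed
qed

end

theorem theorem3p10:
  fixes M :: "'a::polish_space measure"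
    and k :: nat and E :: "(nat \<times> nat) set" and eps :: real
    and Ws :: "nat \<Rightarrow> 'a \<Rightarrow> 'a \<Rightarrow> real" and W :: "'a \<Rightarrow> 'a \<Rightarrow> real"
  assumes "atomless_borel_prob M"
    and "k \<ge> 1" and "graph_on k E"
    and "eps > 0"
    and "graphon M W" and "\<And>n. graphon M (Ws n)"
    and "(\<lambda>n. cut_norm M (\<lambda>x y. Ws n x y - W x y)) \<longlonglongrightarrow> 0"
  shows "(\<lambda>n. til_eps M eps k E (Ws n)) \<longlonglongrightarrow> til_eps M eps k E W"
proof -
  interpret prob_space M using assms(1) by (simp add: atomless_borel_prob_def)
  have "space M = UNIV"
    using assms(1) by (metis atomless_borel_prob_def sets_eq_imp_space_eq space_borel)
  then interpret full_prob_space M by unfold_locales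
  note cover = atomless_finite_cover[OF assms(1)]
  show ?thesis
  proof (rule LIMSEQ_I)
    fix r :: real assume r: "r > 0"
    \<comment> \<open>Either direction loses at most 2 * eta, which is below r.\<close>
    define eta where "eta = r / 4"
    have eta: "eta > 0" using r by (simp add: eta_def)
    \<comment> \<open>A nearly optimal U exists, as otherwise the infimum would exceed itself by
      eta.\<close>
    have "\<exists>U. graphon M U \<and> (\<forall>x y. U x y \<le> W x y) \<and> dint U \<le> eps \<and>
        til M k E (\<lambda>x y. W x y - U x y) < til_eps M eps k E W + eta"
    proof (rule ccontr)
      assume "\<not> ?thesis"
      then have "til_eps M eps k E W + eta \<le> til_eps M eps k E W"
        using assms(4) by (intro til_eps_geI[OF assms(5)]) (force simp: not_less)+
      then show False using eta by simp
    qed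
    then obtain U where U: "graphon M U" "\<And>x y. U x y \<le> W x y" "dint U \<le> eps"
      and near: "til M k E (\<lambda>x y. W x y - U x y) < til_eps M eps k E W + eta" by blast
    obtain \<gamma>1 where g1: "\<gamma>1 > 0" "\<And>W'. graphon M W' \<Longrightarrow> cut_norm M (\<lambda>x y. W' x y - W x y) \<le> \<gamma>1 \<Longrightarrow>
        til_eps M eps k E W' \<le> til M k E (\<lambda>x y. W x y - U x y) + eta"
      using til_eps_upper[OF cover assms(2,3,4) eta assms(5) U] by blast
    obtain \<gamma>2 where g2: "\<gamma>2 > 0" "\<And>W'. graphon M W' \<Longrightarrow> cut_norm M (\<lambda>x y. W' x y - W x y) \<le> \<gamma>2 \<Longrightarrow>
        til_eps M eps k E W \<le> til_eps M eps k E W' + 2 * eta"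
      using til_eps_lower[OF cover assms(2,3,4) eta assms(5)] by blast
    have "eventually (\<lambda>n. cut_norm M (\<lambda>x y. Ws n x y - W x y) < min \<gamma>1 \<gamma>2) sequentially"
      using assms(7) by (rule order_tendstoD) (use g1 g2 in simp)
    then obtain n0 where n0: "\<And>n. n \<ge> n0 \<Longrightarrow> cut_norm M (\<lambda>x y. Ws n x y - W x y) < min \<gamma>1 \<gamma>2"
      by (auto simp: eventually_sequentially)
    show "\<exists>n0. \<forall>n\<ge>n0. norm (til_eps M eps k E (Ws n) - til_eps M eps k E W) < r"
    proof (intro exI[of _ n0] allI impI)
      fix n assume "n \<ge> n0"
      then have cut: "cut_norm M (\<lambda>x y. Ws n x y - W x y) \<le> \<gamma>1" "cut_norm M (\<lambda>x y. Ws n x y - W x y) \<le> \<gamma>2"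
        using n0[of n] by auto
      have "til_eps M eps k E (Ws n) < til_eps M eps k E W + 2 * eta"
        using g1(2)[OF assms(6) cut(1)] near by simp
      moreover have "til_eps M eps k E W \<le> til_eps M eps k E (Ws n) + 2 * eta"
        by (rule g2(2)[OF assms(6) cut(2)])
      ultimately show "norm (til_eps M eps k E (Ws n) - til_eps M eps k E W) < r"
        using r by (simp add: eta_def abs_less_iff)
    qed
  qed
qed

end
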